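(* Let $G$ be a complex semisimple Lie group. For every integer $k\ge0$ there exists $C_{G,k}>0$ such that $$\left|D_{\xi_1}\cdots D_{\xi_k}\,\varphi(\zeta,\cdot)(X)\right|\le C_{G,k}\,(1+\|\zeta\|)^k\,\varphi_0(X)\,e^{h_\Phi(\operatorname{Im}\zeta,X)}\,\mathcal R_\Phi(\zeta,X)$$ for all $\zeta\in\mathfrak a^*_{\mathbb C}$, $X\in\mathfrak a$, and unit vectors $\xi_1,\dots,\xi_k\in\mathfrak a$.
   Context: $G$ is a complex semisimple Lie group, $K$ a maximal compact subgroup, $\mathfrak g=\mathfrak k\oplus\mathfrak p$ the associated Cartan decomposition, $\mathfrak a\subset\mathfrak p$ a maximal abelian subspace, equipped with a Weyl-group-invariant inner product $\langle\cdot,\cdot\rangle$ (e.g. from the Killing form), transported to $\mathfrak a^*$ and extended complex bilinearly; $\|\cdot\|$ is the norm. $\Phi\subset\mathfrak a^*$ is the restricted root system of $G/K$ (it is reduced and every root has multiplicity two), $\Phi^+$ a positive system, $W$ the Weyl group, $\alpha^\vee=2\alpha/\langle\alpha,\alpha\rangle$, $\rho=\frac12\sum_{\alpha\in\Phi^+}\alpha$. For $\zeta\in\mathfrak a_{\mathbb C}^*$ write $\zeta=\lambda+i\eta$ with $\lambda,\eta\in\mathfrak a^*$, $\operatorname{Im}\zeta=\eta$, $\|\zeta\|=(\|\lambda\|^2+\|\eta\|^2)^{1/2}$. $\varphi(\zeta,X)$ is the spherical function of $G/K$ with spectral parameter $\zeta$ evaluated at $\exp X$, $X\in\mathfrak a$,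 normalized by $\varphi(\zeta,0)=1$, in the convention in which tempered parameters are real; explicitly, for regular parameters, $$\varphi(\zeta,X)=\frac{\pi^\vee(2\rho)}{\pi^\vee(i\zeta)}\,\frac{\sum_{w\in W}\det(w)e^{i\langle w\zeta,X\rangle}}{\prod_{\alpha\in\Phi^+}2\sinh\alpha(X)},\qquad \pi^\vee(\nu)=\prod_{\alpha\in\Phi^+}\langle\nu,\alpha^\vee\rangle,$$ extended by continuity to all $(\zeta,X)\in\mathfrak a_{\mathbb C}^*\times\mathfrak a$ (the extension is smooth in $X$ and entire in $\zeta$). Put $\varphi_0(X)=\varphi(0,X)$. Define $$\mathcal R_\Phi(\zeta,X)=\sum_{w\in W}\prod_{\alpha\in\Phi^+}\bigl(1+|\alpha(X)|\,|\langle w\zeta,\alpha^\vee\rangle|\bigr)^{-1},\qquad h_\Phi(\eta,X)=\max_{w\in W}\{-\langle w\eta,X\rangle\},$$ where $\langle w\eta,X\rangle=(w\eta)(X)$. $D_\xi$ is the directional derivative on $\mathfrak a$ in the direction $\xi$. *)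

theory Defs
  imports "HOL-Analysis.Analysis"
begin

text \<open>The complex Lie algebra \<open>\<gg>\<close> of \<open>G\<close> is given in coordinates: its underlying complex vector space is
  \<open>complex^'n\<close>, with scalar multiplication \<open>*s\<close>, and its bracket is an arbitrary function \<open>br\<close>
  subject to the axioms below. The inner product and the norm of \<open>complex^'n\<close> play no role.
  Hence \<open>vec.subspace\<close>, \<open>vec.span\<close> are over the complex numbers and \<open>subspace\<close> is over the reals.\<close>

definition complex_lie_algebra :: "(complex^'n \<Rightarrow> complex^'n \<Rightarrow> complex^'n) \<Rightarrow> bool" where
  "complex_lie_algebra br \<longleftrightarrow>
     (\<forall>x. Vector_Spaces.linear (*s) (*s) (br x)) \<and>
     (\<forall>y. Vector_Spaces.linear (*s) (*s) (\<lambda>x. br x y)) \<and>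
     (\<forall>x. br x x = 0) \<and>
     (\<forall>x y z. br x (br y z) + br y (br z x) + br z (br x y) = 0)"

definition lie_ideal :: "(complex^'n \<Rightarrow> complex^'n \<Rightarrow> complex^'n) \<Rightarrow> (complex^'n) set \<Rightarrow> bool" where
  "lie_ideal br I \<longleftrightarrow> vec.subspace I \<and> (\<forall>x. \<forall>y\<in>I. br x y \<in> I)"

definition derived_algebra ::
    "(complex^'n \<Rightarrow> complex^'n \<Rightarrow> complex^'n) \<Rightarrow> (complex^'n) set \<Rightarrow> (complex^'n) set" where
  "derived_algebra br I = vec.span {br x y | x y. x \<in> I \<and> y \<in> I}"

definition semisimple_lie_algebra :: "(complex^'n \<Rightarrow> complex^'n \<Rightarrow> complex^'n) \<Rightarrow> bool" where
  "semisimple_lie_algebra br \<longleftrightarrow>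
     (\<forall>I. lie_ideal br I \<and> (\<exists>m. (derived_algebra br ^^ m) I = {0}) \<longrightarrow> I = {0})"

text \<open>The Killing form of \<open>\<gg>\<close> regarded as a real Lie algebra: the real trace of a complex linear
  map is twice the real part of its complex trace.\<close>

definition killing :: "(complex^'n \<Rightarrow> complex^'n \<Rightarrow> complex^'n) \<Rightarrow> complex^'n \<Rightarrow> complex^'n \<Rightarrow> real" where
  "killing br x y = 2 * Re (trace (matrix (br x) ** matrix (br y)))"

definition cartan_decomposition ::
    "(complex^'n \<Rightarrow> complex^'n \<Rightarrow> complex^'n) \<Rightarrow> (complex^'n) set \<Rightarrow> (complex^'n) set \<Rightarrow> bool" where
  "cartan_decomposition br \<kk> \<pp> \<longleftrightarrow>
     subspace \<kk> \<and> subspace \<pp> \<and> \<kk> \<inter> \<pp> = {0} \<and> (\<forall>x. \<exists>y\<in>\<kk>. \<exists>z\<in>\<pp>. x = y + z) \<and>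
     (\<forall>x\<in>\<kk>. \<forall>y\<in>\<kk>. br x y \<in> \<kk>) \<and>
     (\<forall>x\<in>\<kk>. \<forall>y\<in>\<pp>. br x y \<in> \<pp>) \<and>
     (\<forall>x\<in>\<pp>. \<forall>y\<in>\<pp>. br x y \<in> \<kk>) \<and>
     (\<forall>x\<in>\<kk>. x \<noteq> 0 \<longrightarrow> killing br x x < 0) \<and>
     (\<forall>x\<in>\<pp>. x \<noteq> 0 \<longrightarrow> killing br x x > 0)"

definition abelian_subspace ::
    "(complex^'n \<Rightarrow> complex^'n \<Rightarrow> complex^'n) \<Rightarrow> (complex^'n) set \<Rightarrow> (complex^'n) set \<Rightarrow> bool" where
  "abelian_subspace br \<pp> \<bb> \<longleftrightarrow> subspace \<bb> \<and> \<bb> \<subseteq> \<pp> \<and> (\<forall>x\<in>\<bb>. \<forall>y\<in>\<bb>. br x y = 0)"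

text \<open>The maximal abelian subspace \<open>\<aa>\<close> is the image of a linear parametrization
  \<open>j :: real^'r \<Rightarrow> complex^'n\<close>. Through \<open>j\<close>, the standard inner product of \<open>real^'r\<close> becomes an
  inner product on \<open>\<aa>\<close>, and every inner product on \<open>\<aa>\<close> arises in this way from a suitable \<open>j\<close>.
  From here on \<open>\<aa>\<close> is \<open>real^'r\<close>.\<close>

definition maximal_abelian_param ::
    "(complex^'n \<Rightarrow> complex^'n \<Rightarrow> complex^'n) \<Rightarrow> (complex^'n) set \<Rightarrow> (real^'r \<Rightarrow> complex^'n) \<Rightarrow> bool" where
  "maximal_abelian_param br \<pp> j \<longleftrightarrow>
     linear j \<and> inj j \<and> abelian_subspace br \<pp> (range j) \<and>
     (\<forall>\<bb>. abelian_subspace br \<pp> \<bb> \<and> range j \<subseteq> \<bb> \<longrightarrow> \<bb> = range j)"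

text \<open>The dual \<open>\<aa>\<^sup>*\<close> is identified with \<open>\<aa>\<close> by the inner product: a vector \<open>\<alpha>\<close> stands for the
  functional \<open>X \<mapsto> \<alpha> \<bullet> X\<close>. The norm and the inner product of \<open>\<aa>\<^sup>*\<close> are then those of \<open>real^'r\<close>.\<close>

definition root_space ::
    "(complex^'n \<Rightarrow> complex^'n \<Rightarrow> complex^'n) \<Rightarrow> (real^'r \<Rightarrow> complex^'n) \<Rightarrow> real^'r \<Rightarrow> (complex^'n) set" where
  "root_space br j \<alpha> = {x. \<forall>H. br (j H) x = (\<alpha> \<bullet> H) *\<^sub>R x}"

definition roots ::
    "(complex^'n \<Rightarrow> complex^'n \<Rightarrow> complex^'n) \<Rightarrow> (real^'r \<Rightarrow> complex^'n) \<Rightarrow> (real^'r) set" where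
  "roots br j = {\<alpha>. \<alpha> \<noteq> 0 \<and> root_space br j \<alpha> \<noteq> {0}}"

text \<open>The Weyl group is generated by the reflections of \<open>\<aa>\<close> in the root hyperplanes that are
  orthogonal for the Killing form, so that its invariance is a genuine condition on the inner
  product of \<open>\<aa>\<close>. Here \<open>killing_dual br j \<alpha>\<close> is the vector \<open>H\<^sub>\<alpha>\<close> of \<open>\<aa>\<close> that represents the
  functional \<open>\<alpha>\<close> by the Killing form.\<close>

definition killing_dual ::
    "(complex^'n \<Rightarrow> complex^'n \<Rightarrow> complex^'n) \<Rightarrow> (real^'r \<Rightarrow> complex^'n) \<Rightarrow> real^'r \<Rightarrow> real^'r" where
  "killing_dual br j \<alpha> = (THE h. \<forall>H. killing br (j h) (j H) = \<alpha> \<bullet> H)"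

definition root_reflection ::
    "(complex^'n \<Rightarrow> complex^'n \<Rightarrow> complex^'n) \<Rightarrow> (real^'r \<Rightarrow> complex^'n) \<Rightarrow> real^'r \<Rightarrow> real^'r \<Rightarrow> real^'r" where
  "root_reflection br j \<alpha> H =
     H - (2 * (\<alpha> \<bullet> H) / (\<alpha> \<bullet> killing_dual br j \<alpha>)) *\<^sub>R killing_dual br j \<alpha>"

text \<open>Under a Weyl group invariant inner product the identification of \<open>\<aa>\<^sup>*\<close> with \<open>\<aa>\<close> is
  equivariant, so the same maps also give the action on \<open>\<aa>\<^sup>*\<close>.\<close>

inductive_set weyl_group ::
    "(complex^'n \<Rightarrow> complex^'n \<Rightarrow> complex^'n) \<Rightarrow> (real^'r \<Rightarrow> complex^'n) \<Rightarrow> (real^'r \<Rightarrow> real^'r) set"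
  for br :: "complex^'n \<Rightarrow> complex^'n \<Rightarrow> complex^'n" and j :: "real^'r \<Rightarrow> complex^'n" where
  "id \<in> weyl_group br j"
| "\<alpha> \<in> roots br j \<Longrightarrow> w \<in> weyl_group br j \<Longrightarrow> root_reflection br j \<alpha> \<circ> w \<in> weyl_group br j"

definition weyl_invariant_inner :: "(real^'r \<Rightarrow> real^'r) set \<Rightarrow> bool" where
  "weyl_invariant_inner W \<longleftrightarrow> (\<forall>w\<in>W. \<forall>x y. w x \<bullet> w y = x \<bullet> y)"

definition positive_system :: "(real^'r) set \<Rightarrow> (real^'r) set \<Rightarrow> bool" where
  "positive_system \<Phi> P \<longleftrightarrow> (\<exists>v. (\<forall>\<alpha>\<in>\<Phi>. \<alpha> \<bullet> v \<noteq> 0) \<and> P = {\<alpha>\<in>\<Phi>. \<alpha> \<bullet> v > 0})"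

text \<open>A spectral parameter \<open>\<zeta> = \<lambda> + i\<eta>\<close> is the pair \<open>(\<lambda>, \<eta>)\<close>; the norm of the product type is
  the Euclidean one, as required. \<open>cpair \<zeta> v\<close> is the complex bilinear pairing with a real
  vector \<open>v\<close>, which stands for an element of \<open>\<aa>\<close> or of \<open>\<aa>\<^sup>*\<close>.\<close>

type_synonym 'r spectral = "(real^'r) \<times> (real^'r)"

definition cpair :: "'r::finite spectral \<Rightarrow> real^'r \<Rightarrow> complex" where
  "cpair \<zeta> v = Complex (fst \<zeta> \<bullet> v) (snd \<zeta> \<bullet> v)"

definition act :: "(real^'r \<Rightarrow> real^'r) \<Rightarrow> 'r::finite spectral \<Rightarrow> 'r spectral" where
  "act w \<zeta> = (w (fst \<zeta>), w (snd \<zeta>))"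

definition times_i :: "'r::finite spectral \<Rightarrow> 'r spectral" where
  "times_i \<zeta> = (- snd \<zeta>, fst \<zeta>)"

definition coroot :: "real^'r \<Rightarrow> real^'r" where
  "coroot \<alpha> = (2 / (\<alpha> \<bullet> \<alpha>)) *\<^sub>R \<alpha>"

definition rho :: "(real^'r) set \<Rightarrow> real^'r" where
  "rho P = (1/2) *\<^sub>R (\<Sum>\<alpha>\<in>P. \<alpha>)"

definition pi_vee :: "(real^'r) set \<Rightarrow> 'r::finite spectral \<Rightarrow> complex" where
  "pi_vee P \<nu> = (\<Prod>\<alpha>\<in>P. cpair \<nu> (coroot \<alpha>))"

definition regular_set :: "(real^'r) set \<Rightarrow> ('r::finite spectral \<times> (real^'r)) set" where
  "regular_set P = {(\<zeta>, X). \<forall>\<alpha>\<in>P. cpair \<zeta> (coroot \<alpha>) \<noteq> 0 \<and> \<alpha> \<bullet> X \<noteq> 0}"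

definition spherical_regular ::
    "(real^'r \<Rightarrow> real^'r) set \<Rightarrow> (real^'r) set \<Rightarrow> 'r::finite spectral \<Rightarrow> real^'r \<Rightarrow> complex" where
  "spherical_regular W P \<zeta> X =
     pi_vee P (2 *\<^sub>R rho P, 0) / pi_vee P (times_i \<zeta>) *
     ((\<Sum>w\<in>W. of_real (det (matrix w)) * exp (\<i> * cpair (act w \<zeta>) X)) /
      of_real (\<Prod>\<alpha>\<in>P. 2 * sinh (\<alpha> \<bullet> X)))"

text \<open>The extension by continuity. The regular set is open and dense, and at a regular point the
  limit is the value of the formula.\<close>

definition spherical ::
    "(real^'r \<Rightarrow> real^'r) set \<Rightarrow> (real^'r) set \<Rightarrow> 'r::finite spectral \<Rightarrow> real^'r \<Rightarrow> complex" where
  "spherical W P \<zeta> X =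
     Lim (at (\<zeta>, X) within regular_set P) (\<lambda>(\<zeta>', X'). spherical_regular W P \<zeta>' X')"

text \<open>The value \<open>\<phi>(0, X)\<close> is real.\<close>

definition spherical0 :: "(real^'r \<Rightarrow> real^'r) set \<Rightarrow> (real^'r) set \<Rightarrow> real^'r::finite \<Rightarrow> real" where
  "spherical0 W P X = Re (spherical W P (0, 0) X)"

definition R_fun ::
    "(real^'r \<Rightarrow> real^'r) set \<Rightarrow> (real^'r) set \<Rightarrow> 'r::finite spectral \<Rightarrow> real^'r \<Rightarrow> real" where
  "R_fun W P \<zeta> X =
     (\<Sum>w\<in>W. \<Prod>\<alpha>\<in>P. inverse (1 + \<bar>\<alpha> \<bullet> X\<bar> * cmod (cpair (act w \<zeta>) (coroot \<alpha>))))"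

definition h_fun :: "(real^'r \<Rightarrow> real^'r) set \<Rightarrow> real^'r \<Rightarrow> real^'r::finite \<Rightarrow> real" where
  "h_fun W \<eta> X = Max ((\<lambda>w. - (w \<eta> \<bullet> X)) ` W)"

definition dir_deriv :: "real^'r \<Rightarrow> (real^'r \<Rightarrow> complex) \<Rightarrow> real^'r::finite \<Rightarrow> complex" where
  "dir_deriv \<xi> f X = vector_derivative (\<lambda>t. f (X + t *\<^sub>R \<xi>)) (at 0)"

end

theory Submission
  imports Defs "HOL-Complex_Analysis.Complex_Analysis"
begin

text \<open>The proof has an algebraic and an analytic half, which meet in the notion of a finite reduced
  root system \<open>\<Phi>\<close> in a Euclidean space with its reflection group \<open>W\<close>.

  The algebraic half produces this root system from the Lie algebra. The form
  \<open>ip x y = - B x (theta y)\<close>, made of the Killing form and the Cartan involution, is an inner product for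
  which \<open>ad x\<close> is self-adjoint when \<open>x \<in> \<pp>\<close>; so the root spaces are orthogonal and there are finitely
  many roots. A root vector \<open>e\<close> and \<open>- theta e\<close> generate a copy of \<open>sl\<^sub>2\<close>, and its strings show that
  the roots are closed under reflections. The roots are reduced because \<open>\<gg>\<close> is complex: a centroid
  argument gives \<open>\<i>\<kk> \<subseteq> \<pp>\<close>, so the centralizer of \<open>\<aa>\<close> is \<open>\<aa> + \<i>\<aa>\<close>, which maps a root vector to
  complex multiples of itself. Invariance of the inner product of \<open>\<aa>\<close> makes the Weyl group the group
  generated by the orthogonal reflections in the roots.

  The analytic half treats the alternating sum \<open>\<Sum>\<^sub>w det w exp \<langle>wz, X\<rangle>\<close> for complex \<open>z\<close> and \<open>X\<close>. The
  main estimate (\<open>alt_sum_bound\<close>) bounds it by \<open>\<Prod>\<^sub>\<alpha> |\<langle>z,\<alpha>\<rangle>| |\<langle>X,\<alpha>\<rangle>|\<close> times the exponential growth times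
  the sum of the decay products, by induction on the number of roots. Let \<open>m\<close> be the maximum of
  \<open>|\<langle>X,\<alpha>\<rangle>|\<close>, and let \<open>\<Psi>\<close> be the proper subsystem spanned by the roots on which \<open>X\<close> is much smaller than
  \<open>m\<close>. The sum over \<open>W\<close> is an average of the sums over the group of \<open>\<Psi>\<close> (\<open>alt_sum_average\<close>), to which the
  induction hypothesis applies. The factors \<open>\<langle>wz,\<alpha>\<rangle> \<langle>X,\<alpha>\<rangle>\<close> with \<open>\<alpha> \<notin> \<Psi>\<close> provide the missing decay as soon
  as every \<open>|\<langle>z,\<alpha>\<rangle>|\<close> is at least of order \<open>1/m\<close> (\<open>coset_step\<close>). This is achieved by moving \<open>z\<close> along a
  circle of radius of order \<open>1/m\<close> in the direction of the sum of the positive roots, where the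
  exponential growth changes by a bounded factor only, and the maximum principle for the quotient of
  the alternating sum by \<open>\<Prod>\<^sub>\<alpha> \<langle>z,\<alpha>\<rangle>\<close> leads back to the centre of the circle (\<open>alt_sum_bound_generic\<close>).

  By this estimate the quotient by \<open>\<Prod>\<^sub>\<alpha> \<langle>z,\<alpha>\<rangle> \<langle>X,\<alpha>\<rangle>\<close> is locally bounded, hence extends across all
  root hyperplanes to a function \<open>F\<close> holomorphic along complex lines (\<open>Riemann_extension\<close>). Then
  \<open>\<phi>(\<zeta>, X)\<close> is a positive constant times \<open>F(\<i>\<zeta>, X) \<Prod>\<^sub>\<alpha> \<alpha>(X) / sinh \<alpha>(X)\<close>. As \<open>F(0, X)\<close> is a positive
  constant (\<open>Harish_Chandra_normalization\<close>), \<open>\<phi>\<^sub>0\<close> is the product \<open>\<Prod>\<^sub>\<alpha> \<alpha>(X) / sinh \<alpha>(X)\<close> up to a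
  constant, and the case \<open>k = 0\<close> follows. All bounds hold for complex \<open>X\<close> and change by a constant
  factor when \<open>X\<close> moves by a small multiple of \<open>1 / (1 + \<parallel>\<zeta>\<parallel>)\<close>; Cauchy estimates on discs of this
  radius therefore give the derivatives, with one factor \<open>1 + \<parallel>\<zeta>\<parallel>\<close> for each.\<close>

section \<open>The Killing form and the Cartan involution\<close>

text \<open>The trace over the reals. The Cartan involution is only real linear, so its effect on the Killing
  form is visible on this trace and not on the complex one.\<close>

definition rtrace :: "('v::euclidean_space \<Rightarrow> 'v) \<Rightarrow> real" where
  "rtrace T = (\<Sum>b\<in>Basis. T b \<bullet> b)"

lemma rtrace_commute:
  fixes S T :: "'a::euclidean_space \<Rightarrow> 'a"
  assumes "linear S" "linear T"
  shows "rtrace (\<lambda>x. S (T x)) = rtrace (\<lambda>x. T (S x))"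
proof -
  have key: "rtrace (\<lambda>x. S (T x)) = (\<Sum>b\<in>Basis. \<Sum>c\<in>Basis. (T b \<bullet> c) * (S c \<bullet> b))"
    if "linear S" "linear T" for S T :: "'a \<Rightarrow> 'a"
  proof -
    have "S (T b) \<bullet> b = (\<Sum>c\<in>Basis. (T b \<bullet> c) * (S c \<bullet> b))" for b
    proof -
      have "S (T b) = S (\<Sum>c\<in>Basis. (T b \<bullet> c) *\<^sub>R c)" by (simp add: euclidean_representation)
      also have "\<dots> = (\<Sum>c\<in>Basis. (T b \<bullet> c) *\<^sub>R S c)"
        using that(1) by (simp add: linear_sum linear_cmul)
      finally show ?thesis by (simp add: inner_sum_left)
    qed
    then show ?thesis by (simp add: rtrace_def)
  qed
  show ?thesis
    unfolding key[OF assms] key[OF assms(2) assms(1)]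
    by (subst sum.swap) (simp add: mult.commute)
qed

lemma rtrace_add: "rtrace (\<lambda>x. S x + T x) = rtrace S + rtrace T"
  by (simp add: rtrace_def inner_add_left sum.distrib)

lemma rtrace_minus: "rtrace (\<lambda>x. - S x) = - rtrace S"
  by (simp add: rtrace_def sum_negf)

lemma rtrace_scaleR: "rtrace (\<lambda>x. r *\<^sub>R S x) = r * rtrace S"
  by (simp add: rtrace_def sum_distrib_left)

lemma Basis_complex_vec:
  "(Basis :: (complex^'n) set) = range (\<lambda>i. axis i 1) \<union> range (\<lambda>i. axis i \<i>)"
  by (auto simp: Basis_vec_def Basis_complex_def)

lemma clinear_scale:
  fixes f :: "complex^'n \<Rightarrow> complex^'n"
  assumes "Vector_Spaces.linear (*s) (*s) f"
  shows "f (c *s x) = c *s f x"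
  using assms by (simp add: Vector_Spaces.linear_def module_hom_def module_hom_axioms_def)

lemma clinear_add:
  fixes f :: "complex^'n \<Rightarrow> complex^'n"
  assumes "Vector_Spaces.linear (*s) (*s) f"
  shows "f (x + y) = f x + f y"
  using assms by (simp add: Vector_Spaces.linear_def module_hom_def module_hom_axioms_def)

text \<open>A complex coordinate \<open>e\<close> contributes the two real basis vectors \<open>e\<close> and \<open>\<i>e\<close>, with the same diagonal
  entry because \<open>f\<close> commutes with \<open>\<i>\<close>.\<close>

lemma rtrace_complex_matrix:
  fixes f :: "complex^'n \<Rightarrow> complex^'n"
  assumes f: "Vector_Spaces.linear (*s) (*s) f"
  shows "rtrace f = 2 * Re (trace (matrix f))"
proof -
  have sc: "f (c *s x) = c *s f x" for c x
    by (rule clinear_scale[OF f])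
  have fi: "f (axis i \<i>) = \<i> *s f (axis i 1)" for i
  proof -
    have "axis i \<i> = \<i> *s axis i (1::complex)"
      by (simp add: vec_eq_iff axis_def)
    then show ?thesis by (simp add: sc)
  qed
  have disj: "range (\<lambda>i::'n. axis i (1::complex)) \<inter> range (\<lambda>i. axis i \<i>) = {}"
    by (auto simp: axis_eq_axis complex_eq_iff)
  have inj: "inj (\<lambda>i::'n. axis i (1::complex))" "inj (\<lambda>i::'n. axis i \<i>)"
    by (auto simp: inj_def axis_eq_axis)
  have "rtrace f = (\<Sum>i\<in>UNIV. f (axis i 1) \<bullet> axis i 1) + (\<Sum>i\<in>UNIV. f (axis i \<i>) \<bullet> axis i \<i>)"
    unfolding rtrace_def Basis_complex_vec
    by (subst sum.union_disjoint) (use disj inj in \<open>auto simp: sum.reindex\<close>)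
  also have "\<dots> = (\<Sum>i\<in>UNIV. Re (f (axis i 1) $ i)) + (\<Sum>i\<in>UNIV. Re (f (axis i 1) $ i))"
    by (simp add: fi inner_axis inner_complex_def)
  also have "\<dots> = 2 * Re (trace (matrix f))"
    by (simp add: trace_def matrix_def Re_sum)
  finally show ?thesis .
qed

lemma scaleR_eq_vector_scalar: "r *\<^sub>R (x::complex^'n) = complex_of_real r *s x"
  unfolding vec_eq_iff vector_scaleR_component vector_smult_component
  by (simp add: scaleR_conv_of_real)

locale cartan_lie_algebra =
  fixes br :: "complex^'n \<Rightarrow> complex^'n \<Rightarrow> complex^'n" and kk pp :: "(complex^'n) set"
  assumes lie: "complex_lie_algebra br" and cartan: "cartan_decomposition br kk pp"
begin

lemma clinear_right: "Vector_Spaces.linear (*s) (*s) (br x)"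
  and clinear_left: "Vector_Spaces.linear (*s) (*s) (\<lambda>x. br x y)"
  and br_self: "br x x = 0"
  and jacobi: "br x (br y z) + br y (br z x) + br z (br x y) = 0"
  using lie by (auto simp: complex_lie_algebra_def)

lemma br_scale_right: "br x (c *s y) = c *s br x y"
  by (rule clinear_scale[OF clinear_right])
lemma br_scale_left: "br (c *s x) y = c *s br x y"
  by (rule clinear_scale[OF clinear_left])
lemma br_add_right: "br x (y + z) = br x y + br x z"
  by (rule clinear_add[OF clinear_right])
lemma br_add_left: "br (x + y) z = br x z + br y z"
  by (rule clinear_add[OF clinear_left])
lemma br_scaleR_right: "br x (c *\<^sub>R y) = c *\<^sub>R br x y"
  by (simp add: scaleR_eq_vector_scalar br_scale_right)
lemma br_scaleR_left: "br (c *\<^sub>R x) y = c *\<^sub>R br x y"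
  by (simp add: scaleR_eq_vector_scalar br_scale_left)
lemma linear_br_right: "linear (br x)"
  by (intro linearI br_add_right br_scaleR_right)
lemma linear_br_left: "linear (\<lambda>x. br x y)"
  by (intro linearI br_add_left br_scaleR_left)
lemmas br_simps = linear_0[OF linear_br_right] linear_0[OF linear_br_left]
  linear_diff[OF linear_br_right] linear_diff[OF linear_br_left]
  linear_neg[OF linear_br_right] linear_neg[OF linear_br_left]
  br_add_left br_add_right br_scaleR_left br_scaleR_right br_scale_left br_scale_right

lemma br_skew: "br x y = - br y x"
proof -
  have "br (x + y) (x + y) = 0" by (rule br_self)
  then have "br x y + br y x = 0" by (simp only: br_add_left br_add_right) (simp add: br_self add.commute)
  then show ?thesis by (simp add: eq_neg_iff_add_eq_0)
qed

text \<open>The Jacobi identity, read as the derivation property of \<open>ad x\<close>.\<close>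

lemma br_deriv: "br x (br y z) = br (br x y) z + br y (br x z)"
proof -
  have "br x (br y z) + br y (br z x) + br z (br x y) = 0" by (rule jacobi)
  moreover have "br y (br z x) = - br y (br x z)"
    by (subst br_skew[of z x]) (simp add: br_simps)
  moreover have "br z (br x y) = - br (br x y) z" by (rule br_skew)
  ultimately show ?thesis by (simp add: algebra_simps)
qed

abbreviation B :: "complex^'n \<Rightarrow> complex^'n \<Rightarrow> real" where "B \<equiv> killing br"

lemma killing_rtrace: "B x y = rtrace (\<lambda>v. br x (br y v))"
proof -
  have "matrix (br x) ** matrix (br y) = matrix (br x \<circ> br y)"
    by (rule matrix_compose_gen[symmetric]) (rule clinear_right)+
  moreover have "Vector_Spaces.linear (*s) (*s) (br x \<circ> br y)"
    by (rule Vector_Spaces.linear_compose) (rule clinear_right)+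
  ultimately show ?thesis
    using rtrace_complex_matrix[of "br x \<circ> br y"] by (simp add: killing_def o_def)
qed

lemma B_sym: "B x y = B y x"
  unfolding killing_rtrace by (rule rtrace_commute) (rule linear_br_right)+

lemma B_add_left: "B (x + y) z = B x z + B y z"
  by (simp add: killing_rtrace br_simps rtrace_add)
lemma B_scaleR_left: "B (r *\<^sub>R x) z = r * B x z"
  by (simp add: killing_rtrace br_simps rtrace_scaleR)
lemma B_add_right: "B z (x + y) = B z x + B z y"
  by (simp add: B_sym[of z] B_add_left)
lemma B_scaleR_right: "B z (r *\<^sub>R x) = r * B z x"
  by (simp add: B_sym[of z] B_scaleR_left)
lemma B_minus_left: "B (- x) z = - B x z" using B_scaleR_left[of "-1"] by simp
lemma B_minus_right: "B z (- x) = - B z x" using B_scaleR_right[of _ "-1"] by simp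
lemma B_zero: "B 0 z = 0" "B z 0 = 0"
  using B_scaleR_left[of 0] B_scaleR_right[of _ 0] by simp_all
lemmas B_simps = B_add_left B_add_right B_scaleR_left B_scaleR_right B_minus_left B_minus_right B_zero

text \<open>The operator \<open>ad [x,y]\<close> is a commutator, and the trace is cyclic.\<close>

lemma B_invariant: "B (br x y) z = B x (br y z)"
proof -
  have l: "linear (\<lambda>v. br a (br b v))" for a b
    using linear_compose[OF linear_br_right linear_br_right] by (simp add: o_def)
  have e1: "br (br x y) (br z v) = br x (br y (br z v)) + - br y (br x (br z v))" for v
    using br_deriv[of x y "br z v"] by simp
  have e2: "br x (br (br y z) v) = br x (br y (br z v)) + - br x (br z (br y v))" for v
    using br_deriv[of y z v] by (simp add: br_simps)
  have "rtrace (\<lambda>v. br y (br x (br z v))) = rtrace (\<lambda>v. br x (br z (br y v)))"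
    by (rule rtrace_commute[OF linear_br_right l])
  then show ?thesis
    unfolding killing_rtrace e1 e2 rtrace_add rtrace_minus by simp
qed

lemma sub_kk: "subspace kk" and sub_pp: "subspace pp" and kk_pp: "kk \<inter> pp = {0}"
  and kk_kk: "x \<in> kk \<Longrightarrow> y \<in> kk \<Longrightarrow> br x y \<in> kk"
  and kk_pp_br: "x \<in> kk \<Longrightarrow> y \<in> pp \<Longrightarrow> br x y \<in> pp"
  and pp_pp_br: "x \<in> pp \<Longrightarrow> y \<in> pp \<Longrightarrow> br x y \<in> kk"
  and neg_kk: "x \<in> kk \<Longrightarrow> x \<noteq> 0 \<Longrightarrow> B x x < 0"
  and pos_pp: "x \<in> pp \<Longrightarrow> x \<noteq> 0 \<Longrightarrow> B x x > 0"
  and decomp: "\<exists>y\<in>kk. \<exists>z\<in>pp. x = y + z"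
  using cartan unfolding cartan_decomposition_def by blast+

lemma pp_kk_br: "x \<in> pp \<Longrightarrow> y \<in> kk \<Longrightarrow> br x y \<in> pp"
  using kk_pp_br[of y x] br_skew[of x y] subspace_neg[OF sub_pp] by simp

definition kpart :: "complex^'n \<Rightarrow> complex^'n" where
  "kpart x = (SOME y. y \<in> kk \<and> x - y \<in> pp)"

lemma kpart: "kpart x \<in> kk" "x - kpart x \<in> pp"
proof -
  have "\<exists>y. y \<in> kk \<and> x - y \<in> pp" using decomp[of x] by auto
  from someI_ex[OF this] show "kpart x \<in> kk" "x - kpart x \<in> pp"
    by (auto simp: kpart_def)
qed

lemma kpart_unique: "kpart (y + z) = y" if "y \<in> kk" "z \<in> pp"
proof -
  have "kpart (y + z) - y \<in> kk" by (intro subspace_diff[OF sub_kk] kpart that)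
  moreover have "(y + z - kpart (y + z)) - z \<in> pp" by (intro subspace_diff[OF sub_pp] kpart that)
  then have "- (kpart (y + z) - y) \<in> pp" by (simp add: algebra_simps)
  then have "kpart (y + z) - y \<in> pp" using subspace_neg[OF sub_pp, of "- (kpart (y + z) - y)"] by simp
  ultimately have "kpart (y + z) - y \<in> kk \<inter> pp" by (rule IntI)
  then show ?thesis by (simp only: kk_pp) simp
qed

definition theta :: "complex^'n \<Rightarrow> complex^'n" where
  "theta x = kpart x - (x - kpart x)"

lemma theta_eq: "theta (y + z) = y - z" if "y \<in> kk" "z \<in> pp"
  using that by (simp add: theta_def kpart_unique)

lemma theta_kk: "x \<in> kk \<Longrightarrow> theta x = x"
  using theta_eq[of x 0] subspace_0[OF sub_pp] by simp
lemma theta_pp: "x \<in> pp \<Longrightarrow> theta x = - x"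
  using theta_eq[of 0 x] subspace_0[OF sub_kk] by simp

lemma kp_cases: obtains y z where "y \<in> kk" "z \<in> pp" "x = y + z"
  using decomp by blast

lemma linear_theta: "linear theta"
proof (rule linearI)
  fix x x' :: "complex^'n" and r :: real
  obtain y z where 1: "y \<in> kk" "z \<in> pp" "x = y + z" by (rule kp_cases)
  obtain y' z' where 2: "y' \<in> kk" "z' \<in> pp" "x' = y' + z'" by (rule kp_cases)
  have "theta ((y + y') + (z + z')) = (y + y') - (z + z')"
    by (intro theta_eq subspace_add sub_kk sub_pp 1 2)
  moreover have "x + x' = (y + y') + (z + z')" using 1(3) 2(3) by simp
  ultimately have "theta (x + x') = (y + y') - (z + z')" by (simp only:)
  then show "theta (x + x') = theta x + theta x'"
    using theta_eq[OF 1(1,2), folded 1(3)] theta_eq[OF 2(1,2), folded 2(3)] by simp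
  have "theta (r *\<^sub>R y + r *\<^sub>R z) = r *\<^sub>R y - r *\<^sub>R z"
    by (intro theta_eq subspace_scale sub_kk sub_pp 1 2)
  then show "theta (r *\<^sub>R x) = r *\<^sub>R theta x"
    using theta_eq[OF 1(1,2), folded 1(3)] 1(3) by (simp add: scaleR_diff_right scaleR_add_right)
qed

lemmas theta_simps = linear_0[OF linear_theta] linear_add[OF linear_theta] linear_neg[OF linear_theta]
  linear_diff[OF linear_theta] linear_cmul[OF linear_theta]

lemma theta_theta [simp]: "theta (theta x) = x"
proof -
  obtain y z where 1: "y \<in> kk" "z \<in> pp" "x = y + z" by (rule kp_cases)
  then show ?thesis by (simp add: theta_simps theta_kk theta_pp)
qed

lemma theta_br: "theta (br x y) = br (theta x) (theta y)"
proof -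
  obtain a b where 1: "a \<in> kk" "b \<in> pp" "x = a + b" by (rule kp_cases)
  obtain c d where 2: "c \<in> kk" "d \<in> pp" "y = c + d" by (rule kp_cases)
  have "theta (br a c) = br a c" "theta (br b d) = br b d" "theta (br a d) = - br a d" "theta (br b c) = - br b c"
    using 1 2 kk_kk pp_pp_br kk_pp_br pp_kk_br by (auto intro!: theta_kk theta_pp)
  then show ?thesis using 1 2 by (simp add: theta_simps br_simps theta_kk theta_pp algebra_simps)
qed

text \<open>An automorphism conjugates \<open>ad x\<close> to \<open>ad (theta x)\<close>, which does not change traces. The eigenspaces \<open>\<kk>\<close>
  and \<open>\<pp>\<close> of \<open>theta\<close> are orthogonal for the Killing form as a consequence.\<close>

lemma B_theta: "B (theta x) (theta y) = B x y"
proof -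
  have l: "linear (\<lambda>v. br a (br b v))" for a b
    using linear_compose[OF linear_br_right linear_br_right] by (simp add: o_def)
  have "B (theta x) (theta y) = rtrace (\<lambda>v. theta (br x (br y (theta v))))"
    by (simp add: killing_rtrace theta_br)
  also have "\<dots> = rtrace (\<lambda>v. br x (br y (theta (theta v))))"
    using rtrace_commute[OF linear_theta linear_compose[OF linear_theta l]] by (simp add: o_def)
  finally show ?thesis by (simp add: killing_rtrace)
qed

lemma B_kk_pp: "x \<in> kk \<Longrightarrow> y \<in> pp \<Longrightarrow> B x y = 0"
  using B_theta[of x y] by (simp add: theta_kk theta_pp B_simps)

text \<open>The Cartan involution changes the sign of the Killing form exactly on the negative definite part, so
  this is an inner product.\<close>

definition ip :: "complex^'n \<Rightarrow> complex^'n \<Rightarrow> real" where "ip x y = - B x (theta y)"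

lemma ip_pos: "x \<noteq> 0 \<Longrightarrow> ip x x > 0"
proof -
  assume x: "x \<noteq> 0"
  obtain a b where 1: "a \<in> kk" "b \<in> pp" "x = a + b" by (rule kp_cases)
  have "ip x x = - B a a + B b b"
    using 1 B_kk_pp[of a b] B_sym[of b a] B_add_right[of _ a "- b"]
    by (simp add: ip_def theta_simps theta_kk theta_pp B_simps)
  moreover have "a \<noteq> 0 \<or> b \<noteq> 0" using x 1 by auto
  moreover have "- B a a \<ge> 0" "B b b \<ge> 0"
    using neg_kk[OF 1(1)] pos_pp[OF 1(2)] B_zero by (cases "a = 0"; cases "b = 0"; force)+
  moreover have "a \<noteq> 0 \<Longrightarrow> - B a a > 0" "b \<noteq> 0 \<Longrightarrow> B b b > 0"
    using neg_kk pos_pp 1 by auto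
  ultimately show ?thesis by linarith
qed

lemma ip_simps: "ip (x + y) z = ip x z + ip y z" "ip z (x + y) = ip z x + ip z y"
  "ip (r *\<^sub>R x) z = r * ip x z" "ip z (r *\<^sub>R x) = r * ip z x"
  "ip (- x) z = - ip x z" "ip z (- x) = - ip z x" "ip 0 z = 0" "ip z 0 = 0"
  by (simp_all add: ip_def B_simps theta_simps)

text \<open>On \<open>\<pp>\<close>, where \<open>theta\<close> is \<open>-1\<close>, this says that \<open>ad z\<close> is self-adjoint. For \<open>z = e\<close> a root vector it makes
  \<open>ad (- theta e)\<close> the adjoint of \<open>ad e\<close>.\<close>

lemma ip_adjoint: "ip (br z x) y = - ip x (br (theta z) y)"
proof -
  have "ip (br z x) y = B (br x z) (theta y)" by (simp add: ip_def br_skew[of z x] B_simps)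
  also have "\<dots> = B x (br z (theta y))" by (rule B_invariant)
  also have "\<dots> = - ip x (br (theta z) y)" by (simp add: ip_def theta_br)
  finally show ?thesis .
qed

text \<open>A central element is orthogonal to everything for the Killing form, which is nondegenerate.\<close>

lemma center_trivial: "c = 0" if "\<And>y. br c y = 0"
proof (rule ccontr)
  assume "c \<noteq> 0"
  then have "ip c c > 0" by (rule ip_pos)
  moreover have "B c y = 0" for y by (simp add: killing_rtrace that rtrace_def)
  ultimately show False by (simp add: ip_def)
qed

text \<open>This is the place where the complex structure enters: \<open>\<kk>\<close> is a compact real form. The multiplication
  \<open>J\<close> by \<open>\<i>\<close> and its conjugate \<open>J'\<close> by the Cartan involution both commute with the adjoint
  representation. Since the centre is trivial they commute with each other, whence \<open>N = (J + J') / 2\<close>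
  satisfies \<open>N\<^sup>3 = - N\<close>. It preserves \<open>\<kk>\<close> and is symmetric for the Killing form, so that
  \<open>B (N\<^sup>2 x) (N\<^sup>2 x) = - B (N x) (N x)\<close> for \<open>x \<in> \<kk>\<close>; as \<open>B\<close> is negative definite on \<open>\<kk>\<close>, this forces
  \<open>N x = 0\<close>. But \<open>N x\<close> is the \<open>\<kk>\<close>-part of \<open>\<i>x\<close>.\<close>

lemma i_kk_subset_pp: "\<i> *s x \<in> pp" if x: "x \<in> kk"
proof -
  define J where "J \<equiv> \<lambda>x::complex^'n. \<i> *s x"
  define J' where "J' x = theta (J (theta x))" for x
  define N where "N x = (1/2) *\<^sub>R (J x + J' x)" for x
  have JJ: "J (J x) = - x" for x by (simp add: J_def vec_eq_iff)
  have J'J': "J' (J' x) = - x" for x by (simp add: J'_def JJ theta_simps)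
  have Jadd: "J (x + y) = J x + J y" for x y by (simp add: J_def vec_eq_iff algebra_simps)
  have Jsc: "J (r *\<^sub>R y) = r *\<^sub>R J y" for r y by (simp add: J_def vec_eq_iff)
  have linJ: "linear J" by (intro linearI Jadd Jsc)
  have linJ': "linear J'" unfolding J'_def
    using linear_compose[OF linear_compose[OF linear_theta linJ] linear_theta] by (simp add: o_def)
  have linN: "linear N" unfolding N_def
    by (intro linear_compose_scale_right linear_compose_add linJ linJ')
  have Jr: "br x (J y) = J (br x y)" and Jl: "br (J x) y = J (br x y)" for x y
    by (simp_all add: J_def br_simps)
  have J'r: "br x (J' y) = J' (br x y)" for x y
    using arg_cong[OF Jr[of "theta x" "theta y"], of theta] by (simp add: J'_def theta_br)
  have J'l: "br (J' x) y = J' (br x y)" for x y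
    using arg_cong[OF Jl[of "theta x" "theta y"], of theta] by (simp add: J'_def theta_br)
  have comm: "J (J' x) = J' (J x)" for x
  proof -
    have "br (J (J' x) - J' (J x)) y = 0" for y
    proof -
      have "br (J (J' x)) y = br (J' x) (J y)" by (simp only: Jr Jl)
      also have "\<dots> = J' (br x (J y))" by (rule J'l)
      also have "\<dots> = br (J' (J x)) y" by (simp only: J'l Jr Jl)
      finally show ?thesis by (simp add: br_simps)
    qed
    from center_trivial[OF this] show ?thesis by simp
  qed
  have Nr: "br x (N y) = N (br x y)" and Nl: "br (N x) y = N (br x y)" for x y
    by (simp_all add: N_def br_simps Jr Jl J'r J'l)
  have N3: "N (N (N x)) = - N x" for x
  proof -
    have a: "N (N y) = (1/2) *\<^sub>R (J (J' y) - y)" for y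
    proof -
      have "N (N y) = (1/4) *\<^sub>R (J (J y) + J (J' y) + (J' (J y) + J' (J' y)))"
        by (simp add: N_def linear_add[OF linJ] linear_add[OF linJ'] linear_cmul[OF linJ] linear_cmul[OF linJ']
            scaleR_add_right)
      also have "J (J y) + J (J' y) + (J' (J y) + J' (J' y)) = 2 *\<^sub>R (J (J' y) - y)"
        by (simp add: JJ J'J' comm scaleR_2)
      finally show ?thesis by simp
    qed
    have b: "J (J' (N y)) = - N y" for y
    proof -
      have "J (J' (J y)) = - J' y" by (simp add: comm[symmetric] JJ)
      moreover have "J (J' (J' y)) = - J y" by (simp add: J'J' linear_neg[OF linJ])
      ultimately show ?thesis
        by (simp add: N_def linear_add[OF linJ] linear_add[OF linJ'] linear_cmul[OF linJ] linear_cmul[OF linJ'] algebra_simps)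
    qed
    have "N (N (N x)) = (1/2) *\<^sub>R (- N x - N x)" unfolding a[of "N x"] b ..
    also have "\<dots> = (1/2) *\<^sub>R ((- 2) *\<^sub>R N x)" by (simp only: scaleR_minus_left scaleR_2) simp
    finally show ?thesis by simp
  qed
  have l: "linear (\<lambda>v. br a (br b v))" for a b
    using linear_compose[OF linear_br_right linear_br_right] by (simp add: o_def)
  have BN: "B (N x) y = B x (N y)" for x y
    by (simp add: killing_rtrace Nl Nr)
  have Nth: "N (theta x) = theta (N x)" for x
    by (simp add: N_def J'_def theta_simps)
  have Nkk: "N x \<in> kk" if "x \<in> kk" for x
  proof -
    obtain a b where 1: "a \<in> kk" "b \<in> pp" "N x = a + b" by (rule kp_cases)
    have "a + b = a - b" using Nth[of x] theta_eq[OF 1(1,2)] 1(3) theta_kk[OF that] by simp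
    then have "2 *\<^sub>R b = 0" by (simp add: scaleR_2 algebra_simps)
    then have "b = 0" by simp
    then show ?thesis using 1 by simp
  qed
  have "B (N (N x)) (N (N x)) = - B (N x) (N x)"
    by (simp add: BN[of "N x"] N3 B_simps)
  moreover have "B (N (N x)) (N (N x)) \<le> 0" "N x \<noteq> 0 \<Longrightarrow> B (N x) (N x) < 0"
    using Nkk x neg_kk[of "N (N x)"] neg_kk[of "N x"] B_zero by (cases "N (N x) = 0"; force)+
  ultimately have "N x = 0" by fastforce
  then have e: "J x + theta (J x) = 0" using theta_kk[OF x] by (simp add: N_def J'_def)
  obtain a b where 1: "a \<in> kk" "b \<in> pp" "J x = a + b" by (rule kp_cases)
  have "2 *\<^sub>R a = 0" using e 1 theta_eq[OF 1(1,2)] by (simp add: scaleR_2)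
  then have "J x = b" using 1 by simp
  then show ?thesis using 1 by (simp add: J_def)
qed

end

section \<open>Restricted roots\<close>

locale restricted_roots = cartan_lie_algebra br kk pp
  for br :: "complex^'n \<Rightarrow> complex^'n \<Rightarrow> complex^'n" and kk pp +
  fixes j :: "real^'r \<Rightarrow> complex^'n"
  assumes maxab: "maximal_abelian_param br pp j"
begin

lemma linear_j: "linear j" and inj_j: "inj j" and j_pp: "j H \<in> pp" and j_br: "br (j H) (j H') = 0"
  using maxab by (auto simp: maximal_abelian_param_def abelian_subspace_def)

text \<open>Otherwise \<open>\<aa> + \<real>z\<close> would be a larger abelian subspace.\<close>

lemma centralizer_pp:
  assumes z: "z \<in> pp" and c: "\<And>H. br (j H) z = 0"
  shows "\<exists>H. z = j H"
proof -
  let ?b = "{j H + r *\<^sub>R z | H r. True}"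
  have "subspace ?b"
  proof (rule subspaceI)
    show "0 \<in> ?b" using linear_0[OF linear_j] by (auto intro!: exI[of _ 0])
  next
    fix x y assume "x \<in> ?b" "y \<in> ?b"
    then obtain H r H' r' where "x = j H + r *\<^sub>R z" "y = j H' + r' *\<^sub>R z" by blast
    then have "x + y = j (H + H') + (r + r') *\<^sub>R z"
      by (simp add: linear_add[OF linear_j] algebra_simps)
    then show "x + y \<in> ?b" by blast
  next
    fix c x assume "x \<in> ?b"
    then obtain H r where "x = j H + r *\<^sub>R z" by blast
    then have "c *\<^sub>R x = j (c *\<^sub>R H) + (c * r) *\<^sub>R z"
      by (simp add: linear_cmul[OF linear_j] algebra_simps)
    then show "c *\<^sub>R x \<in> ?b" by blast
  qed
  moreover have "?b \<subseteq> pp"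
    using j_pp z by (auto intro!: subspace_add[OF sub_pp] subspace_scale[OF sub_pp])
  moreover have "\<forall>x\<in>?b. \<forall>y\<in>?b. br x y = 0"
    using c br_skew[of z] by (auto simp: br_simps j_br br_self)
  ultimately have "abelian_subspace br pp ?b" by (auto simp: abelian_subspace_def)
  moreover have "range j \<subseteq> ?b"
  proof
    fix x assume "x \<in> range j"
    then obtain H where "x = j H + 0 *\<^sub>R z" by auto
    then show "x \<in> ?b" by blast
  qed
  ultimately have "?b = range j" using maxab unfolding maximal_abelian_param_def by blast
  moreover have "z = j 0 + 1 *\<^sub>R z" using linear_0[OF linear_j] by simp
  then have "z \<in> ?b" by blast
  ultimately show ?thesis by auto
qed

text \<open>The parts of \<open>x\<close> in \<open>\<kk>\<close> and \<open>\<pp>\<close> commute with \<open>\<aa>\<close> separately, and multiplication by \<open>\<i>\<close> moves the first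
  one into \<open>\<pp>\<close>, where maximality of \<open>\<aa>\<close> applies to both.\<close>

lemma centralizer:
  assumes c: "\<And>H. br (j H) x = 0"
  shows "\<exists>H1 H2. x = j H1 + \<i> *s j H2"
proof -
  obtain a b where 1: "a \<in> kk" "b \<in> pp" "x = a + b" by (rule kp_cases)
  have ab: "br (j H) a = 0 \<and> br (j H) b = 0" for H
  proof -
    have "br (j H) a \<in> pp" "br (j H) b \<in> kk" using 1 j_pp pp_kk_br pp_pp_br by auto
    moreover have s: "br (j H) a + br (j H) b = 0" using c[of H] 1 by (simp add: br_simps)
    moreover have "br (j H) b = - br (j H) a" using s by (simp add: eq_neg_iff_add_eq_0 add.commute)
    ultimately have "br (j H) a \<in> kk \<inter> pp" using subspace_neg[OF sub_kk, of "br (j H) b"] by simp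
    then have "br (j H) a = 0" by (simp only: kk_pp) simp
    then show ?thesis using s by simp
  qed
  obtain H1 where H1: "b = j H1" using centralizer_pp[OF 1(2)] ab by blast
  have "br (j H) (\<i> *s a) = 0" for H using ab by (simp add: br_simps)
  then obtain H2 where "\<i> *s a = j H2" using centralizer_pp[OF i_kk_subset_pp[OF 1(1)]] by blast
  then have "\<i> *s (\<i> *s a) = \<i> *s j H2" by simp
  then have "a = - (\<i> *s j H2)" by (simp add: vec_eq_iff) (metis minus_equation_iff)
  then have "a = \<i> *s j (- H2)" by (simp add: linear_neg[OF linear_j] vec_eq_iff)
  then show ?thesis using H1 1 by (metis add.commute)
qed

abbreviation gs :: "real^'r \<Rightarrow> (complex^'n) set" where "gs \<equiv> root_space br j"

lemma gs_iff: "x \<in> gs \<alpha> \<longleftrightarrow> (\<forall>H. br (j H) x = (\<alpha> \<bullet> H) *\<^sub>R x)"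
  by (simp add: root_space_def)

lemma gs_D: "x \<in> gs \<alpha> \<Longrightarrow> br (j H) x = (\<alpha> \<bullet> H) *\<^sub>R x"
  by (simp add: gs_iff)

lemma zero_gs: "0 \<in> gs \<alpha>" by (simp add: gs_iff br_simps)

lemma gs_add: "x \<in> gs \<alpha> \<Longrightarrow> y \<in> gs \<beta> \<Longrightarrow> br x y \<in> gs (\<alpha> + \<beta>)"
  by (auto simp: gs_iff br_deriv[of "j _" x y] br_simps inner_add_left scaleR_add_left)

text \<open>The Cartan involution is \<open>-1\<close> on \<open>\<aa>\<close>.\<close>

lemma gs_theta: "x \<in> gs \<alpha> \<Longrightarrow> theta x \<in> gs (- \<alpha>)"
proof -
  assume x: "x \<in> gs \<alpha>"
  have "br (j H) (theta x) = theta (br (- j H) x)" for H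
    using theta_pp[OF j_pp, of H] by (simp add: theta_br theta_simps)
  then show ?thesis using gs_D[OF x] by (simp add: gs_iff br_simps theta_simps)
qed

lemma ip_ad_j: "ip (br (j H) x) y = ip x (br (j H) y)"
  using ip_adjoint[of "j H" x y] theta_pp[OF j_pp, of H] by (simp add: br_simps ip_simps)

text \<open>Eigenvectors of a self-adjoint operator to different eigenvalues are orthogonal.\<close>

lemma gs_orth: "x \<in> gs \<alpha> \<Longrightarrow> y \<in> gs \<beta> \<Longrightarrow> \<alpha> \<noteq> \<beta> \<Longrightarrow> ip x y = 0"
proof -
  assume x: "x \<in> gs \<alpha>" and y: "y \<in> gs \<beta>" and ne: "\<alpha> \<noteq> \<beta>"
  have "(\<alpha> \<bullet> (\<alpha> - \<beta>)) * ip x y = (\<beta> \<bullet> (\<alpha> - \<beta>)) * ip x y"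
    using ip_ad_j[of "\<alpha> - \<beta>" x y] by (simp add: gs_D[OF x] gs_D[OF y] ip_simps)
  then have "((\<alpha> - \<beta>) \<bullet> (\<alpha> - \<beta>)) * ip x y = 0" by (simp add: inner_diff_left algebra_simps)
  then show ?thesis using ne by simp
qed

lemma gs_nonzero: "gs \<alpha> \<noteq> {0} \<Longrightarrow> \<exists>x. x \<in> gs \<alpha> \<and> x \<noteq> 0"
  using zero_gs by blast

lemma finite_weights: "finite {\<alpha>. gs \<alpha> \<noteq> {0}}"
proof -
  let ?S = "{\<alpha>. gs \<alpha> \<noteq> {0}}"
  define x where "x \<alpha> = (SOME x. x \<in> gs \<alpha> \<and> x \<noteq> 0)" for \<alpha>
  have x: "x \<alpha> \<in> gs \<alpha>" "x \<alpha> \<noteq> 0" if "\<alpha> \<in> ?S" for \<alpha>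
    using someI_ex[OF gs_nonzero[of \<alpha>]] that by (simp_all add: x_def)
  have orth: "ip (x \<alpha>) (x \<beta>) = 0" if "\<alpha> \<in> ?S" "\<beta> \<in> ?S" "\<alpha> \<noteq> \<beta>" for \<alpha> \<beta>
    by (rule gs_orth[OF x(1) x(1)]) (rule that)+
  have pos: "ip (x \<alpha>) (x \<alpha>) > 0" if "\<alpha> \<in> ?S" for \<alpha>
    by (rule ip_pos[OF x(2)[OF that]])
  have inj: "inj_on x ?S"
  proof (rule inj_onI, rule ccontr)
    fix \<alpha> \<beta> assume a: "\<alpha> \<in> ?S" "\<beta> \<in> ?S" "x \<alpha> = x \<beta>" "\<alpha> \<noteq> \<beta>"
    then show False using orth[OF a(1,2,4)] pos[OF a(1)] by simp
  qed
  have "independent (x ` ?S)"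
  proof (rule real_vector.independent_explicit_module[THEN iffD2], intro allI impI)
    fix T f v assume T: "finite T" "T \<subseteq> x ` ?S" "(\<Sum>v\<in>T. f v *\<^sub>R v) = 0" "v \<in> T"
    obtain \<beta> where \<beta>: "\<beta> \<in> ?S" "v = x \<beta>" by (rule imageE[OF subsetD[OF T(2,4)]])
    have o: "ip u v = 0" if u: "u \<in> T" "u \<noteq> v" for u
    proof -
      obtain \<alpha> where \<alpha>: "\<alpha> \<in> ?S" "u = x \<alpha>" by (rule imageE[OF subsetD[OF T(2) u(1)]])
      have "\<alpha> \<noteq> \<beta>" using u(2) \<alpha>(2) \<beta>(2) by metis
      then show ?thesis using orth[OF \<alpha>(1) \<beta>(1)] \<alpha>(2) \<beta>(2) by simp
    qed
    have "0 = ip (\<Sum>v\<in>T. f v *\<^sub>R v) v" by (simp only: T(3) ip_simps)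
    also have "\<dots> = (\<Sum>u\<in>T. f u * ip u v)"
      using T(1) by induction (simp_all add: ip_simps)
    also have "\<dots> = f v * ip v v + (\<Sum>u\<in>T - {v}. f u * ip u v)"
      by (rule sum.remove[OF T(1,4)])
    also have "(\<Sum>u\<in>T - {v}. f u * ip u v) = 0"
      by (rule sum.neutral) (simp add: o)
    finally show "f v = 0" using pos[OF \<beta>(1)] \<beta>(2) by simp
  qed
  then have "finite (x ` ?S)" by (rule independent_imp_finite)
  then show ?thesis using inj by (rule finite_imageD)
qed

lemma finite_roots: "finite (roots br j)"
  by (rule finite_subset[OF _ finite_weights]) (auto simp: roots_def)

lemma roots_iff: "\<alpha> \<in> roots br j \<longleftrightarrow> \<alpha> \<noteq> 0 \<and> gs \<alpha> \<noteq> {0}" by (simp add: roots_def)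

lemma root_gs: "\<alpha> \<in> roots br j \<Longrightarrow> gs \<alpha> \<noteq> {0}" by (simp add: roots_iff)

lemma roots_neg: "\<alpha> \<in> roots br j \<Longrightarrow> - \<alpha> \<in> roots br j"
proof -
  assume a: "\<alpha> \<in> roots br j"
  then obtain x where "x \<in> gs \<alpha>" "x \<noteq> 0" using zero_gs by (auto simp: roots_iff)
  then have "theta x \<in> gs (- \<alpha>)" "theta x \<noteq> 0" using gs_theta theta_simps(1) theta_theta by metis+
  then show ?thesis using a by (auto simp: roots_iff)
qed

abbreviation kd :: "real^'r \<Rightarrow> real^'r" where "kd \<equiv> killing_dual br j"

lemma B_j_pos: "H \<noteq> 0 \<Longrightarrow> B (j H) (j H) > 0"
  using pos_pp[OF j_pp, of H] linear_0[OF linear_j] inj_j by (metis injD)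

text \<open>The Killing form is positive definite on \<open>\<aa>\<close>.\<close>

lemma killing_dual_unique: "(\<And>H. B (j h) (j H) = \<alpha> \<bullet> H) \<Longrightarrow> kd \<alpha> = h"
proof -
  assume h: "\<And>H. B (j h) (j H) = \<alpha> \<bullet> H"
  have "h' = h" if "\<forall>H. B (j h') (j H) = \<alpha> \<bullet> H" for h'
  proof (rule ccontr)
    assume "h' \<noteq> h"
    then have "B (j (h' - h)) (j (h' - h)) > 0" by (intro B_j_pos) simp
    moreover have "B (j (h' - h)) (j H) = 0" for H
      using that h[of H] B_add_left[of "j h'" "- j h"]
      by (simp add: linear_diff[OF linear_j] B_minus_left)
    ultimately show False by simp
  qed
  then show ?thesis unfolding killing_dual_def by (intro the_equality) (use h in auto)
qed

lemma killing_dual_exists: "\<exists>h. \<forall>H. B (j h) (j H) = \<alpha> \<bullet> H"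
proof -
  define T where "T h = (\<Sum>b\<in>Basis. B (j h) (j b) *\<^sub>R b)" for h
  have linB: "linear (\<lambda>H. B (j h) (j H))" "linear (\<lambda>h. B (j h) (j H))" for h H
    by (auto intro!: linearI simp: linear_add[OF linear_j] linear_cmul[OF linear_j] B_simps)
  have T: "T h \<bullet> H = B (j h) (j H)" for h H
  proof -
    have "B (j h) (j H) = B (j h) (j (\<Sum>b\<in>Basis. (H \<bullet> b) *\<^sub>R b))" by (simp add: euclidean_representation)
    also have "\<dots> = (\<Sum>b\<in>Basis. (H \<bullet> b) * B (j h) (j b))"
      using linear_sum[OF linB(1), of h "\<lambda>b. (H \<bullet> b) *\<^sub>R b" Basis] linear_cmul[OF linB(1)] by simp
    also have "\<dots> = T h \<bullet> H" unfolding T_def inner_sum_left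
      by (intro sum.cong) (auto simp: inner_commute)
    finally show ?thesis by simp
  qed
  have "linear T" unfolding T_def
    by (intro linear_compose_sum ballI linearI) (simp_all add: linear_add[OF linear_j] linear_cmul[OF linear_j] B_simps algebra_simps)
  moreover have "inj T"
  proof (subst linear_injective_0[OF \<open>linear T\<close>], intro allI impI)
    fix h assume "T h = 0"
    then have "B (j h) (j h) = 0" using T[of h h] by simp
    then show "h = 0" using B_j_pos[of h] by force
  qed
  ultimately have "surj T" by (rule linear_inj_imp_surj)
  then obtain h where "T h = \<alpha>" by (metis surjD)
  then show ?thesis using T by metis
qed

lemma B_kd: "B (j (kd \<alpha>)) (j H) = \<alpha> \<bullet> H"
  using killing_dual_exists[of \<alpha>] killing_dual_unique by metis

lemma kd_neg: "kd (- \<alpha>) = - kd \<alpha>"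
  by (rule killing_dual_unique) (simp add: linear_neg[OF linear_j] B_simps B_kd)

lemma kd_pos: "\<alpha> \<noteq> 0 \<Longrightarrow> \<alpha> \<bullet> kd \<alpha> > 0"
proof -
  assume "\<alpha> \<noteq> 0"
  then have "kd \<alpha> \<noteq> 0" using B_kd[of \<alpha> \<alpha>] linear_0[OF linear_j] B_zero by auto
  then show ?thesis using B_j_pos[of "kd \<alpha>"] B_kd[of \<alpha> "kd \<alpha>"] by simp
qed

text \<open>The bracket lies in the zero weight space, and in \<open>\<pp>\<close> because \<open>theta\<close> changes its sign. So it lies in
  \<open>\<aa>\<close>, where the invariance of the Killing form identifies it.\<close>

lemma sl2_bracket:
  assumes e: "e \<in> gs \<alpha>"
  shows "br e (- theta e) = j (ip e e *\<^sub>R kd \<alpha>)"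
proof -
  let ?f = "- theta e"
  have f: "?f \<in> gs (- \<alpha>)" using gs_theta[OF e] by (simp add: gs_iff br_simps)
  have "theta (br e ?f) = br (theta e) (- e)" by (simp add: theta_br theta_simps)
  also have "\<dots> = - br e ?f" using br_skew[of "theta e" e] by (simp add: br_simps)
  finally have "theta (br e ?f) = - br e ?f" .
  moreover obtain a b where 1: "a \<in> kk" "b \<in> pp" "br e ?f = a + b" by (rule kp_cases)
  ultimately have "a - b = - (a + b)" using theta_eq[OF 1(1,2)] by simp
  then have "2 *\<^sub>R a = 0" by (simp add: scaleR_2 algebra_simps)
  then have "br e ?f \<in> pp" using 1 by simp
  moreover have "br (j H) (br e ?f) = 0" for H
    using gs_add[OF e f] gs_D[of "br e ?f" 0 H] by simp
  ultimately obtain h where h: "br e ?f = j h" using centralizer_pp by blast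
  have "B (j h) (j H) = ip e e * (\<alpha> \<bullet> H)" for H
  proof -
    have "B (br e ?f) (j H) = B e (br ?f (j H))" by (rule B_invariant)
    also have "br ?f (j H) = (\<alpha> \<bullet> H) *\<^sub>R ?f" using gs_D[OF f, of H] br_skew[of ?f "j H"] by simp
    also have "B e ((\<alpha> \<bullet> H) *\<^sub>R ?f) = (\<alpha> \<bullet> H) * ip e e"
      unfolding B_scaleR_right by (simp add: ip_def B_simps)
    finally show ?thesis by (simp add: h)
  qed
  moreover have "B (j (ip e e *\<^sub>R kd \<alpha>)) (j H) = ip e e * (\<alpha> \<bullet> H)" for H
    by (simp add: linear_cmul[OF linear_j] B_simps B_kd)
  ultimately have "kd (ip e e *\<^sub>R \<alpha>) = h" "kd (ip e e *\<^sub>R \<alpha>) = ip e e *\<^sub>R kd \<alpha>"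
    by (intro killing_dual_unique; simp)+
  then show ?thesis using h by simp
qed

text \<open>The part of \<open>sl\<^sub>2\<close>-theory that is needed, for a vector \<open>v\<close> that \<open>e\<close> annihilates. With \<open>u k = f\<^sup>k v\<close> and
  \<open>f = - theta e\<close> one has \<open>[e, u (k + 1)] = c (k + 1) u k\<close> for an explicit quadratic \<open>c\<close>; since \<open>f\<close> is the
  adjoint of \<open>e\<close>, also \<open>\<parallel>u (k + 1)\<parallel>\<^sup>2 = c (k + 1) \<parallel>u k\<parallel>\<^sup>2\<close>. There are finitely many weights, so the string
  stops, say after \<open>u K\<close>, and the root \<open>K + 1\<close> of \<open>c\<close> gives the integrality of the weight.\<close>

lemma string:
  assumes a: "\<alpha> \<noteq> 0" and e: "e \<in> gs \<alpha>" "e \<noteq> 0" and v: "v \<in> gs \<gamma>" "v \<noteq> 0" and top: "br e v = 0"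
  defines "u \<equiv> \<lambda>k. (br (- theta e) ^^ k) v"
  shows "\<exists>K::nat. 2 * (\<gamma> \<bullet> kd \<alpha>) / (\<alpha> \<bullet> kd \<alpha>) = real K \<and>
     (\<forall>k\<le>K. u k \<noteq> 0 \<and> u k \<in> gs (\<gamma> - real k *\<^sub>R \<alpha>)) \<and>
     (\<forall>k<K. \<exists>c\<noteq>0. br e (u (Suc k)) = c *\<^sub>R u k)"
proof -
  let ?f = "- theta e"
  define s where "s = ip e e"
  have s: "s > 0" using ip_pos e by (simp add: s_def)
  define c where "c k = s * (real k * (\<gamma> \<bullet> kd \<alpha>) - real k * (real k - 1) / 2 * (\<alpha> \<bullet> kd \<alpha>))" for k :: nat
  have f: "?f \<in> gs (- \<alpha>)" using gs_theta[OF e(1)] by (simp add: gs_iff br_simps)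
  have uS: "u (Suc k) = br ?f (u k)" for k by (simp add: u_def)
  have ugs: "u k \<in> gs (\<gamma> - real k *\<^sub>R \<alpha>)" for k
  proof (induction k)
    case 0 then show ?case using v by (simp add: u_def)
  next
    case (Suc k)
    have eq: "- \<alpha> + (\<gamma> - real k *\<^sub>R \<alpha>) = \<gamma> - real (Suc k) *\<^sub>R \<alpha>" by (simp add: algebra_simps)
    from gs_add[OF f Suc] show ?case unfolding eq uS .
  qed
  have raise: "br e (u (Suc k)) = c (Suc k) *\<^sub>R u k" for k
  proof (induction k)
    case 0
    have "br e (br ?f v) = br (br e ?f) v + br ?f (br e v)" by (rule br_deriv)
    also have "\<dots> = (\<gamma> \<bullet> (s *\<^sub>R kd \<alpha>)) *\<^sub>R v"
      by (simp only: sl2_bracket[OF e(1)] top gs_D[OF v(1)] s_def linear_0[OF linear_br_right] add_0_right)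
    finally show ?case by (simp add: u_def c_def)
  next
    case (Suc k)
    have "br e (u (Suc (Suc k))) = br (br e ?f) (u (Suc k)) + br ?f (br e (u (Suc k)))"
      unfolding uS[of "Suc k"] by (rule br_deriv)
    also have "br (br e ?f) (u (Suc k)) = ((\<gamma> - real (Suc k) *\<^sub>R \<alpha>) \<bullet> (s *\<^sub>R kd \<alpha>)) *\<^sub>R u (Suc k)"
      by (simp only: sl2_bracket[OF e(1)] gs_D[OF ugs] s_def)
    also have "br ?f (br e (u (Suc k))) = c (Suc k) *\<^sub>R u (Suc k)"
      by (simp only: Suc br_scaleR_right flip: uS)
    finally have "br e (u (Suc (Suc k))) =
        ((\<gamma> - real (Suc k) *\<^sub>R \<alpha>) \<bullet> (s *\<^sub>R kd \<alpha>) + c (Suc k)) *\<^sub>R u (Suc k)"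
      by (simp only: scaleR_add_left)
    also have "(\<gamma> - real (Suc k) *\<^sub>R \<alpha>) \<bullet> (s *\<^sub>R kd \<alpha>) + c (Suc k) = c (Suc (Suc k))"
      by (simp add: c_def inner_diff_left inner_add_left field_simps)
    finally show ?case .
  qed
  have norm: "ip (u (Suc k)) (u (Suc k)) = c (Suc k) * ip (u k) (u k)" for k
  proof -
    have "ip (u (Suc k)) (u (Suc k)) = - ip (u k) (br (theta ?f) (u (Suc k)))"
      by (subst (1) uS) (rule ip_adjoint)
    also have "br (theta ?f) (u (Suc k)) = - (c (Suc k) *\<^sub>R u k)"
      using raise[of k] by (simp add: theta_simps br_simps)
    finally show ?thesis by (simp add: ip_simps)
  qed
  have "\<exists>k. u k = 0"
  proof (rule ccontr)
    assume "\<not> ?thesis"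
    then have "range (\<lambda>k::nat. \<gamma> - real k *\<^sub>R \<alpha>) \<subseteq> {\<alpha>. gs \<alpha> \<noteq> {0}}" using ugs by blast
    then have "finite (range (\<lambda>k::nat. \<gamma> - real k *\<^sub>R \<alpha>))" using finite_weights finite_subset by blast
    moreover have "inj (\<lambda>k::nat. \<gamma> - real k *\<^sub>R \<alpha>)" using a by (auto simp: inj_def)
    ultimately show False using range_inj_infinite by blast
  qed
  define M where "M = (LEAST k. u k = 0)"
  have uM: "u M = 0" unfolding M_def using \<open>\<exists>k. u k = 0\<close> by (rule LeastI_ex)
  have nz: "u k \<noteq> 0" if "k < M" for k using not_less_Least[of k] that by (auto simp: M_def)
  have "M \<noteq> 0" using uM v by (cases M) (auto simp: u_def)
  then obtain K where K: "M = Suc K" by (cases M) auto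
  have "c (Suc K) = 0" using norm[of K] uM nz[of K] ip_pos[of "u K"] by (simp add: K ip_simps)
  then have "real (Suc K) * ((\<gamma> \<bullet> kd \<alpha>) - real K / 2 * (\<alpha> \<bullet> kd \<alpha>)) = 0"
  proof -
    have "real (Suc K) * (\<gamma> \<bullet> kd \<alpha>) - real (Suc K) * (real (Suc K) - 1) / 2 * (\<alpha> \<bullet> kd \<alpha>) = 0"
      using \<open>c (Suc K) = 0\<close> s unfolding c_def mult_eq_0_iff by blast
    then show ?thesis by (simp add: algebra_simps)
  qed
  then have "\<gamma> \<bullet> kd \<alpha> = real K / 2 * (\<alpha> \<bullet> kd \<alpha>)" by simp
  then have "2 * (\<gamma> \<bullet> kd \<alpha>) / (\<alpha> \<bullet> kd \<alpha>) = real K" using kd_pos[OF a] by (simp add: field_simps)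
  moreover have "\<exists>c\<noteq>0. br e (u (Suc k)) = c *\<^sub>R u k" if "k < K" for k
  proof -
    have "c (Suc k) \<noteq> 0" using norm[of k] nz[of "Suc k"] ip_pos[of "u (Suc k)"] that by (auto simp: K)
    then show ?thesis using raise by blast
  qed
  ultimately show ?thesis using nz ugs by (intro exI[of _ K]) (auto simp: K)
qed

lemma string_top:
  assumes a: "\<alpha> \<noteq> 0" and b: "gs \<beta> \<noteq> {0}"
  shows "\<exists>n::nat. gs (\<beta> + real n *\<^sub>R \<alpha>) \<noteq> {0} \<and> gs (\<beta> + real (Suc n) *\<^sub>R \<alpha>) = {0}"
proof (rule ccontr)
  assume n: "\<not> ?thesis"
  have w: "gs (\<beta> + real n *\<^sub>R \<alpha>) \<noteq> {0}" for n
  proof (induction n)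
    case 0 show ?case using b by simp
  next
    case (Suc m)
    show ?case
    proof
      assume "gs (\<beta> + real (Suc m) *\<^sub>R \<alpha>) = {0}"
      with Suc have "gs (\<beta> + real m *\<^sub>R \<alpha>) \<noteq> {0} \<and> gs (\<beta> + real (Suc m) *\<^sub>R \<alpha>) = {0}" by (rule conjI)
      then show False by (rule notE[OF n exI])
    qed
  qed
  have "range (\<lambda>k::nat. \<beta> + real k *\<^sub>R \<alpha>) \<subseteq> {\<alpha>. gs \<alpha> \<noteq> {0}}"
    by (intro image_subsetI CollectI w)
  then have "finite (range (\<lambda>k::nat. \<beta> + real k *\<^sub>R \<alpha>))" by (rule finite_subset[OF _ finite_weights])
  moreover have "inj (\<lambda>k::nat. \<beta> + real k *\<^sub>R \<alpha>)" using a by (auto simp: inj_def)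
  then have "infinite (range (\<lambda>k::nat. \<beta> + real k *\<^sub>R \<alpha>))" by (rule range_inj_infinite)
  ultimately show False by (rule notE[rotated])
qed

text \<open>The last weight space of the string in the direction of \<open>\<alpha>\<close>.\<close>

lemma top_vector:
  assumes a: "\<alpha> \<in> roots br j" and b: "gs \<beta> \<noteq> {0}"
  obtains e n v where "e \<in> gs \<alpha>" "e \<noteq> 0" "v \<in> gs (\<beta> + real n *\<^sub>R \<alpha>)" "v \<noteq> 0" "br e v = 0"
proof -
  have a0: "\<alpha> \<noteq> 0" using a by (simp add: roots_iff)
  obtain n :: nat where n: "gs (\<beta> + real n *\<^sub>R \<alpha>) \<noteq> {0}" "gs (\<beta> + real (Suc n) *\<^sub>R \<alpha>) = {0}"
    using string_top[OF a0 b] by blast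
  obtain e where e: "e \<in> gs \<alpha>" "e \<noteq> 0" using gs_nonzero[OF root_gs[OF a]] by blast
  obtain v where v: "v \<in> gs (\<beta> + real n *\<^sub>R \<alpha>)" "v \<noteq> 0" using gs_nonzero[OF n(1)] by blast
  have "br e v \<in> gs (\<alpha> + (\<beta> + real n *\<^sub>R \<alpha>))" by (rule gs_add[OF e(1) v(1)])
  also have "\<alpha> + (\<beta> + real n *\<^sub>R \<alpha>) = \<beta> + real (Suc n) *\<^sub>R \<alpha>" by (simp add: algebra_simps)
  finally have "br e v = 0" using n by simp
  then show ?thesis by (rule that[OF e v])
qed

text \<open>The vectors below the top of the string have the weights \<open>K, K - 2, \<dots>, - K\<close>, as multiples of \<open>\<alpha>/2\<close>. One of
  them is the weight of \<open>\<beta>\<close>, and so is its opposite, whose place in the string is \<open>K - n\<close>.\<close>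

lemma roots_reflection_pos:
  assumes a: "\<alpha> \<in> roots br j" and b: "\<beta> \<in> roots br j"
  defines "m \<equiv> 2 * (\<beta> \<bullet> kd \<alpha>) / (\<alpha> \<bullet> kd \<alpha>)"
  assumes m: "m \<ge> 0"
  shows "gs (\<beta> - m *\<^sub>R \<alpha>) \<noteq> {0}"
proof -
  have a0: "\<alpha> \<noteq> 0" using a by (simp add: roots_iff)
  obtain e n v where ev: "e \<in> gs \<alpha>" "e \<noteq> 0" "v \<in> gs (\<beta> + real n *\<^sub>R \<alpha>)" "v \<noteq> 0" "br e v = 0"
    by (rule top_vector[OF a root_gs[OF b]])
  note str = string[OF a0 ev]
  obtain K :: nat where K: "2 * ((\<beta> + real n *\<^sub>R \<alpha>) \<bullet> kd \<alpha>) / (\<alpha> \<bullet> kd \<alpha>) = real K"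
    and u: "\<forall>k\<le>K. (br (- theta e) ^^ k) v \<noteq> 0 \<and>
      (br (- theta e) ^^ k) v \<in> gs (\<beta> + real n *\<^sub>R \<alpha> - real k *\<^sub>R \<alpha>)"
    using str by (elim exE conjE)
  have K2: "m + 2 * real n = real K"
    using K kd_pos[OF a0] by (simp add: m_def inner_add_left field_simps)
  then have "n \<le> K" using m by linarith
  have u': "(br (- theta e) ^^ (K - n)) v \<noteq> 0"
      "(br (- theta e) ^^ (K - n)) v \<in> gs (\<beta> + real n *\<^sub>R \<alpha> - real (K - n) *\<^sub>R \<alpha>)"
    using u by simp_all
  have "real (K - n) = m + real n" using K2 \<open>n \<le> K\<close> by (simp add: of_nat_diff)
  then have "\<beta> + real n *\<^sub>R \<alpha> - real (K - n) *\<^sub>R \<alpha> = \<beta> - m *\<^sub>R \<alpha>" by (simp add: algebra_simps)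
  from u'(2)[unfolded this] show ?thesis using u'(1) by (metis singletonD)
qed

lemma roots_reflection:
  assumes a: "\<alpha> \<in> roots br j" and b: "\<beta> \<in> roots br j"
  shows "gs (\<beta> - (2 * (\<beta> \<bullet> kd \<alpha>) / (\<alpha> \<bullet> kd \<alpha>)) *\<^sub>R \<alpha>) \<noteq> {0}"
proof (cases "2 * (\<beta> \<bullet> kd \<alpha>) / (\<alpha> \<bullet> kd \<alpha>) \<ge> 0")
  case True
  then show ?thesis by (rule roots_reflection_pos[OF a b])
next
  case False
  have "- \<alpha> \<bullet> kd (- \<alpha>) = \<alpha> \<bullet> kd \<alpha>" by (simp add: kd_neg)
  moreover have "2 * (\<beta> \<bullet> kd (- \<alpha>)) = - (2 * (\<beta> \<bullet> kd \<alpha>))" by (simp add: kd_neg)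
  ultimately have m: "2 * (\<beta> \<bullet> kd (- \<alpha>)) / (- \<alpha> \<bullet> kd (- \<alpha>)) = - (2 * (\<beta> \<bullet> kd \<alpha>) / (\<alpha> \<bullet> kd \<alpha>))"
    by (simp only: minus_divide_left)
  with False have "0 \<le> 2 * (\<beta> \<bullet> kd (- \<alpha>)) / (- \<alpha> \<bullet> kd (- \<alpha>))" by linarith
  from roots_reflection_pos[OF roots_neg[OF a] b this] show ?thesis
    unfolding m scaleR_minus_left scaleR_minus_right minus_minus .
qed

text \<open>If the string through \<open>c\<alpha>\<close> has integral multiples of \<open>\<alpha>\<close> as its weights, it passes through the weight
  zero. There \<open>w = f\<^sup>q v\<close> lies in \<open>\<aa> + \<i>\<aa>\<close>, so \<open>[e, w]\<close> is a complex multiple of \<open>e\<close> and \<open>[e, [e, w]] = 0\<close>; but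
  \<open>[e, [e, w]]\<close> is a nonzero multiple of an earlier vector of the string. The remaining possibility is that \<open>\<alpha>/2\<close> is a weight,
  and that \<open>c\<close> is no integer.\<close>

lemma no_multiple:
  assumes a: "\<alpha> \<in> roots br j" and c: "c > 1" "c *\<^sub>R \<alpha> \<in> roots br j"
  shows "(1/2) *\<^sub>R \<alpha> \<in> roots br j \<and> (\<forall>i::nat. c \<noteq> real i)"
proof -
  have a0: "\<alpha> \<noteq> 0" using a by (simp add: roots_iff)
  obtain e n v where ev: "e \<in> gs \<alpha>" "e \<noteq> 0" "v \<in> gs (c *\<^sub>R \<alpha> + real n *\<^sub>R \<alpha>)" "v \<noteq> 0" "br e v = 0"
    by (rule top_vector[OF a root_gs[OF c(2)]])
  let ?u = "\<lambda>k. (br (- theta e) ^^ k) v"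
  note str = string[OF a0 ev]
  obtain K :: nat where K: "2 * ((c *\<^sub>R \<alpha> + real n *\<^sub>R \<alpha>) \<bullet> kd \<alpha>) / (\<alpha> \<bullet> kd \<alpha>) = real K"
    and u': "\<forall>k\<le>K. ?u k \<noteq> 0 \<and> ?u k \<in> gs (c *\<^sub>R \<alpha> + real n *\<^sub>R \<alpha> - real k *\<^sub>R \<alpha>)"
    and r': "\<forall>k<K. \<exists>c\<noteq>0. br e (?u (Suc k)) = c *\<^sub>R ?u k"
    using str by (elim exE conjE)
  have u: "?u k \<noteq> 0" "?u k \<in> gs (c *\<^sub>R \<alpha> + real n *\<^sub>R \<alpha> - real k *\<^sub>R \<alpha>)" if "k \<le> K" for k
    using u' that by simp_all
  have r: "\<exists>c\<noteq>0. br e (?u (Suc k)) = c *\<^sub>R ?u k" if "k < K" for k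
    using r' that by simp
  have "(c *\<^sub>R \<alpha> + real n *\<^sub>R \<alpha>) \<bullet> kd \<alpha> = (c + real n) * (\<alpha> \<bullet> kd \<alpha>)"
    by (simp add: inner_add_left algebra_simps)
  then have K2: "2 * (c + real n) = real K"
    using K kd_pos[OF a0] by simp
  show ?thesis
  proof (cases "even K")
    case True
    then obtain q where q: "K = 2 * q" by (elim evenE)
    have cq: "c + real n = real q" using K2 q by simp
    then have "q \<ge> 2" using c by linarith
    then obtain p where p: "q = Suc (Suc p)" by (metis add_2_eq_Suc le_Suc_ex)
    have "c *\<^sub>R \<alpha> + real n *\<^sub>R \<alpha> - real q *\<^sub>R \<alpha> = 0" using cq by (simp flip: scaleR_add_left)
    then have "?u q \<in> gs 0" using u(2)[of q] q by simp
    then obtain H1 H2 where H: "?u q = j H1 + \<i> *s j H2"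
      using centralizer[of "?u q"] by (auto simp: gs_iff)
    have pK: "Suc p < K" "p < K" using p q by simp_all
    obtain d where d: "d \<noteq> 0" "br e (?u q) = d *\<^sub>R ?u (Suc p)" using r[OF pK(1)] unfolding p by (elim exE conjE)
    obtain d' where d': "d' \<noteq> 0" "br e (?u (Suc p)) = d' *\<^sub>R ?u p" using r[OF pK(2)] by (elim exE conjE)
    have "br e (br e (?u q)) = (d * d') *\<^sub>R ?u p"
      by (simp only: d d' br_scaleR_right scaleR_scaleR)
    moreover have "d * d' \<noteq> 0" using d d' by simp
    moreover have "?u p \<noteq> 0" using u(1)[of p] p q by simp
    moreover have "br e (br e (?u q)) = 0"
    proof -
      have "br e (j H) = - (\<alpha> \<bullet> H) *\<^sub>R e" for H
        using gs_D[OF ev(1), of H] br_skew[of e "j H"] by simp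
      then show ?thesis by (simp only: H br_simps br_self) simp
    qed
    ultimately show ?thesis by simp
  next
    case False
    then obtain q where q: "K = 2 * q + 1" by (elim oddE)
    then have cq: "c + real n = real q + 1/2" using K2 by simp
    have "c *\<^sub>R \<alpha> + real n *\<^sub>R \<alpha> - real q *\<^sub>R \<alpha> = (1/2) *\<^sub>R \<alpha>"
      using cq by (simp flip: scaleR_add_left scaleR_diff_left)
    then have "?u q \<in> gs ((1/2) *\<^sub>R \<alpha>)" using u(2)[of q] q by simp
    moreover have "?u q \<noteq> 0" using u(1)[of q] q by simp
    ultimately have "gs ((1/2) *\<^sub>R \<alpha>) \<noteq> {0}" by (metis singletonD)
    moreover have "c \<noteq> real i" for i
    proof
      assume "c = real i"
      then have "real (2 * (i + n)) = real K" using K2 by simp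
      then have "2 * (i + n) = K" by (simp only: of_nat_eq_iff)
      then show False using False by auto
    qed
    ultimately show ?thesis using a0 by (simp add: roots_iff)
  qed
qed

text \<open>By the previous lemma \<open>\<alpha>/2\<close> would be a root; but then \<open>2\<close> is an excluded factor for \<open>\<alpha>/2\<close>.\<close>

lemma roots_reduced_gt:
  assumes a: "\<alpha> \<in> roots br j" and c: "c > 1" "c *\<^sub>R \<alpha> \<in> roots br j"
  shows False
proof -
  have "(1/2) *\<^sub>R \<alpha> \<in> roots br j" using no_multiple[OF a c] by blast
  then have "\<forall>i::nat. (2::real) \<noteq> real i"
    using no_multiple[of "(1/2) *\<^sub>R \<alpha>" 2] a by simp
  then show False by (metis of_nat_numeral)
qed

lemma roots_reduced:
  assumes a: "\<alpha> \<in> roots br j" and c: "c *\<^sub>R \<alpha> \<in> roots br j"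
  shows "c = 1 \<or> c = - 1"
proof -
  have pos: "c = 1" if c0: "c > 0" and "c *\<^sub>R \<alpha> \<in> roots br j" for c
  proof (rule ccontr)
    assume "c \<noteq> 1"
    then consider "c > 1" | "1 / c > 1" using c0
      by (cases c "1::real" rule: linorder_cases) auto
    then show False
    proof cases
      case 1 then show False using roots_reduced_gt a that by blast
    next
      case 2 then show False using roots_reduced_gt[of "c *\<^sub>R \<alpha>" "1 / c"] a that by simp
    qed
  qed
  have "c \<noteq> 0" using c by (auto simp: roots_iff)
  then consider "c > 0" | "- c > 0" by linarith
  then show ?thesis
  proof cases
    case 1 then show ?thesis using pos c by blast
  next
    case 2 then show ?thesis using pos[of "- c"] roots_neg[OF c] by auto
  qed
qed

text \<open>The reflection fixes the hyperplane orthogonal to \<open>\<alpha>\<close> pointwise and changes the sign of \<open>kd \<alpha>\<close>. As it is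
  an isometry, \<open>kd \<alpha>\<close> is orthogonal to that hyperplane.\<close>

lemma killing_dual_parallel:
  assumes a: "\<alpha> \<in> roots br j" and inv: "weyl_invariant_inner (weyl_group br j)"
  shows "kd \<alpha> = ((\<alpha> \<bullet> kd \<alpha>) / (\<alpha> \<bullet> \<alpha>)) *\<^sub>R \<alpha>"
proof -
  let ?s = "root_reflection br j \<alpha>"
  have a0: "\<alpha> \<noteq> 0" using a by (simp add: roots_iff)
  have "?s \<circ> id \<in> weyl_group br j" using a by (intro weyl_group.intros)
  then have iso: "?s x \<bullet> ?s y = x \<bullet> y" for x y
    using inv by (simp add: weyl_invariant_inner_def)
  define y where "y = kd \<alpha> - ((\<alpha> \<bullet> kd \<alpha>) / (\<alpha> \<bullet> \<alpha>)) *\<^sub>R \<alpha>"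
  have ya: "\<alpha> \<bullet> y = 0" using a0 by (simp add: y_def inner_diff_right)
  have "?s y = y" by (simp add: root_reflection_def ya)
  moreover have "?s (kd \<alpha>) = - kd \<alpha>" using kd_pos[OF a0] by (simp add: root_reflection_def scaleR_2)
  ultimately have "y \<bullet> kd \<alpha> = 0" using iso[of y "kd \<alpha>"] by simp
  then have "y \<bullet> y = 0" using ya by (subst (2) y_def) (simp add: inner_diff_right inner_commute)
  then show ?thesis by (simp add: y_def)
qed

lemma root_reflection_orthogonal:
  assumes a: "\<alpha> \<in> roots br j" and inv: "weyl_invariant_inner (weyl_group br j)"
  shows "root_reflection br j \<alpha> x = x - (2 * (\<alpha> \<bullet> x) / (\<alpha> \<bullet> \<alpha>)) *\<^sub>R \<alpha>"
proof -
  have a0: "\<alpha> \<noteq> 0" using a by (simp add: roots_iff)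
  have "(2 * (\<alpha> \<bullet> x) / (\<alpha> \<bullet> kd \<alpha>)) *\<^sub>R kd \<alpha> =
      (2 * (\<alpha> \<bullet> x) / (\<alpha> \<bullet> kd \<alpha>)) *\<^sub>R (((\<alpha> \<bullet> kd \<alpha>) / (\<alpha> \<bullet> \<alpha>)) *\<^sub>R \<alpha>)"
    using killing_dual_parallel[OF assms] by simp
  also have "\<dots> = (2 * (\<alpha> \<bullet> x) / (\<alpha> \<bullet> \<alpha>)) *\<^sub>R \<alpha>" using kd_pos[OF a0] by simp
  finally show ?thesis by (simp add: root_reflection_def)
qed

lemma roots_reflection_closed:
  assumes a: "\<alpha> \<in> roots br j" and b: "\<beta> \<in> roots br j" and inv: "weyl_invariant_inner (weyl_group br j)"
  shows "\<beta> - (2 * (\<alpha> \<bullet> \<beta>) / (\<alpha> \<bullet> \<alpha>)) *\<^sub>R \<alpha> \<in> roots br j"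
proof -
  have a0: "\<alpha> \<noteq> 0" and b0: "\<beta> \<noteq> 0" using a b by (auto simp: roots_iff)
  have k: "\<beta> \<bullet> kd \<alpha> = (\<alpha> \<bullet> kd \<alpha>) / (\<alpha> \<bullet> \<alpha>) * (\<alpha> \<bullet> \<beta>)"
    using arg_cong[OF killing_dual_parallel[OF a inv], of "\<lambda>v. \<beta> \<bullet> v"] by (simp add: inner_commute)
  have "2 * (\<beta> \<bullet> kd \<alpha>) / (\<alpha> \<bullet> kd \<alpha>) = 2 * (\<alpha> \<bullet> \<beta>) / (\<alpha> \<bullet> \<alpha>)"
    unfolding k using kd_pos[OF a0] by simp
  then have "gs (\<beta> - (2 * (\<alpha> \<bullet> \<beta>) / (\<alpha> \<bullet> \<alpha>)) *\<^sub>R \<alpha>) \<noteq> {0}" using roots_reflection[OF a b] by simp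
  moreover have "\<beta> - (2 * (\<alpha> \<bullet> \<beta>) / (\<alpha> \<bullet> \<alpha>)) *\<^sub>R \<alpha> \<noteq> 0"
  proof
    assume z: "\<beta> - (2 * (\<alpha> \<bullet> \<beta>) / (\<alpha> \<bullet> \<alpha>)) *\<^sub>R \<alpha> = 0"
    then have "\<alpha> \<bullet> (\<beta> - (2 * (\<alpha> \<bullet> \<beta>) / (\<alpha> \<bullet> \<alpha>)) *\<^sub>R \<alpha>) = 0" by simp
    then have "\<alpha> \<bullet> \<beta> = 0" using a0 by (simp add: inner_diff_right)
    then show False using z b0 by simp
  qed
  ultimately show ?thesis by (simp add: roots_iff)
qed

end

section \<open>Reflection groups\<close>

definition reflection :: "real^'r \<Rightarrow> real^'r \<Rightarrow> real^'r" where
  "reflection \<alpha> x = x - (2 * (\<alpha> \<bullet> x) / (\<alpha> \<bullet> \<alpha>)) *\<^sub>R \<alpha>"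

inductive_set reflection_group :: "(real^'r) set \<Rightarrow> (real^'r \<Rightarrow> real^'r) set" for \<Phi> :: "(real^'r) set" where
  reflection_group_id: "id \<in> reflection_group \<Phi>"
| reflection_group_step: "\<alpha> \<in> \<Phi> \<Longrightarrow> w \<in> reflection_group \<Phi> \<Longrightarrow> reflection \<alpha> \<circ> w \<in> reflection_group \<Phi>"

text \<open>Reduced root systems in a weak sense that passes to the intersection with a subspace, as the
  induction on subsystems requires.\<close>

definition root_set :: "(real^'r) set \<Rightarrow> bool" where
  "root_set \<Phi> \<longleftrightarrow> finite \<Phi> \<and> 0 \<notin> \<Phi> \<and> (\<forall>\<alpha>\<in>\<Phi>. \<forall>\<beta>\<in>\<Phi>. reflection \<alpha> \<beta> \<in> \<Phi>) \<and>
     (\<forall>\<alpha>\<in>\<Phi>. \<forall>c. c *\<^sub>R \<alpha> \<in> \<Phi> \<longrightarrow> c = 1 \<or> c = - 1)"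

lemma linear_reflection: "linear (reflection \<alpha>)"
  by (rule linearI) (simp_all add: reflection_def inner_add_right add_divide_distrib algebra_simps)

lemma reflection_self: "reflection \<alpha> \<alpha> = - \<alpha>"
  by (cases "\<alpha> = 0") (simp_all add: reflection_def scaleR_2)

lemma reflection_inner: "reflection \<alpha> x \<bullet> reflection \<alpha> y = x \<bullet> y"
  by (cases "\<alpha> = 0") (simp_all add: reflection_def inner_diff_left inner_diff_right inner_commute field_simps)

lemma reflection_reflection: "reflection \<alpha> (reflection \<alpha> x) = x"
proof (cases "\<alpha> = 0")
  case False
  then have "\<alpha> \<bullet> reflection \<alpha> x = - (\<alpha> \<bullet> x)" by (simp add: reflection_def inner_diff_right)
  then show ?thesis by (subst reflection_def) (simp add: reflection_def)
qed (simp add: reflection_def)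

lemma reflection_fixes: "\<alpha> \<bullet> x = 0 \<Longrightarrow> reflection \<alpha> x = x"
  by (simp add: reflection_def)

text \<open>An orthogonal transformation carries \<open>\<alpha>\<close> to a coordinate axis, where the reflection is diagonal.\<close>

lemma det_reflection: "det (matrix (reflection \<alpha>)) = - 1" if "\<alpha> \<noteq> 0" for \<alpha> :: "real^'r"
proof -
  obtain k :: 'r where True by simp
  let ?e = "norm \<alpha> *\<^sub>R axis k (1::real)"
  obtain f where f: "orthogonal_transformation f" "f \<alpha> = ?e"
    by (rule orthogonal_transformation_exists[of \<alpha> ?e]) simp
  have lf: "linear f" using f(1) by (rule orthogonal_transformation_linear)
  have fin: "f x \<bullet> f y = x \<bullet> y" for x y using f(1) by (simp add: orthogonal_transformation_def)
  have "reflection ?e (f x) = f (reflection \<alpha> x)" for x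
    unfolding f(2)[symmetric] by (simp add: reflection_def fin linear_diff[OF lf] linear_cmul[OF lf])
  then have "reflection ?e \<circ> f = f \<circ> reflection \<alpha>" by auto
  then have "matrix (reflection ?e) ** matrix f = matrix f ** matrix (reflection \<alpha>)"
    using matrix_compose[OF lf linear_reflection, of ?e] matrix_compose[OF linear_reflection lf, of \<alpha>] by simp
  then have "det (matrix (reflection ?e)) * det (matrix f) = det (matrix f) * det (matrix (reflection \<alpha>))"
    by (metis det_mul)
  moreover have "det (matrix f) \<noteq> 0"
    using f(1) det_orthogonal_matrix orthogonal_transformation_matrix by force
  ultimately have eq: "det (matrix (reflection \<alpha>)) = det (matrix (reflection ?e))" by simp
  have ek: "reflection ?e x = x - (2 * x $ k) *\<^sub>R axis k 1" for x
    using that by (simp add: reflection_def inner_axis' axis_eq_axis power2_eq_square flip: power2_norm_eq_inner)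
  have "det (matrix (reflection ?e)) = (\<Prod>i\<in>UNIV. matrix (reflection ?e) $ i $ i)"
    unfolding matrix_def ek by (intro det_diagonal) (auto simp: axis_def)
  also have "\<dots> = (\<Prod>i\<in>UNIV. if i = k then -1 else 1)"
    unfolding matrix_def ek by (intro prod.cong) (auto simp: axis_def)
  also have "\<dots> = -1" by simp
  finally show ?thesis using eq by simp
qed

lemma reflection_group_mono: "\<Psi> \<subseteq> \<Phi> \<Longrightarrow> reflection_group \<Psi> \<subseteq> reflection_group \<Phi>"
proof
  fix w assume s: "\<Psi> \<subseteq> \<Phi>" and "w \<in> reflection_group \<Psi>"
  from this(2) show "w \<in> reflection_group \<Phi>"
  proof induction
    case (reflection_group_step \<alpha> w)
    then show ?case using s by (intro reflection_group.intros) auto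
  qed (rule reflection_group.intros)
qed

lemma reflection_group_linear: "w \<in> reflection_group \<Phi> \<Longrightarrow> linear w"
proof (induction rule: reflection_group.induct)
  case reflection_group_id
  show ?case by (rule linear_id)
next
  case (reflection_group_step \<alpha> w)
  then show ?case by (intro linear_compose linear_reflection)
qed

lemma reflection_group_inner: "w \<in> reflection_group \<Phi> \<Longrightarrow> w x \<bullet> w y = x \<bullet> y"
  by (induction rule: reflection_group.induct) (auto simp: reflection_inner)

lemma reflection_group_comp: "w \<in> reflection_group \<Phi> \<Longrightarrow> w' \<in> reflection_group \<Phi> \<Longrightarrow> w \<circ> w' \<in> reflection_group \<Phi>"
  by (induction rule: reflection_group.induct) (auto intro: reflection_group.intros simp: comp_assoc)

lemma reflection_in_group: "\<alpha> \<in> \<Phi> \<Longrightarrow> reflection \<alpha> \<in> reflection_group \<Phi>"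
  using reflection_group_step[OF _ reflection_group_id, of \<alpha> \<Phi>] by simp

lemma reflection_group_inverse:
  "w \<in> reflection_group \<Phi> \<Longrightarrow> \<exists>w'\<in>reflection_group \<Phi>. w \<circ> w' = id \<and> w' \<circ> w = id"
proof (induction rule: reflection_group.induct)
  case reflection_group_id
  show ?case by (intro bexI[of _ id] reflection_group.intros) simp
next
  case (reflection_group_step \<alpha> w)
  then obtain w' where w': "w' \<in> reflection_group \<Phi>" "w \<circ> w' = id" "w' \<circ> w = id" by blast
  have "w' \<circ> reflection \<alpha> \<in> reflection_group \<Phi>"
    by (intro reflection_group_comp w' reflection_in_group reflection_group_step)
  moreover have "(reflection \<alpha> \<circ> w) \<circ> (w' \<circ> reflection \<alpha>) = id" "(w' \<circ> reflection \<alpha>) \<circ> (reflection \<alpha> \<circ> w) = id"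
    using w' by (auto simp: fun_eq_iff reflection_reflection)
  ultimately show ?case by blast
qed

lemma reflection_group_maps: "w \<in> reflection_group \<Phi> \<Longrightarrow> root_set \<Phi> \<Longrightarrow> \<alpha> \<in> \<Phi> \<Longrightarrow> w \<alpha> \<in> \<Phi>"
  by (induction arbitrary: \<alpha> rule: reflection_group.induct) (auto simp: root_set_def)

lemma reflection_group_det: "w \<in> reflection_group \<Phi> \<Longrightarrow> 0 \<notin> \<Phi> \<Longrightarrow> det (matrix w) = 1 \<or> det (matrix w) = - 1"
proof (induction rule: reflection_group.induct)
  case reflection_group_id
  show ?case by (simp only: matrix_id_mat_1 det_I) simp
next
  case (reflection_group_step \<alpha> w)
  then have "\<alpha> \<noteq> 0" by auto
  then have "det (matrix (reflection \<alpha> \<circ> w)) = - det (matrix w)"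
    using matrix_compose[OF reflection_group_linear[OF reflection_group_step(2)] linear_reflection, of \<alpha>] det_reflection[of \<alpha>]
    by (auto simp: det_mul)
  then show ?case using reflection_group_step.IH[OF reflection_group_step.prems] by (metis minus_minus)
qed

lemma det_comp: "w \<in> reflection_group \<Phi> \<Longrightarrow> w' \<in> reflection_group \<Phi> \<Longrightarrow>
    det (matrix (w \<circ> w')) = det (matrix w) * det (matrix w')"
  by (subst matrix_compose) (simp_all add: reflection_group_linear det_mul)

text \<open>The group permutes the finite set \<open>\<Phi>\<close>, and this action is faithful because the orthogonal complement of
  \<open>\<Phi>\<close> is fixed.\<close>

lemma finite_reflection_group:
  assumes \<Phi>: "root_set \<Phi>"
  shows "finite (reflection_group \<Phi>)"
proof -
  have fixes_perp: "w x = x" if "w \<in> reflection_group \<Phi>" "\<And>\<alpha>. \<alpha> \<in> \<Phi> \<Longrightarrow> \<alpha> \<bullet> x = 0" for w x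
    using that by (induction rule: reflection_group.induct) (auto simp: reflection_fixes)
  have "inj_on (\<lambda>w. restrict w \<Phi>) (reflection_group \<Phi>)"
  proof (rule inj_onI)
    fix w w' assume w: "w \<in> reflection_group \<Phi>" "w' \<in> reflection_group \<Phi>" "restrict w \<Phi> = restrict w' \<Phi>"
    have eq: "w \<alpha> = w' \<alpha>" if "\<alpha> \<in> \<Phi>" for \<alpha> using w(3) that by (metis restrict_apply')
    show "w = w'"
    proof
      fix x
      obtain y z where yz: "y \<in> span \<Phi>" "\<And>w. w \<in> span \<Phi> \<Longrightarrow> orthogonal z w" "x = y + z"
        using orthogonal_subspace_decomp_exists[of \<Phi> x] by blast
      have "w y = w' y"
        using linear_eq_on_span[OF reflection_group_linear[OF w(1)] reflection_group_linear[OF w(2)] eq yz(1)] by auto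
      moreover have "\<alpha> \<bullet> z = 0" if "\<alpha> \<in> \<Phi>" for \<alpha>
        using yz(2)[of \<alpha>] that span_base by (auto simp: orthogonal_def inner_commute)
      then have "w z = z" "w' z = z" using fixes_perp w by blast+
      ultimately show "w x = w' x"
        using reflection_group_linear[OF w(1)] reflection_group_linear[OF w(2)] yz(3) by (simp add: linear_add)
    qed
  qed
  moreover have "(\<lambda>w. restrict w \<Phi>) ` reflection_group \<Phi> \<subseteq> \<Phi> \<rightarrow>\<^sub>E \<Phi>"
    using reflection_group_maps \<Phi> by auto
  then have "finite ((\<lambda>w. restrict w \<Phi>) ` reflection_group \<Phi>)"
    using \<Phi> finite_subset finite_PiE[of \<Phi> "\<lambda>_. \<Phi>"] unfolding root_set_def by blast
  ultimately show ?thesis by (rule finite_imageD[rotated])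
qed

lemma bij_comp_left:
  assumes "u \<in> reflection_group \<Phi>"
  shows "bij_betw (\<lambda>w. u \<circ> w) (reflection_group \<Phi>) (reflection_group \<Phi>)"
proof -
  obtain u' where u': "u' \<in> reflection_group \<Phi>" "u \<circ> u' = id" "u' \<circ> u = id"
    using reflection_group_inverse[OF assms] by blast
  show ?thesis
    by (rule bij_betwI[where g = "\<lambda>w. u' \<circ> w"])
      (use assms u' reflection_group_comp in \<open>auto simp: fun_eq_iff pointfree_idE\<close>)
qed

lemma bij_comp_right:
  assumes "u \<in> reflection_group \<Phi>"
  shows "bij_betw (\<lambda>w. w \<circ> u) (reflection_group \<Phi>) (reflection_group \<Phi>)"
proof -
  obtain u' where u': "u' \<in> reflection_group \<Phi>" "u \<circ> u' = id" "u' \<circ> u = id"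
    using reflection_group_inverse[OF assms] by blast
  show ?thesis
    by (rule bij_betwI[where g = "\<lambda>w. w \<circ> u'"])
      (use assms u' reflection_group_comp in \<open>auto simp: fun_eq_iff pointfree_idE\<close>)
qed

lemma root_set_uminus: "root_set \<Phi> \<Longrightarrow> \<alpha> \<in> \<Phi> \<Longrightarrow> - \<alpha> \<in> \<Phi>"
  using reflection_self[of \<alpha>] unfolding root_set_def by metis

lemma root_set_sub:
  assumes "root_set \<Phi>"
  shows "root_set (\<Phi> \<inter> span S)"
proof -
  have "reflection \<alpha> \<beta> \<in> span S" if "\<alpha> \<in> span S" "\<beta> \<in> span S" for \<alpha> \<beta>
    using that by (simp add: reflection_def span_diff span_scale)
  then show ?thesis using assms by (auto simp: root_set_def)
qed

section \<open>Complexified pairing\<close>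

text \<open>A pair of vectors stands for a point of the complexified space, both for spectral parameters and for
  complex \<open>X\<close>; this is the multiplication by complex scalars, and \<open>cbil\<close> below the complex bilinear
  extension of the inner product.\<close>

definition csc :: "complex \<Rightarrow> 'r::finite spectral \<Rightarrow> 'r spectral" where
  "csc t z = (Re t *\<^sub>R fst z - Im t *\<^sub>R snd z, Re t *\<^sub>R snd z + Im t *\<^sub>R fst z)"

definition cbil :: "'r::finite spectral \<Rightarrow> 'r spectral \<Rightarrow> complex" where
  "cbil z X = Complex (fst z \<bullet> fst X - snd z \<bullet> snd X) (fst z \<bullet> snd X + snd z \<bullet> fst X)"

lemma cpair_add: "cpair (z + z') \<alpha> = cpair z \<alpha> + cpair z' \<alpha>"
  by (simp add: cpair_def complex_eq_iff inner_add_left)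
lemma cpair_add_right: "cpair z (\<alpha> + \<beta>) = cpair z \<alpha> + cpair z \<beta>"
  by (simp add: cpair_def complex_eq_iff inner_add_right)
lemma cpair_csc: "cpair (csc t z) \<alpha> = t * cpair z \<alpha>"
  by (simp add: cpair_def csc_def complex_eq_iff inner_add_left inner_diff_left)
lemma cpair_scaleR: "cpair (r *\<^sub>R z) \<alpha> = of_real r * cpair z \<alpha>"
  by (simp add: cpair_def complex_eq_iff)
lemma cpair_scaleR_right: "cpair z (r *\<^sub>R \<alpha>) = of_real r * cpair z \<alpha>"
  by (simp add: cpair_def complex_eq_iff)
lemma cpair_minus_right: "cpair z (- \<alpha>) = - cpair z \<alpha>"
  by (simp add: cpair_def complex_eq_iff)
lemma cpair_diff_right: "cpair z (\<alpha> - \<beta>) = cpair z \<alpha> - cpair z \<beta>"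
  by (simp add: cpair_def complex_eq_iff inner_diff_right)
lemma cpair_zero_right: "cpair z 0 = 0" by (simp add: cpair_def complex_eq_iff)
lemma cpair_sum_right: "cpair z (\<Sum>i\<in>I. f i) = (\<Sum>i\<in>I. cpair z (f i))"
  by (induction I rule: infinite_finite_induct) (simp_all add: cpair_zero_right cpair_add_right)
lemma cpair_real: "cpair (x, 0) \<alpha> = of_real (x \<bullet> \<alpha>)"
  by (simp add: cpair_def complex_eq_iff)

lemma cbil_add_left: "cbil (z + z') X = cbil z X + cbil z' X"
  by (simp add: cbil_def complex_eq_iff inner_add_left)
lemma cbil_add_right: "cbil z (X + X') = cbil z X + cbil z X'"
  by (simp add: cbil_def complex_eq_iff inner_add_right)
lemma cbil_csc_left: "cbil (csc t z) X = t * cbil z X"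
  by (simp add: cbil_def csc_def complex_eq_iff inner_add_left inner_diff_left algebra_simps)
lemma cbil_csc_right: "cbil z (csc t X) = t * cbil z X"
  by (simp add: cbil_def csc_def complex_eq_iff inner_add_right inner_diff_right algebra_simps)
lemma cbil_real_left: "cbil (x, 0) X = cpair X x"
  by (simp add: cbil_def cpair_def complex_eq_iff inner_commute)
lemma cbil_real_right: "cbil z (x, 0) = cpair z x"
  by (simp add: cbil_def cpair_def complex_eq_iff inner_commute)

lemma cmod_cpair_le: "cmod (cpair z \<alpha>) \<le> norm z * norm \<alpha>"
proof -
  have "(cmod (cpair z \<alpha>))\<^sup>2 = (fst z \<bullet> \<alpha>)\<^sup>2 + (snd z \<bullet> \<alpha>)\<^sup>2"
    by (simp add: cmod_power2 cpair_def)
  also have "\<dots> \<le> (norm (fst z) * norm \<alpha>)\<^sup>2 + (norm (snd z) * norm \<alpha>)\<^sup>2"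
    using Cauchy_Schwarz_ineq2[of "fst z" \<alpha>] Cauchy_Schwarz_ineq2[of "snd z" \<alpha>]
    by (intro add_mono power2_le_iff_abs_le[THEN iffD2]) auto
  also have "\<dots> = (norm z * norm \<alpha>)\<^sup>2"
    by (simp add: norm_prod_def power_mult_distrib algebra_simps)
  finally show ?thesis by (rule power2_le_imp_le) simp
qed

lemma act_id: "act id z = z" by (simp add: act_def)
lemma act_comp: "act (u \<circ> w) z = act u (act w z)" by (simp add: act_def)
lemma act_add: "linear w \<Longrightarrow> act w (z + z') = act w z + act w z'"
  by (simp add: act_def linear_add)
lemma act_csc: "linear w \<Longrightarrow> act w (csc t z) = csc t (act w z)"
  by (simp add: act_def csc_def linear_add linear_diff linear_cmul)
lemma act_real: "linear w \<Longrightarrow> act w (x, 0) = (w x, 0)"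
  by (simp add: act_def linear_0)

lemma cpair_act: "w \<in> reflection_group \<Phi> \<Longrightarrow> cpair (act w z) (w \<alpha>) = cpair z \<alpha>"
  by (simp add: act_def cpair_def reflection_group_inner)

lemma act_reflection_fixed: "cpair z \<alpha> = 0 \<Longrightarrow> act (reflection \<alpha>) z = z"
  by (auto simp: act_def cpair_def complex_eq_iff reflection_fixes inner_commute intro!: prod_eqI)

text \<open>The numerator of the spherical function, at \<open>z = \<i>\<zeta>\<close> and also for complex \<open>X\<close>.\<close>

definition alt_sum :: "(real^'r) set \<Rightarrow> 'r::finite spectral \<Rightarrow> 'r spectral \<Rightarrow> complex" where
  "alt_sum \<Phi> z X = (\<Sum>w\<in>reflection_group \<Phi>. of_real (det (matrix w)) * exp (cbil (act w z) X))"

lemma alt_sum_reflection: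
  assumes \<Phi>: "root_set \<Phi>" and a: "\<alpha> \<in> \<Phi>"
  shows "alt_sum \<Phi> (act (reflection \<alpha>) z) X = - alt_sum \<Phi> z X"
proof -
  have a0: "\<alpha> \<noteq> 0" using \<Phi> a by (auto simp: root_set_def)
  have "alt_sum \<Phi> z X =
      (\<Sum>w\<in>reflection_group \<Phi>. of_real (det (matrix (w \<circ> reflection \<alpha>))) * exp (cbil (act (w \<circ> reflection \<alpha>) z) X))"
    unfolding alt_sum_def
    by (rule sum.reindex_bij_betw[OF bij_comp_right[OF reflection_in_group[OF a]], symmetric])
  also have "\<dots> = (\<Sum>w\<in>reflection_group \<Phi>. - (of_real (det (matrix w)) * exp (cbil (act w (act (reflection \<alpha>) z)) X)))"
    by (intro sum.cong) (auto simp: det_comp[OF _ reflection_in_group[OF a]] det_reflection[OF a0] act_comp)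
  finally show ?thesis by (simp add: alt_sum_def sum_negf)
qed

lemma alt_sum_zero:
  assumes \<Phi>: "root_set \<Phi>" and a: "\<alpha> \<in> \<Phi>" and z: "cpair z \<alpha> = 0"
  shows "alt_sum \<Phi> z X = 0"
  using alt_sum_reflection[OF \<Phi> a, of z X] act_reflection_fixed[OF z] by simp

text \<open>Group the elements \<open>u \<circ> w\<close> with \<open>u\<close> in the subgroup; summing over all \<open>w\<close> instead of representatives of
  cosets counts every element of the group equally often.\<close>

lemma alt_sum_average:
  assumes \<Phi>: "root_set \<Phi>" and s: "\<Psi> \<subseteq> \<Phi>"
  shows "of_nat (card (reflection_group \<Psi>)) * alt_sum \<Phi> z X =
    (\<Sum>w\<in>reflection_group \<Phi>. of_real (det (matrix w)) * alt_sum \<Psi> (act w z) X)"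
proof -
  have "(\<Sum>w\<in>reflection_group \<Phi>. of_real (det (matrix w)) * alt_sum \<Psi> (act w z) X) =
     (\<Sum>w\<in>reflection_group \<Phi>. \<Sum>u\<in>reflection_group \<Psi>. of_real (det (matrix (u \<circ> w))) * exp (cbil (act (u \<circ> w) z) X))"
    unfolding alt_sum_def sum_distrib_left
    using reflection_group_mono[OF s] by (intro sum.cong refl) (auto simp: det_comp[of _ \<Phi>] act_comp subset_iff)
  also have "\<dots> = (\<Sum>u\<in>reflection_group \<Psi>. \<Sum>w\<in>reflection_group \<Phi>. of_real (det (matrix (u \<circ> w))) * exp (cbil (act (u \<circ> w) z) X))"
    by (rule sum.swap)
  also have "\<dots> = (\<Sum>u\<in>reflection_group \<Psi>. alt_sum \<Phi> z X)"
    unfolding alt_sum_def using reflection_group_mono[OF s]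
    by (intro sum.cong refl sum.reindex_bij_betw[OF bij_comp_left]) auto
  finally show ?thesis by simp
qed

section \<open>Positive systems\<close>

definition pos_roots :: "real^'r \<Rightarrow> (real^'r) set \<Rightarrow> (real^'r) set" where
  "pos_roots v \<Psi> = {\<alpha>\<in>\<Psi>. \<alpha> \<bullet> v > 0}"

text \<open>Up to signs, which \<open>g\<close> does not see, \<open>f\<close> permutes the positive elements.\<close>

lemma prod_pos_even:
  fixes g :: "real^'r \<Rightarrow> 'c::comm_monoid_mult"
  assumes fin: "finite X" and sym: "\<And>\<alpha>. \<alpha> \<in> X \<Longrightarrow> - \<alpha> \<in> X" and v: "\<And>\<alpha>. \<alpha> \<in> X \<Longrightarrow> \<alpha> \<bullet> v \<noteq> 0"
    and f: "\<And>\<alpha>. \<alpha> \<in> X \<Longrightarrow> f \<alpha> \<in> X" "inj_on f X" "\<And>\<alpha>. f (- \<alpha>) = - f \<alpha>"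
    and g: "\<And>\<alpha>. g (- \<alpha>) = g \<alpha>"
  shows "(\<Prod>\<alpha>\<in>pos_roots v X. g (f \<alpha>)) = (\<Prod>\<alpha>\<in>pos_roots v X. g \<alpha>)"
proof -
  define \<tau> where "\<tau> \<alpha> = (if f \<alpha> \<bullet> v > 0 then f \<alpha> else - f \<alpha>)" for \<alpha>
  have maps: "\<tau> ` pos_roots v X \<subseteq> pos_roots v X"
    using f(1) sym v by (auto simp: \<tau>_def pos_roots_def not_less less_le)
  have "inj_on \<tau> (pos_roots v X)"
  proof (rule inj_onI)
    fix \<alpha> \<beta> assume a: "\<alpha> \<in> pos_roots v X" "\<beta> \<in> pos_roots v X" "\<tau> \<alpha> = \<tau> \<beta>"
    have "f \<alpha> = f \<beta> \<or> f \<alpha> = f (- \<beta>)" using a(3) unfolding \<tau>_def f(3) by (metis minus_minus)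
    then have "\<alpha> = \<beta> \<or> \<alpha> = - \<beta>" using f(2) a sym by (auto simp: pos_roots_def inj_on_def)
    then show "\<alpha> = \<beta>" using a by (auto simp: pos_roots_def)
  qed
  moreover have "finite (pos_roots v X)" using fin by (simp add: pos_roots_def)
  ultimately have "bij_betw \<tau> (pos_roots v X) (pos_roots v X)"
    using maps by (simp add: bij_betw_def endo_inj_surj)
  then have "(\<Prod>\<alpha>\<in>pos_roots v X. g (\<tau> \<alpha>)) = (\<Prod>\<alpha>\<in>pos_roots v X. g \<alpha>)"
    by (rule prod.reindex_bij_betw)
  moreover have "g (\<tau> \<alpha>) = g (f \<alpha>)" for \<alpha> by (simp add: \<tau>_def g)
  ultimately show ?thesis by simp
qed

text \<open>The group of \<open>\<Psi>\<close> permutes both \<open>\<Psi>\<close> and \<open>\<Phi> - \<Psi>\<close>.\<close>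

lemma prod_pos_act:
  fixes \<Phi> :: "(real^'r) set" and g :: "real \<Rightarrow> real"
  assumes \<Phi>: "root_set \<Phi>" and \<Psi>: "root_set \<Psi>" "\<Psi> \<subseteq> \<Phi>" and v: "\<And>\<alpha>. \<alpha> \<in> \<Phi> \<Longrightarrow> \<alpha> \<bullet> v \<noteq> 0"
    and w: "w \<in> reflection_group \<Psi>"
  shows "(\<Prod>\<alpha>\<in>pos_roots v (\<Phi> - \<Psi>). g (cmod (cpair (act w z) \<alpha>))) = (\<Prod>\<alpha>\<in>pos_roots v (\<Phi> - \<Psi>). g (cmod (cpair z \<alpha>)))"
    and "(\<Prod>\<alpha>\<in>pos_roots v \<Psi>. g (cmod (cpair (act w z) \<alpha>))) = (\<Prod>\<alpha>\<in>pos_roots v \<Psi>. g (cmod (cpair z \<alpha>)))"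
proof -
  obtain w' where w': "w' \<in> reflection_group \<Psi>" "w \<circ> w' = id" "w' \<circ> w = id"
    using reflection_group_inverse[OF w] by blast
  have eq: "cpair (act w z) \<alpha> = cpair z (w' \<alpha>)" for \<alpha>
    using cpair_act[OF w, of z "w' \<alpha>"] w'(2) by (simp add: pointfree_idE)
  have neg: "w' (- \<alpha>) = - w' \<alpha>" for \<alpha> using reflection_group_linear[OF w'(1)] by (rule linear_neg)
  have inj: "inj_on w' S" for S
    using w'(2) by (metis inj_on_inverseI comp_apply id_apply)
  have w\<Phi>: "w \<in> reflection_group \<Phi>" "w' \<in> reflection_group \<Phi>" using reflection_group_mono[OF \<Psi>(2)] w w'(1) by auto
  have maps: "w' \<alpha> \<in> \<Phi> - \<Psi>" if "\<alpha> \<in> \<Phi> - \<Psi>" for \<alpha>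
  proof -
    have "w' \<alpha> \<in> \<Phi>" using reflection_group_maps[OF w\<Phi>(2) \<Phi>] that by blast
    moreover have "w' \<alpha> \<notin> \<Psi>"
      using reflection_group_maps[OF w \<Psi>(1), of "w' \<alpha>"] w'(2) that by (auto simp: pointfree_idE)
    ultimately show ?thesis by blast
  qed
  show "(\<Prod>\<alpha>\<in>pos_roots v (\<Phi> - \<Psi>). g (cmod (cpair (act w z) \<alpha>))) = (\<Prod>\<alpha>\<in>pos_roots v (\<Phi> - \<Psi>). g (cmod (cpair z \<alpha>)))"
    unfolding eq
  proof (rule prod_pos_even)
    show "- \<alpha> \<in> \<Phi> - \<Psi>" if "\<alpha> \<in> \<Phi> - \<Psi>" for \<alpha>
      using root_set_uminus[OF \<Phi>, of \<alpha>] root_set_uminus[OF \<Psi>(1), of "- \<alpha>"] that by auto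
  qed (use maps inj neg v \<Phi> in \<open>auto simp: cpair_minus_right root_set_def\<close>)
  show "(\<Prod>\<alpha>\<in>pos_roots v \<Psi>. g (cmod (cpair (act w z) \<alpha>))) = (\<Prod>\<alpha>\<in>pos_roots v \<Psi>. g (cmod (cpair z \<alpha>)))"
    unfolding eq
  proof (rule prod_pos_even)
    show "- \<alpha> \<in> \<Psi>" if "\<alpha> \<in> \<Psi>" for \<alpha> using root_set_uminus[OF \<Psi>(1) that] .
    show "w' \<alpha> \<in> \<Psi>" if "\<alpha> \<in> \<Psi>" for \<alpha> using reflection_group_maps[OF w'(1) \<Psi>(1) that] .
  qed (use inj neg v \<Psi> in \<open>auto simp: cpair_minus_right root_set_def\<close>)
qed

text \<open>Positive roots whose images under the reflection in \<open>\<alpha>\<close> are positive contribute nothing in total, since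
  the reflection changes the sign of the pairing with \<open>\<alpha>\<close>. The other ones pair positively with \<open>\<alpha>\<close>, for
  otherwise their image would be the sum of a positive root and a nonnegative multiple of \<open>\<alpha>\<close>.\<close>

lemma sum_pos_dominant:
  assumes \<Phi>: "root_set \<Phi>" and a: "\<alpha> \<in> pos_roots v \<Phi>"
  shows "(\<Sum>\<beta>\<in>pos_roots v \<Phi>. \<beta>) \<bullet> \<alpha> > 0"
proof -
  let ?P = "pos_roots v \<Phi>"
  have fin: "finite ?P" using \<Phi> by (simp add: pos_roots_def root_set_def)
  have a\<Phi>: "\<alpha> \<in> \<Phi>" and av: "\<alpha> \<bullet> v > 0" and a0: "\<alpha> \<bullet> \<alpha> > 0" using a by (auto simp: pos_roots_def)
  let ?A = "{\<beta>\<in>?P. reflection \<alpha> \<beta> \<in> ?P}" and ?B = "{\<beta>\<in>?P. reflection \<alpha> \<beta> \<notin> ?P}"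
  have ra: "reflection \<alpha> \<beta> \<bullet> \<alpha> = - (\<beta> \<bullet> \<alpha>)" for \<beta>
    using reflection_inner[of \<alpha> \<beta> \<alpha>] by (simp add: reflection_self)
  have "bij_betw (reflection \<alpha>) ?A ?A"
    by (rule bij_betwI[where g = "reflection \<alpha>"]) (auto simp: reflection_reflection)
  then have "(\<Sum>\<beta>\<in>?A. reflection \<alpha> \<beta> \<bullet> \<alpha>) = (\<Sum>\<beta>\<in>?A. \<beta> \<bullet> \<alpha>)"
    by (rule sum.reindex_bij_betw)
  then have A: "(\<Sum>\<beta>\<in>?A. \<beta> \<bullet> \<alpha>) = 0" by (simp add: ra sum_negf)
  have Bpos: "\<beta> \<bullet> \<alpha> > 0" if "\<beta> \<in> ?B" for \<beta>
  proof (rule ccontr)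
    assume n: "\<not> \<beta> \<bullet> \<alpha> > 0"
    have "reflection \<alpha> \<beta> \<in> \<Phi>" using \<Phi> a\<Phi> that by (auto simp: root_set_def pos_roots_def)
    moreover have "reflection \<alpha> \<beta> \<bullet> v = \<beta> \<bullet> v + (2 * (- (\<alpha> \<bullet> \<beta>)) / (\<alpha> \<bullet> \<alpha>)) * (\<alpha> \<bullet> v)"
      by (simp add: reflection_def inner_diff_left)
    moreover have "(2 * (- (\<alpha> \<bullet> \<beta>)) / (\<alpha> \<bullet> \<alpha>)) * (\<alpha> \<bullet> v) \<ge> 0"
      using n a0 av by (intro mult_nonneg_nonneg divide_nonneg_nonneg) (auto simp: inner_commute)
    ultimately have "reflection \<alpha> \<beta> \<in> ?P" using that by (auto simp: pos_roots_def)
    then show False using that by simp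
  qed
  have "\<alpha> \<in> ?B" using a av by (auto simp: reflection_self pos_roots_def)
  then have B: "(\<Sum>\<beta>\<in>?B. \<beta> \<bullet> \<alpha>) > 0"
    using fin Bpos by (intro sum_pos) auto
  have "(\<Sum>\<beta>\<in>?P. \<beta>) \<bullet> \<alpha> = (\<Sum>\<beta>\<in>?P. \<beta> \<bullet> \<alpha>)" by (rule inner_sum_left)
  also have "\<dots> = (\<Sum>\<beta>\<in>?A \<union> ?B. \<beta> \<bullet> \<alpha>)"
    by (rule sum.cong) auto
  also have "\<dots> = (\<Sum>\<beta>\<in>?A. \<beta> \<bullet> \<alpha>) + (\<Sum>\<beta>\<in>?B. \<beta> \<bullet> \<alpha>)"
    using fin by (intro sum.union_disjoint) auto
  finally show ?thesis using A B by simp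
qed

section \<open>Holomorphic functions of one variable\<close>

lemma holomorphic_divide_root:
  assumes f: "f holomorphic_on UNIV" and a: "f a = 0"
  obtains g where "g holomorphic_on UNIV" "\<And>z. f z = (z - a) * g z"
proof
  show "(\<lambda>z. if z = a then deriv f a else (f z - f a) / (z - a)) holomorphic_on UNIV"
    using pole_lemma[OF f, of a] by simp
  show "f z = (z - a) * (if z = a then deriv f a else (f z - f a) / (z - a))" for z
    using a by auto
qed

lemma holomorphic_divide_roots:
  assumes "finite T" "f holomorphic_on UNIV" "inj_on a T" "\<And>i. i \<in> T \<Longrightarrow> f (a i) = 0"
  shows "\<exists>g. g holomorphic_on UNIV \<and> (\<forall>z. f z = (\<Prod>i\<in>T. z - a i) * g z)"
  using assms
proof (induction T arbitrary: f rule: finite_induct)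
  case empty
  then show ?case by auto
next
  case (insert i T)
  obtain g where g: "g holomorphic_on UNIV" "\<And>z. f z = (z - a i) * g z"
    using holomorphic_divide_root[of f "a i"] insert.prems by auto
  have "g (a k) = 0" if "k \<in> T" for k
  proof -
    have "a k \<noteq> a i" using insert that by (metis inj_onD insertCI)
    moreover have "f (a k) = 0" using insert.prems that by auto
    ultimately show ?thesis using g(2)[of "a k"] by auto
  qed
  then obtain h where "h holomorphic_on UNIV" "\<forall>z. g z = (\<Prod>i\<in>T. z - a i) * h z"
    using insert.IH[OF g(1)] insert.prems by (auto simp: inj_on_insert)
  then show ?case using g(2) insert.hyps by (intro exI[of _ h]) (simp add: mult.assoc)
qed

text \<open>The quotient of \<open>f\<close> by \<open>\<Prod>i. (t - a i)\<close> is entire, so its value at \<open>0\<close> is bounded by its values on the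
  circle.\<close>

lemma max_principle_quotient:
  assumes T: "finite T" and f: "f holomorphic_on UNIV" and a: "inj_on a T" "\<And>i. i \<in> T \<Longrightarrow> f (a i) = 0"
    and r: "r > 0" "\<And>i. i \<in> T \<Longrightarrow> cmod (a i) \<noteq> r"
    and bound: "\<And>t. cmod t = r \<Longrightarrow> cmod (f t) \<le> K * (\<Prod>i\<in>T. cmod (t - a i))"
  shows "cmod (f 0) \<le> K * (\<Prod>i\<in>T. cmod (a i))"
proof -
  obtain g where g: "g holomorphic_on UNIV" "\<And>z. f z = (\<Prod>i\<in>T. z - a i) * g z"
    using holomorphic_divide_roots[OF T f a] by auto
  have gK: "cmod (g t) \<le> K" if t: "t \<in> frontier (ball 0 r)" for t
  proof -
    have t: "cmod t = r" using t r(1) by simp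
    have "0 < (\<Prod>i\<in>T. cmod (t - a i))" using r(2) t by (intro prod_pos) auto
    moreover have "(\<Prod>i\<in>T. cmod (t - a i)) * cmod (g t) \<le> (\<Prod>i\<in>T. cmod (t - a i)) * K"
      using bound[OF t] by (simp add: g(2) norm_mult prod_norm mult.commute)
    ultimately show ?thesis by (simp add: mult_le_cancel_left_pos)
  qed
  have "cmod (g 0) \<le> K"
    by (rule maximum_modulus_frontier[of g "ball 0 r"])
      (use g(1) gK r(1) in \<open>auto intro: holomorphic_on_subset holomorphic_on_imp_continuous_on\<close>)
  then have "(\<Prod>i\<in>T. cmod (a i)) * cmod (g 0) \<le> (\<Prod>i\<in>T. cmod (a i)) * K"
    by (intro mult_left_mono prod_nonneg) auto
  then show ?thesis by (simp add: g(2) norm_mult prod_norm[symmetric] mult.commute)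
qed

text \<open>Each \<open>\<rho> i\<close> is within distance \<open>1/2\<close> of at most one of the \<open>card T + 1\<close> radii \<open>1, 2, \<dots>\<close>.\<close>

lemma separated_radius:
  fixes \<rho> :: "'i \<Rightarrow> real"
  assumes T: "finite T"
  obtains r where "1 \<le> r" "r \<le> real (card T) + 1" "\<And>i. i \<in> T \<Longrightarrow> \<bar>\<rho> i - r\<bar> \<ge> 1/2"
proof -
  have "\<exists>n\<in>{1..card T + 1}. \<forall>i\<in>T. \<bar>\<rho> i - real n\<bar> \<ge> 1/2"
  proof (rule ccontr)
    assume "\<not> ?thesis"
    then have "\<forall>n\<in>{1..card T + 1}. \<exists>i. i \<in> T \<and> \<bar>\<rho> i - real n\<bar> < 1/2" by (metis not_le)
    then obtain i where i: "\<And>n. n \<in> {1..card T + 1} \<Longrightarrow> i n \<in> T \<and> \<bar>\<rho> (i n) - real n\<bar> < 1/2"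
      by metis
    have "inj_on i {1..card T + 1}"
    proof (rule inj_onI)
      fix m n assume mn: "m \<in> {1..card T + 1}" "n \<in> {1..card T + 1}" "i m = i n"
      then have "\<bar>\<rho> (i n) - real m\<bar> < 1/2" "\<bar>\<rho> (i n) - real n\<bar> < 1/2" using i by metis+
      then show "m = n" by linarith
    qed
    then have "card {1..card T + 1} \<le> card T" using i T by (intro card_inj_on_le[of i]) auto
    then show False by simp
  qed
  then obtain n where "n \<in> {1..card T + 1}" "\<forall>i\<in>T. \<bar>\<rho> i - real n\<bar> \<ge> 1/2" by blast
  then show ?thesis by (intro that[of "real n"]) auto
qed

text \<open>The distance is bounded below both by \<open>1/2\<close> and, for large \<open>a\<close>, by \<open>|a| / 2\<close>.\<close>

lemma separated_radius_growth:
  fixes t a :: complex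
  assumes "cmod t = r" "1 \<le> r" "r \<le> N + 1" "N \<ge> 0" "\<bar>cmod a - r\<bar> \<ge> 1/2"
  shows "cmod (t - a) \<ge> (1 + cmod a) / (4 * N + 6)"
proof -
  have ge: "cmod (t - a) \<ge> \<bar>cmod a - r\<bar>" using norm_triangle_ineq3[of t a] assms(1) by (simp add: abs_minus_commute)
  show ?thesis
  proof (cases "cmod a \<le> 2 * (N + 1)")
    case True
    then have "1 + cmod a \<le> (1/2) * (4 * N + 6)" by simp
    also have "\<dots> \<le> cmod (t - a) * (4 * N + 6)" using ge assms by (intro mult_right_mono) auto
    finally show ?thesis using assms by (simp add: divide_le_eq)
  next
    case False
    have "cmod a - r \<le> cmod (t - a)" using ge abs_ge_self[of "cmod a - r"] by (rule order_trans[rotated])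
    moreover have "r \<le> cmod a / 2" using False assms(3) by simp
    ultimately have 1: "cmod (t - a) \<ge> cmod a / 2" by simp
    have "(1 + cmod a) / (4 * N + 6) \<le> (1 + cmod a) / 6"
      using assms by (intro divide_left_mono) (auto intro: add_nonneg_pos)
    also have "\<dots> \<le> cmod a / 2" using False assms by simp
    finally show ?thesis using 1 by linarith
  qed
qed

text \<open>Riemann's theorem, applied to one puncture after the other.\<close>

lemma bounded_holomorphic_extend:
  fixes f :: "complex \<Rightarrow> complex"
  assumes "finite K" "open S" "f holomorphic_on S - K" "\<And>z. z \<in> S - K \<Longrightarrow> cmod (f z) \<le> M"
  shows "\<exists>g. g holomorphic_on S \<and> (\<forall>z\<in>S - K. g z = f z)"
  using assms
proof (induction K arbitrary: f S rule: finite_induct)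
  case empty
  then show ?case by auto
next
  case (insert a K)
  have op: "open (S - K)" using insert by (simp add: open_Diff finite_imp_closed)
  show ?case
  proof (cases "a \<in> S")
    case False
    then have "S - insert a K = S - K" by auto
    then show ?thesis using insert.IH[OF insert.prems(1), of f] insert.prems by auto
  next
    case True
    have eq: "S - insert a K = S - K - {a}" by auto
    have aint: "a \<in> interior (S - K)" using True insert.hyps op by (simp add: interior_open)
    have "(\<exists>g. g holomorphic_on (S - K) \<and> (\<forall>z\<in>S - K - {a}. g z = f z)) \<longleftrightarrow> (\<exists>B. \<forall>\<^sub>F z in at a. norm (f z) \<le> B)"
      using insert.prems(2) aint unfolding eq by (rule holomorphic_on_extend_bounded)
    moreover have ev: "\<forall>\<^sub>F z in at a. norm (f z) \<le> M \<and> z \<in> S - K - {a}"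
    proof -
      have "a \<in> S - K" using True insert.hyps by blast
      from eventually_at_in_open[OF op this] show ?thesis
        by (rule eventually_mono) (use insert.prems(3) in auto)
    qed
    then have "\<forall>\<^sub>F z in at a. norm (f z) \<le> M" by (rule eventually_mono) simp
    ultimately obtain g where g: "g holomorphic_on (S - K)" "\<forall>z\<in>S - K - {a}. g z = f z" by blast
    have "cmod (g z) \<le> M" if z: "z \<in> S - K" for z
    proof (cases "z = a")
      case False
      then show ?thesis using g(2) insert.prems(3) z eq by auto
    next
      case True
      have "(g \<longlongrightarrow> g a) (at a)"
        using holomorphic_on_imp_continuous_on[OF g(1)] op z True
        by (metis continuous_on_eq_continuous_at isContD)
      then have "((\<lambda>z. norm (g z)) \<longlongrightarrow> norm (g a)) (at a)" by (rule tendsto_norm)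
      moreover have "\<forall>\<^sub>F z in at a. norm (g z) \<le> M"
        using ev by (rule eventually_mono) (use g(2) in auto)
      ultimately show ?thesis using True tendsto_upperbound by (metis at_neq_bot)
    qed
    then obtain h where "h holomorphic_on S" "\<forall>z\<in>S - K. h z = g z"
      using insert.IH[OF insert.prems(1) g(1)] by blast
    then show ?thesis using g(2) by (intro exI[of _ h]) auto
  qed
qed

text \<open>Cauchy's inequality bounds the derivative on the disc of radius \<open>r\<close> by \<open>M / r\<close>; it is applied with a
  radius slightly smaller than \<open>r\<close>, because \<open>g\<close> is controlled on an open disc only.\<close>

lemma bounded_holomorphic_increment:
  fixes g :: "complex \<Rightarrow> complex"
  assumes g: "g holomorphic_on ball 0 (2 * r)" and M: "\<And>t. t \<in> ball 0 (2 * r) \<Longrightarrow> cmod (g t) \<le> M"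
    and s: "cmod s < r"
  shows "cmod (g s - g 0) \<le> M / r * cmod s"
proof -
  have r: "r > 0" using s norm_ge_zero[of s] by linarith
  have d: "cmod (deriv g t) \<le> M / r" if "t \<in> ball 0 r" for t
  proof -
    have sub: "cball t (r - e) \<subseteq> ball 0 (2 * r)" if "e > 0" for e
    proof
      fix y assume "y \<in> cball t (r - e)"
      then show "y \<in> ball 0 (2 * r)"
        using norm_triangle_ineq2[of y t] \<open>t \<in> ball 0 r\<close> that by (auto simp: dist_norm norm_minus_commute)
    qed
    have e: "cmod (deriv g t) \<le> M / (r - e)" if "0 < e" "e < r" for e
    proof -
      have "cmod ((deriv ^^ 1) g t) \<le> fact 1 * M / (r - e) ^ 1"
      proof (rule Cauchy_inequality)
        show "g holomorphic_on ball t (r - e)"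
          using g sub[OF that(1)] by (meson ball_subset_cball holomorphic_on_subset order_trans)
        show "continuous_on (cball t (r - e)) g"
          using g sub[OF that(1)] by (meson holomorphic_on_imp_continuous_on holomorphic_on_subset)
        show "cmod (g x) \<le> M" if "cmod (t - x) = r - e" for x
        proof (rule M)
          have "x \<in> cball t (r - e)" by (simp add: dist_norm that)
          then show "x \<in> ball 0 (2 * r)" using sub[OF \<open>0 < e\<close>] by blast
        qed
      qed (use that in auto)
      then show ?thesis by simp
    qed
    have lim: "((\<lambda>e. M / (r - e)) \<longlongrightarrow> M / (r - 0)) (at_right 0)"
      using r by (intro tendsto_intros) auto
    have ev: "\<forall>\<^sub>F e in at_right 0. cmod (deriv g t) \<le> M / (r - e)"
      using eventually_at_right_less[of 0] eventually_at_right_field[of _ 0] r e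
      by (metis (mono_tags, lifting) eventually_at_right_field)
    show ?thesis using tendsto_lowerbound[OF lim ev] by simp
  qed
  have "cmod (g s - g 0) \<le> (M / r) * cmod (s - 0)"
  proof (rule field_differentiable_bound[of "ball 0 r" g "deriv g"])
    show "(g has_field_derivative deriv g z) (at z within ball 0 r)" if "z \<in> ball 0 r" for z
      using holomorphic_derivI[OF g, of z] that r by (auto intro: has_field_derivative_at_within)
  qed (use d s r in auto)
  then show ?thesis by simp
qed

text \<open>The difference quotient is itself holomorphic and bounded by \<open>M / r\<close>, so the previous lemma applies
  to it.\<close>

lemma holomorphic_difference_quotient:
  fixes g :: "complex \<Rightarrow> complex"
  assumes g: "g holomorphic_on ball 0 (4 * r)" and M: "\<And>t. t \<in> ball 0 (4 * r) \<Longrightarrow> cmod (g t) \<le> M"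
    and s: "cmod s < r" "s \<noteq> 0"
  shows "cmod ((g s - g 0) / s - deriv g 0) \<le> M / r\<^sup>2 * cmod s"
proof -
  have r: "r > 0" using s norm_ge_zero[of s] by linarith
  define q where "q t = (if t = 0 then deriv g 0 else (g t - g 0) / (t - 0))" for t
  have q: "q holomorphic_on ball 0 (4 * r)"
    unfolding q_def using pole_lemma[OF g, of 0] r by simp
  have M0: "M \<ge> 0" using M[of 0] r norm_ge_zero[of "g 0"] by (simp del: norm_ge_zero)
  have b: "cmod (q t) \<le> M / r" if t: "t \<in> ball 0 (2 * r)" for t
  proof (cases "t = 0")
    case True
    have "cmod ((deriv ^^ 1) g 0) \<le> fact 1 * M / r ^ 1"
    proof (rule Cauchy_inequality)
      show "g holomorphic_on ball 0 r" by (rule holomorphic_on_subset[OF g]) (use r in auto)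
      show "continuous_on (cball 0 r) g"
        by (rule holomorphic_on_imp_continuous_on[OF holomorphic_on_subset[OF g]]) (use r in auto)
    qed (use r M in auto)
    then show ?thesis using True by (simp add: q_def)
  next
    case False
    have "cmod (g t - g 0) \<le> M / (2 * r) * cmod t"
    proof (rule bounded_holomorphic_increment)
      show "g holomorphic_on ball 0 (2 * (2 * r))" using g by simp
    qed (use t M in auto)
    also have "\<dots> \<le> M / r * cmod t" using r M0 by (intro mult_right_mono divide_left_mono) auto
    finally show ?thesis using False by (simp add: q_def norm_divide divide_le_eq)
  qed
  have "cmod (q s - q 0) \<le> (M / r) / r * cmod s"
  proof (rule bounded_holomorphic_increment)
    show "q holomorphic_on ball 0 (2 * r)" by (rule holomorphic_on_subset[OF q]) (use r in auto)
  qed (use b s in auto)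
  then show ?thesis using s(2) by (simp add: q_def power2_eq_square)
qed

section \<open>Density of regular points\<close>

lemma eventually_affine_nonzero:
  fixes c d :: complex
  assumes "d \<noteq> 0"
  shows "\<forall>\<^sub>F n in sequentially. c + of_real (inverse (real (Suc n))) * d \<noteq> 0"
proof (cases "c = 0")
  case True
  then show ?thesis using assms by (auto simp del: of_nat_Suc)
next
  case False
  have "(\<lambda>n. c + complex_of_real (inverse (real (Suc n))) * d) \<longlonglongrightarrow> c + of_real 0 * d"
    by (intro tendsto_intros LIMSEQ_inverse_real_of_nat)
  then show ?thesis using False by (intro tendsto_imp_eventually_ne[of _ c]) auto
qed

lemma avoid_hyperplanes:
  fixes S :: "(real^'r) set"
  assumes "finite S" "0 \<notin> S"
  shows "\<exists>d. \<forall>a\<in>S. a \<bullet> d \<noteq> 0"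
  using assms
proof (induction S rule: finite_induct)
  case empty
  then show ?case by auto
next
  case (insert a S)
  then obtain d where d: "\<And>b. b \<in> S \<Longrightarrow> b \<bullet> d \<noteq> 0" by auto
  have a: "a \<noteq> 0" using insert by auto
  have "\<forall>\<^sub>F n in sequentially. b \<bullet> (d + inverse (real (Suc n)) *\<^sub>R a) \<noteq> 0" if b: "b \<in> insert a S" for b
  proof (cases "b \<bullet> d = 0")
    case True
    then have "b = a" using b d by auto
    then show ?thesis using True a by (simp add: inner_add_right del: of_nat_Suc)
  next
    case False
    have "(\<lambda>n. b \<bullet> (d + inverse (real (Suc n)) *\<^sub>R a)) \<longlonglongrightarrow> b \<bullet> (d + 0 *\<^sub>R a)"
      by (intro tendsto_intros LIMSEQ_inverse_real_of_nat)
    then show ?thesis using False by (intro tendsto_imp_eventually_ne) auto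
  qed
  then have "\<forall>\<^sub>F n in sequentially. \<forall>b\<in>insert a S. b \<bullet> (d + inverse (real (Suc n)) *\<^sub>R a) \<noteq> 0"
    using insert(1) by (subst eventually_ball_finite_distrib) auto
  from eventually_happens'[OF _ this] show ?case by auto
qed

lemma eventually_cpair_nonzero:
  assumes "finite S" "\<And>a. a \<in> S \<Longrightarrow> a \<bullet> d \<noteq> 0"
  shows "\<forall>\<^sub>F n in sequentially. \<forall>a\<in>S. cpair (z + inverse (real (Suc n)) *\<^sub>R (d, 0)) a \<noteq> 0"
  unfolding eventually_ball_finite_distrib[OF assms(1)]
proof
  fix a assume "a \<in> S"
  then have "complex_of_real (d \<bullet> a) \<noteq> 0" using assms(2) by (simp add: inner_commute)
  from eventually_affine_nonzero[OF this, of "cpair z a"]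
  show "\<forall>\<^sub>F n in sequentially. cpair (z + inverse (real (Suc n)) *\<^sub>R (d, 0)) a \<noteq> 0"
    by (simp only: cpair_add cpair_scaleR cpair_real)
qed

lemma tendsto_perturb: "(\<lambda>n. (z::'b::real_normed_vector) + inverse (real (Suc n)) *\<^sub>R d) \<longlonglongrightarrow> z"
proof -
  have "(\<lambda>n. z + inverse (real (Suc n)) *\<^sub>R d) \<longlonglongrightarrow> z + 0 *\<^sub>R d"
    by (intro tendsto_intros LIMSEQ_inverse_real_of_nat)
  then show ?thesis by simp
qed

section \<open>The estimate for alternating sums\<close>

text \<open>Comparable with the exponential of the maximum that occurs in the theorem, and easier to pass to the
  limit with.\<close>

definition exp_sum :: "(real^'r) set \<Rightarrow> 'r::finite spectral \<Rightarrow> 'r spectral \<Rightarrow> real" where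
  "exp_sum \<Phi> z X = (\<Sum>w\<in>reflection_group \<Phi>. exp (Re (cbil (act w z) X)))"

definition decay :: "(real^'r) set \<Rightarrow> 'r::finite spectral \<Rightarrow> 'r spectral \<Rightarrow> real" where
  "decay P z X = (\<Prod>\<alpha>\<in>P. inverse (1 + cmod (cpair X \<alpha>) * cmod (cpair z \<alpha>)))"

definition decay_sum :: "real^'r \<Rightarrow> (real^'r) set \<Rightarrow> 'r::finite spectral \<Rightarrow> 'r spectral \<Rightarrow> real" where
  "decay_sum v \<Phi> z X = (\<Sum>w\<in>reflection_group \<Phi>. decay (pos_roots v \<Phi>) (act w z) X)"

definition root_prod :: "(real^'r) set \<Rightarrow> 'r::finite spectral \<Rightarrow> 'r spectral \<Rightarrow> real" where
  "root_prod P z X = (\<Prod>\<alpha>\<in>P. cmod (cpair z \<alpha>) * cmod (cpair X \<alpha>))"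

lemma exp_sum_nonneg: "exp_sum \<Phi> z X \<ge> 0" by (simp add: exp_sum_def sum_nonneg)
lemma decay_nonneg: "decay P z X \<ge> 0" by (simp add: decay_def prod_nonneg)
lemma decay_sum_nonneg: "decay_sum v P z X \<ge> 0" by (simp add: decay_sum_def sum_nonneg decay_nonneg)
lemma root_prod_nonneg: "root_prod P z X \<ge> 0" by (simp add: root_prod_def prod_nonneg)

lemma tendsto_cpair [tendsto_intros]: "(f \<longlongrightarrow> z) F \<Longrightarrow> ((\<lambda>x. cpair (f x) \<alpha>) \<longlongrightarrow> cpair z \<alpha>) F"
  unfolding cpair_def by (auto intro!: tendsto_intros)
lemma tendsto_cbil [tendsto_intros]:
  "(f \<longlongrightarrow> z) F \<Longrightarrow> (g \<longlongrightarrow> X) F \<Longrightarrow> ((\<lambda>x. cbil (f x) (g x)) \<longlongrightarrow> cbil z X) F"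
  unfolding cbil_def by (auto intro!: tendsto_intros)
lemma tendsto_act [tendsto_intros]:
  "linear w \<Longrightarrow> (f \<longlongrightarrow> z) F \<Longrightarrow> ((\<lambda>x. act w (f x)) \<longlongrightarrow> act w z) F"
  unfolding act_def by (intro tendsto_intros linear_continuous_at[THEN isContD, THEN tendsto_compose[rotated]] 
      linear_conv_bounded_linear[THEN iffD1] bounded_linear.tendsto[of w]) auto

lemma tendsto_alt_sum:
  assumes "(f \<longlongrightarrow> z) F" "(g \<longlongrightarrow> X) F"
  shows "((\<lambda>x. alt_sum \<Phi> (f x) (g x)) \<longlongrightarrow> alt_sum \<Phi> z X) F"
  unfolding alt_sum_def by (intro tendsto_intros assms reflection_group_linear)

lemma tendsto_exp_sum:
  assumes "(f \<longlongrightarrow> z) F" "(g \<longlongrightarrow> X) F"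
  shows "((\<lambda>x. exp_sum \<Phi> (f x) (g x)) \<longlongrightarrow> exp_sum \<Phi> z X) F"
  unfolding exp_sum_def by (intro tendsto_intros assms reflection_group_linear)

lemma one_plus_nz: "1 + cmod a * cmod b \<noteq> 0"
  by (metis add_pos_nonneg less_irrefl mult_nonneg_nonneg norm_ge_zero zero_less_one)

lemma tendsto_decay_sum:
  assumes "(f \<longlongrightarrow> z) F" "(g \<longlongrightarrow> X) F"
  shows "((\<lambda>x. decay_sum v \<Phi> (f x) (g x)) \<longlongrightarrow> decay_sum v \<Phi> z X) F"
  unfolding decay_sum_def decay_def by (intro tendsto_intros assms reflection_group_linear one_plus_nz)

lemma tendsto_root_prod:
  assumes "(f \<longlongrightarrow> z) F" "(g \<longlongrightarrow> X) F"
  shows "((\<lambda>x. root_prod P (f x) (g x)) \<longlongrightarrow> root_prod P z X) F"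
  unfolding root_prod_def by (intro tendsto_intros assms)

text \<open>Each root in the span of \<open>S\<close> is a fixed linear combination of elements of \<open>S\<close>. As there are finitely many
  subsets and roots, one constant serves for all of them.\<close>

lemma span_bound:
  fixes \<Phi> :: "(real^'r) set"
  assumes \<Phi>: "finite \<Phi>"
  obtains K :: real where "K \<ge> 1" "\<And>S \<alpha> X s. S \<subseteq> \<Phi> \<Longrightarrow> \<alpha> \<in> \<Phi> \<Longrightarrow> \<alpha> \<in> span S \<Longrightarrow>
    (\<And>\<beta>. \<beta> \<in> S \<Longrightarrow> cmod (cpair X \<beta>) \<le> s) \<Longrightarrow> s \<ge> 0 \<Longrightarrow> cmod (cpair X \<alpha>) \<le> K * s"
proof -
  let ?I = "Pow \<Phi> \<times> \<Phi>"
  have "\<forall>p\<in>?I. \<exists>k\<ge>0. snd p \<in> span (fst p) \<longrightarrow> (\<forall>X s. (\<forall>\<beta>\<in>fst p. cmod (cpair X \<beta>) \<le> s) \<longrightarrow> s \<ge> 0 \<longrightarrow>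
      cmod (cpair X (snd p)) \<le> k * s)"
  proof
    fix p assume p: "p \<in> ?I"
    define S where "S = fst p"
    define \<alpha> where "\<alpha> = snd p"
    have S: "finite S" using p finite_subset[OF _ \<Phi>] by (auto simp: S_def)
    show "\<exists>k\<ge>0. snd p \<in> span (fst p) \<longrightarrow> (\<forall>X s. (\<forall>\<beta>\<in>fst p. cmod (cpair X \<beta>) \<le> s) \<longrightarrow> s \<ge> 0 \<longrightarrow>
      cmod (cpair X (snd p)) \<le> k * s)"
    proof (cases "\<alpha> \<in> span S")
      case True
      then obtain c where c: "\<alpha> = (\<Sum>\<beta>\<in>S. c \<beta> *\<^sub>R \<beta>)" using span_finite[OF S] by auto
      have "cmod (cpair X \<alpha>) \<le> (\<Sum>\<beta>\<in>S. \<bar>c \<beta>\<bar>) * s" if "\<forall>\<beta>\<in>S. cmod (cpair X \<beta>) \<le> s" "s \<ge> 0" for X s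
      proof -
        have "cmod (cpair X \<alpha>) \<le> (\<Sum>\<beta>\<in>S. cmod (of_real (c \<beta>) * cpair X \<beta>))"
          unfolding c cpair_sum_right cpair_scaleR_right by (rule norm_sum)
        also have "\<dots> \<le> (\<Sum>\<beta>\<in>S. \<bar>c \<beta>\<bar> * s)"
          using that by (intro sum_mono) (auto simp: norm_mult intro: mult_left_mono)
        finally show ?thesis by (simp add: sum_distrib_right)
      qed
      then show ?thesis by (intro exI[of _ "\<Sum>\<beta>\<in>S. \<bar>c \<beta>\<bar>"]) (auto simp: S_def \<alpha>_def sum_nonneg)
    next
      case False
      then show ?thesis by (intro exI[of _ 0]) (auto simp: S_def \<alpha>_def)
    qed
  qed
  then obtain k where k: "\<And>p. p \<in> ?I \<Longrightarrow> k p \<ge> (0::real) \<and> (snd p \<in> span (fst p) \<longrightarrow> (\<forall>X s. (\<forall>\<beta>\<in>fst p. cmod (cpair X \<beta>) \<le> s) \<longrightarrow> s \<ge> 0 \<longrightarrow>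
      cmod (cpair X (snd p)) \<le> k p * s))" by (metis (no_types, lifting))
  have fin: "finite ?I" using \<Phi> by simp
  show ?thesis
  proof (rule that[of "1 + sum k ?I"])
    show "1 \<le> 1 + sum k ?I" using k by (simp add: sum_nonneg)
    fix S \<alpha> X and s :: real
    assume a: "S \<subseteq> \<Phi>" "\<alpha> \<in> \<Phi>" "\<alpha> \<in> span S" "\<And>\<beta>. \<beta> \<in> S \<Longrightarrow> cmod (cpair X \<beta>) \<le> s" "s \<ge> 0"
    then have p: "(S, \<alpha>) \<in> ?I" by auto
    have "cmod (cpair X \<alpha>) \<le> k (S, \<alpha>) * s" using k[OF p, unfolded fst_conv snd_conv] a by blast
    also have "k (S, \<alpha>) \<le> sum k ?I" using k fin p by (intro member_le_sum) auto
    then have "k (S, \<alpha>) * s \<le> (1 + sum k ?I) * s" using a by (intro mult_right_mono) auto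
    finally show "cmod (cpair X \<alpha>) \<le> (1 + sum k ?I) * s" .
  qed
qed


lemma prod_factor_bound:
  fixes a b :: "'i \<Rightarrow> real"
  assumes "finite Q" "\<And>i. i \<in> Q \<Longrightarrow> 0 \<le> a i \<and> a i \<le> c * b i" "c \<ge> 1" "card Q \<le> N" "\<And>i. i \<in> Q \<Longrightarrow> 0 \<le> b i"
  shows "(\<Prod>i\<in>Q. a i) \<le> c ^ N * (\<Prod>i\<in>Q. b i)"
proof -
  have "(\<Prod>i\<in>Q. a i) \<le> (\<Prod>i\<in>Q. c * b i)" using assms by (intro prod_mono) auto
  also have "\<dots> = c ^ card Q * (\<Prod>i\<in>Q. b i)" by (simp add: prod.distrib)
  also have "\<dots> \<le> c ^ N * (\<Prod>i\<in>Q. b i)"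
    using assms by (intro mult_right_mono power_increasing prod_nonneg) auto
  finally show ?thesis .
qed

text \<open>The passage from \<open>\<Psi>\<close> to \<open>\<Phi>\<close>. After averaging, each summand is bounded by the estimate for \<open>\<Psi>\<close> at \<open>w z'\<close>.
  For \<open>\<alpha> \<in> \<Psi>\<close> its decay factors at \<open>z'\<close> are controlled by those at \<open>z\<close>. For \<open>\<alpha> \<in> \<Phi> - \<Psi>\<close> the factor
  \<open>\<langle>w z', \<alpha>\<rangle> \<langle>X, \<alpha>\<rangle>\<close>, which is present on the right-hand side only, is at least of order
  \<open>1 + m |\<langle>w z, \<alpha>\<rangle>|\<close> and so pays for the decay factor of \<open>\<alpha>\<close>. Here it matters that \<open>m\<close> replaces \<open>|\<langle>X, \<alpha>\<rangle>|\<close>,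
  since then the product over \<open>\<Phi> - \<Psi>\<close> does not change when \<open>w\<close> is replaced by \<open>u \<circ> w\<close> with \<open>u\<close> in the
  group of \<open>\<Psi>\<close>.\<close>

lemma coset_step:
  fixes \<Phi> \<Psi> :: "(real^'r) set"
  assumes \<Phi>: "root_set \<Phi>" and \<Psi>: "root_set \<Psi>" "\<Psi> \<subseteq> \<Phi>" and v: "\<And>\<alpha>. \<alpha> \<in> \<Phi> \<Longrightarrow> \<alpha> \<bullet> v \<noteq> 0"
    and C: "C \<ge> 0" "\<And>z X. cmod (alt_sum \<Psi> z X) \<le> C * root_prod (pos_roots v \<Psi>) z X * exp_sum \<Psi> z X * decay_sum v \<Psi> z X"
    and m: "m > 0" "\<And>\<alpha>. \<alpha> \<in> \<Phi> \<Longrightarrow> cmod (cpair X \<alpha>) \<le> m"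
    and \<epsilon>: "0 < \<epsilon>" "\<epsilon> \<le> 1" "\<And>\<alpha>. \<alpha> \<in> \<Phi> - \<Psi> \<Longrightarrow> cmod (cpair X \<alpha>) \<ge> \<epsilon> * m"
    and \<kappa>: "0 < \<kappa>" "\<kappa> \<le> 1" "\<And>\<alpha>. \<alpha> \<in> \<Phi> \<Longrightarrow> cmod (cpair z' \<alpha>) \<ge> \<kappa> * (1 / m + cmod (cpair z \<alpha>))"
  shows "cmod (alt_sum \<Phi> z' X) \<le> C * (inverse (\<epsilon> * \<kappa>)) ^ (2 * card (pos_roots v \<Phi>)) *
     root_prod (pos_roots v \<Phi>) z' X * exp_sum \<Phi> z' X * decay_sum v \<Phi> z X"
proof -
  let ?P = "pos_roots v \<Phi>" and ?P' = "pos_roots v \<Psi>" and ?Q = "pos_roots v (\<Phi> - \<Psi>)"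
  let ?W = "reflection_group \<Phi>" and ?W' = "reflection_group \<Psi>"
  define c where "c = inverse (\<epsilon> * \<kappa>)"
  define N where "N = card ?P"
  have finP: "finite ?P" and finW: "finite ?W" and finW': "finite ?W'"
    using \<Phi> \<Psi> finite_reflection_group by (auto simp: pos_roots_def root_set_def)
  have P: "?P = ?P' \<union> ?Q" "?P' \<inter> ?Q = {}" "finite ?P'" "finite ?Q"
    using \<Psi>(2) finite_subset[OF _ finP, of ?P'] finite_subset[OF _ finP, of ?Q] by (auto simp: pos_roots_def)
  have card: "card ?P' \<le> N" "card ?Q \<le> N" unfolding N_def using P finP by (auto intro!: card_mono)
  have "\<epsilon> * \<kappa> > 0" "\<epsilon> * \<kappa> \<le> 1" using \<epsilon>(1,2) \<kappa>(1,2) by (simp_all add: mult_le_one)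
  then have c1: "c \<ge> 1" unfolding c_def by (rule one_le_inverse)
  have W': "?W' \<subseteq> ?W" by (rule reflection_group_mono[OF \<Psi>(2)])
  have root_inv: "w' \<alpha> \<in> \<Phi>" if "w' \<in> ?W" "\<alpha> \<in> \<Phi>" for w' \<alpha> using reflection_group_maps[OF that(1) \<Phi> that(2)] .
  have low: "cmod (cpair (act w z') \<alpha>) \<ge> \<kappa> * (1 / m + cmod (cpair (act w z) \<alpha>))"
    if w: "w \<in> ?W" and a: "\<alpha> \<in> \<Phi>" for w \<alpha>
  proof -
    obtain w' where w': "w' \<in> ?W" "w \<circ> w' = id" using reflection_group_inverse[OF w] by blast
    have eq: "cpair (act w z) \<alpha> = cpair z (w' \<alpha>)" for z
      using cpair_act[OF w, of z "w' \<alpha>"] w'(2) by (simp add: pointfree_idE)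
    show ?thesis unfolding eq by (rule \<kappa>(3)[OF root_inv[OF w'(1) a]])
  qed
  \<comment> \<open>Both kinds of roots at once, for one summand of the average and one term of its decay sum.\<close>
  have summand: "root_prod ?P' (act w z') X * decay ?P' (act u (act w z')) X
      \<le> c ^ (2 * N) * (root_prod ?P z' X * decay ?P (act (u \<circ> w) z) X)"
    if w: "w \<in> ?W" and u: "u \<in> ?W'" for w u
  proof -
    let ?y = "act w z" and ?y' = "act w z'"
    have uw: "u \<circ> w \<in> ?W" using u W' w by (intro reflection_group_comp) auto
    have "(\<Prod>\<alpha>\<in>pos_roots v (\<Phi> - {}). cmod (cpair ?y' \<alpha>)) = (\<Prod>\<alpha>\<in>pos_roots v (\<Phi> - {}). cmod (cpair z' \<alpha>))"
      using prod_pos_act(2)[OF \<Phi> \<Phi> subset_refl v w, of "\<lambda>x. x" z'] by simp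
    then have rp: "root_prod ?P z' X = root_prod ?P ?y' X" by (simp add: root_prod_def prod.distrib)
    have split: "root_prod ?P ?y' X = root_prod ?P' ?y' X * root_prod ?Q ?y' X"
      unfolding root_prod_def P(1) using P by (intro prod.union_disjoint) auto
    have dsplit: "decay ?P (act u ?y) X = decay ?P' (act u ?y) X * decay ?Q (act u ?y) X"
      unfolding decay_def P(1) using P by (intro prod.union_disjoint) auto
    have d': "decay ?P' (act u ?y') X \<le> c ^ N * decay ?P' (act u ?y) X"
      unfolding decay_def
    proof (rule prod_factor_bound[OF P(3) _ c1 card(1)])
      fix \<alpha> assume a: "\<alpha> \<in> ?P'"
      then have "\<alpha> \<in> \<Phi>" using \<Psi>(2) by (auto simp: pos_roots_def)
      let ?x = "cmod (cpair X \<alpha>)"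
      let ?s = "cmod (cpair (act u ?y') \<alpha>)" and ?t = "cmod (cpair (act u ?y) \<alpha>)"
      have "?s \<ge> \<kappa> * (1 / m + ?t)" using low[OF uw \<open>\<alpha> \<in> \<Phi>\<close>] by (simp add: act_comp)
      moreover have "\<kappa> * (1 / m + ?t) \<ge> \<kappa> * ?t" using \<kappa> m by (intro mult_left_mono) auto
      ultimately have "?s \<ge> \<kappa> * ?t" by linarith
      then have "?x * (\<kappa> * ?t) \<le> ?x * ?s" by (intro mult_left_mono) auto
      then have "\<kappa> * (1 + ?x * ?t) \<le> 1 + ?x * ?s" using \<kappa> by (simp add: algebra_simps)
      moreover have "(\<epsilon> * \<kappa>) * (1 + ?x * ?t) \<le> \<kappa> * (1 + ?x * ?t)"
        using \<epsilon> \<kappa> by (intro mult_right_mono) (auto simp: mult_le_cancel_right2)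
      ultimately have "(\<epsilon> * \<kappa>) * (1 + ?x * ?t) \<le> 1 + ?x * ?s" by linarith
      then have "inverse (1 + ?x * ?s) \<le> inverse ((\<epsilon> * \<kappa>) * (1 + ?x * ?t))"
        using \<epsilon> \<kappa> by (intro le_imp_inverse_le mult_pos_pos add_pos_nonneg) auto
      then show "0 \<le> inverse (1 + ?x * ?s) \<and> inverse (1 + ?x * ?s) \<le> c * inverse (1 + ?x * ?t)"
        by (simp add: c_def)
    qed simp
    have q: "1 \<le> c ^ N * (root_prod ?Q ?y' X * decay ?Q (act u ?y) X)"
    proof -
      have "(\<Prod>\<alpha>\<in>?Q. (1::real)) \<le> c ^ N * (\<Prod>\<alpha>\<in>?Q. cmod (cpair ?y' \<alpha>) * cmod (cpair X \<alpha>) * inverse (1 + m * cmod (cpair ?y \<alpha>)))"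
      proof (rule prod_factor_bound[OF P(4) _ c1 card(2)])
        fix \<alpha> assume "\<alpha> \<in> ?Q"
        then have a: "\<alpha> \<in> \<Phi> - \<Psi>" by (auto simp: pos_roots_def)
        let ?x = "cmod (cpair X \<alpha>)" and ?s = "cmod (cpair ?y' \<alpha>)" and ?t = "cmod (cpair ?y \<alpha>)"
        have "(\<kappa> * (1 / m + ?t)) * (\<epsilon> * m) \<le> ?s * ?x"
          using low[OF w, of \<alpha>] \<epsilon>(3)[OF a] a \<kappa> \<epsilon> m by (intro mult_mono) auto
        also have "(\<kappa> * (1 / m + ?t)) * (\<epsilon> * m) = (\<epsilon> * \<kappa>) * (1 + m * ?t)" using m by (simp add: field_simps)
        finally have "1 \<le> c * (?s * ?x * inverse (1 + m * ?t))"
          using \<epsilon> \<kappa> m unfolding c_def by (simp add: field_simps add_pos_nonneg)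
        then show "0 \<le> (1::real) \<and> 1 \<le> c * (?s * ?x * inverse (1 + m * ?t))" by simp
      qed (use m in auto)
      also have "(\<Prod>\<alpha>\<in>?Q. cmod (cpair ?y' \<alpha>) * cmod (cpair X \<alpha>) * inverse (1 + m * cmod (cpair ?y \<alpha>)))
          = root_prod ?Q ?y' X * (\<Prod>\<alpha>\<in>?Q. inverse (1 + m * cmod (cpair ?y \<alpha>)))"
        unfolding root_prod_def by (rule prod.distrib)
      also have "(\<Prod>\<alpha>\<in>?Q. inverse (1 + m * cmod (cpair ?y \<alpha>))) = (\<Prod>\<alpha>\<in>?Q. inverse (1 + m * cmod (cpair (act u ?y) \<alpha>)))"
        by (rule prod_pos_act(1)[OF \<Phi> \<Psi> v u, of "\<lambda>x. inverse (1 + m * x)", symmetric])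
      also have "\<dots> \<le> decay ?Q (act u ?y) X"
        unfolding decay_def
      proof (intro prod_mono conjI)
        fix \<alpha> assume "\<alpha> \<in> ?Q"
        then have "cmod (cpair X \<alpha>) \<le> m" using m by (auto simp: pos_roots_def)
        then show "inverse (1 + m * cmod (cpair (act u ?y) \<alpha>)) \<le> inverse (1 + cmod (cpair X \<alpha>) * cmod (cpair (act u ?y) \<alpha>))"
          by (intro le_imp_inverse_le add_left_mono mult_right_mono add_pos_nonneg) auto
      qed (use m in auto)
      finally show ?thesis using c1 root_prod_nonneg[of ?Q ?y' X] by (simp add: mult_left_mono)
    qed
    have "root_prod ?P' ?y' X * decay ?P' (act u ?y') X \<le> root_prod ?P' ?y' X * (c ^ N * decay ?P' (act u ?y) X) * 1"
      using mult_left_mono[OF d' root_prod_nonneg] by simp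
    also have "\<dots> \<le> root_prod ?P' ?y' X * (c ^ N * decay ?P' (act u ?y) X) * (c ^ N * (root_prod ?Q ?y' X * decay ?Q (act u ?y) X))"
      using c1 by (intro mult_left_mono[OF q] mult_nonneg_nonneg root_prod_nonneg decay_nonneg) auto
    also have "\<dots> = c ^ (2 * N) * (root_prod ?P z' X * decay ?P (act (u \<circ> w) z) X)"
      by (simp add: rp split dsplit act_comp power_mult power2_eq_square power_mult_distrib)
    finally show ?thesis .
  qed
  define G where "G w = decay ?P (act w z) X" for w
  define E where "E = exp_sum \<Phi> z' X"
  define p where "p = root_prod ?P z' X"
  have E0: "E \<ge> 0" and p0: "p \<ge> 0" by (simp_all add: E_def p_def exp_sum_nonneg root_prod_nonneg)
  have Tw: "cmod (alt_sum \<Psi> (act w z') X) \<le> (\<Sum>u\<in>?W'. C * E * c ^ (2 * N) * p * G (u \<circ> w))" if w: "w \<in> ?W" for w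
  proof -
    have "exp_sum \<Psi> (act w z') X = (\<Sum>u\<in>?W'. exp (Re (cbil (act (u \<circ> w) z') X)))"
      by (simp add: exp_sum_def act_comp)
    also have "\<dots> = (\<Sum>w'\<in>(\<lambda>u. u \<circ> w) ` ?W'. exp (Re (cbil (act w' z') X)))"
    proof (subst sum.reindex)
      have "inj_on (\<lambda>u. u \<circ> w) ?W" using bij_comp_right[OF w] by (simp add: bij_betw_def)
      then show "inj_on (\<lambda>u. u \<circ> w) ?W'" by (rule inj_on_subset[OF _ W'])
    qed simp
    also have "\<dots> \<le> E" unfolding E_def exp_sum_def
      using W' w finW by (intro sum_mono2) (auto intro: reflection_group_comp)
    finally have e: "exp_sum \<Psi> (act w z') X \<le> E" .
    have "cmod (alt_sum \<Psi> (act w z') X) \<le> C * root_prod ?P' (act w z') X * exp_sum \<Psi> (act w z') X * decay_sum v \<Psi> (act w z') X"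
      by (rule C(2))
    also have "\<dots> \<le> C * root_prod ?P' (act w z') X * E * decay_sum v \<Psi> (act w z') X"
      using e C(1) by (intro mult_right_mono mult_left_mono mult_nonneg_nonneg root_prod_nonneg decay_sum_nonneg)
    also have "\<dots> = (\<Sum>u\<in>?W'. C * E * (root_prod ?P' (act w z') X * decay ?P' (act u (act w z')) X))"
      by (simp add: decay_sum_def sum_distrib_left mult.assoc mult.left_commute)
    also have "\<dots> \<le> (\<Sum>u\<in>?W'. C * E * (c ^ (2 * N) * (p * G (u \<circ> w))))"
      unfolding p_def G_def using summand[OF w] C(1) E0 by (intro sum_mono mult_left_mono mult_nonneg_nonneg) auto
    finally show ?thesis by (simp add: mult.assoc)
  qed
  have cardW': "card ?W' > 0" using finW' reflection_group.intros(1) by (auto simp: card_gt_0_iff)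
  have "real (card ?W') * cmod (alt_sum \<Phi> z' X) = cmod (\<Sum>w\<in>?W. of_real (det (matrix w)) * alt_sum \<Psi> (act w z') X)"
    using arg_cong[OF alt_sum_average[OF \<Phi> \<Psi>(2), of z' X], of cmod] by (simp add: norm_mult)
  also have "\<dots> \<le> (\<Sum>w\<in>?W. cmod (alt_sum \<Psi> (act w z') X))"
  proof (rule sum_norm_le)
    fix w assume "w \<in> ?W"
    then have "\<bar>det (matrix w)\<bar> = 1" using reflection_group_det \<Phi> by (force simp: root_set_def)
    then show "cmod (of_real (det (matrix w)) * alt_sum \<Psi> (act w z') X) \<le> cmod (alt_sum \<Psi> (act w z') X)"
      by (simp add: norm_mult)
  qed
  also have "\<dots> \<le> (\<Sum>w\<in>?W. \<Sum>u\<in>?W'. C * E * c ^ (2 * N) * p * G (u \<circ> w))"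
    by (intro sum_mono Tw)
  also have "\<dots> = (\<Sum>u\<in>?W'. \<Sum>w\<in>?W. C * E * c ^ (2 * N) * p * G (u \<circ> w))" by (rule sum.swap)
  also have "\<dots> = (\<Sum>u\<in>?W'. C * E * c ^ (2 * N) * p * decay_sum v \<Phi> z X)"
  proof (rule sum.cong[OF HOL.refl])
    fix u assume "u \<in> ?W'"
    then have "(\<Sum>w\<in>?W. G (u \<circ> w)) = decay_sum v \<Phi> z X"
      unfolding decay_sum_def G_def using W'
      by (intro sum.reindex_bij_betw[OF bij_comp_left]) auto
    then show "(\<Sum>w\<in>?W. C * E * c ^ (2 * N) * p * G (u \<circ> w)) = C * E * c ^ (2 * N) * p * decay_sum v \<Phi> z X"
      by (simp flip: sum_distrib_left)
  qed
  also have "\<dots> = real (card ?W') * (C * E * c ^ (2 * N) * p * decay_sum v \<Phi> z X)" by simp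
  finally have "cmod (alt_sum \<Phi> z' X) \<le> C * E * c ^ (2 * N) * p * decay_sum v \<Phi> z X"
    using cardW' by (simp add: mult_le_cancel_left_pos)
  then show ?thesis by (simp add: E_def c_def N_def p_def mult.assoc mult.left_commute)
qed


lemma reflection_group_empty: "reflection_group {} = {id}"
proof -
  have "w = id" if "w \<in> reflection_group {}" for w :: "real^'a \<Rightarrow> real^'a"
    using that by induction auto
  then show ?thesis using reflection_group_id by blast
qed

text \<open>The step of the induction at points where \<open>X\<close> is regular and where the zeros \<open>a \<alpha>\<close> of the linear
  functions \<open>t \<mapsto> \<langle>z + (t/m) u, \<alpha>\<rangle>\<close> are distinct, so that the alternating sum is divisible by their product.
  The direction \<open>u\<close> is the sum of the positive roots: it is regular, and \<open>|\<langle>w u, X\<rangle>|\<close> is at most a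
  multiple of \<open>m\<close>, so the exponential growth is stable on the circle.\<close>

lemma alt_sum_bound_generic:
  fixes \<Phi> :: "(real^'r) set"
  assumes \<Phi>: "root_set \<Phi>" "\<Phi> \<noteq> {}" and v: "\<And>\<alpha>. \<alpha> \<in> \<Phi> \<Longrightarrow> \<alpha> \<bullet> v \<noteq> 0"
  defines "P \<equiv> pos_roots v \<Phi>"
  defines "u \<equiv> \<Sum>\<alpha>\<in>P. \<alpha>"
  assumes C0: "C0 \<ge> 0" "\<And>S z X. S \<subseteq> \<Phi> \<Longrightarrow> \<Phi> \<inter> span S \<noteq> \<Phi> \<Longrightarrow> cmod (alt_sum (\<Phi> \<inter> span S) z X) \<le>
       C0 * root_prod (pos_roots v (\<Phi> \<inter> span S)) z X * exp_sum (\<Phi> \<inter> span S) z X * decay_sum v (\<Phi> \<inter> span S) z X"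
  shows "\<exists>C\<ge>0. \<forall>z X. (\<forall>\<alpha>\<in>P. cpair X \<alpha> \<noteq> 0) \<longrightarrow>
    (\<forall>\<alpha>\<in>P. \<forall>\<beta>\<in>P. \<alpha> \<noteq> \<beta> \<longrightarrow> cpair z ((1 / (u \<bullet> \<alpha>)) *\<^sub>R \<alpha> - (1 / (u \<bullet> \<beta>)) *\<^sub>R \<beta>) \<noteq> 0) \<longrightarrow>
    cmod (alt_sum \<Phi> z X) \<le> C * root_prod P z X * exp_sum \<Phi> z X * decay_sum v \<Phi> z X"
proof -
  let ?W = "reflection_group \<Phi>"
  define N where "N = card P"
  have fin\<Phi>: "finite \<Phi>" using \<Phi> by (simp add: root_set_def)
  have finP: "finite P" and P\<Phi>: "P \<subseteq> \<Phi>" using fin\<Phi> by (auto simp: P_def pos_roots_def)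
  obtain K where K: "K \<ge> 1" "\<And>S \<alpha> X s. S \<subseteq> \<Phi> \<Longrightarrow> \<alpha> \<in> \<Phi> \<Longrightarrow> \<alpha> \<in> span S \<Longrightarrow>
    (\<And>\<beta>. \<beta> \<in> S \<Longrightarrow> cmod (cpair X \<beta>) \<le> s) \<Longrightarrow> s \<ge> 0 \<Longrightarrow> cmod (cpair X \<alpha>) \<le> K * s"
    using span_bound[OF fin\<Phi>] by metis
  define \<epsilon> where "\<epsilon> = 1 / (2 * K)"
  have \<epsilon>: "0 < \<epsilon>" "\<epsilon> \<le> 1" "K * \<epsilon> = 1/2" using K(1) by (auto simp: \<epsilon>_def)
  have upos: "u \<bullet> \<alpha> > 0" if "\<alpha> \<in> P" for \<alpha>
    using sum_pos_dominant[OF \<Phi>(1)] that by (simp add: u_def P_def)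
  define \<delta> where "\<delta> = Min (insert 1 ((\<lambda>\<alpha>. u \<bullet> \<alpha>) ` P))"
  have \<delta>: "\<delta> > 0" "\<delta> \<le> 1" "\<And>\<alpha>. \<alpha> \<in> P \<Longrightarrow> \<delta> \<le> u \<bullet> \<alpha>" using finP upos by (auto simp: \<delta>_def)
  define \<kappa> where "\<kappa> = \<delta> / (4 * real N + 6)"
  have \<kappa>: "0 < \<kappa>" "\<kappa> \<le> 1" using \<delta> by (auto simp: \<kappa>_def divide_le_eq intro!: divide_pos_pos add_nonneg_pos)
  define D where "D = C0 * inverse (\<epsilon> * \<kappa>) ^ (2 * N)"
  have D: "D \<ge> 0" using C0(1) \<epsilon> \<kappa> by (simp add: D_def)
  define C where "C = D * exp ((real N + 1) * real N)"
  have "cmod (alt_sum \<Phi> z X) \<le> C * root_prod P z X * exp_sum \<Phi> z X * decay_sum v \<Phi> z X"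
    if reg: "\<forall>\<alpha>\<in>P. cpair X \<alpha> \<noteq> 0" and gen: "\<forall>\<alpha>\<in>P. \<forall>\<beta>\<in>P. \<alpha> \<noteq> \<beta> \<longrightarrow>
      cpair z ((1 / (u \<bullet> \<alpha>)) *\<^sub>R \<alpha> - (1 / (u \<bullet> \<beta>)) *\<^sub>R \<beta>) \<noteq> 0" for z X
  proof -
    define m where "m = Max ((\<lambda>\<alpha>. cmod (cpair X \<alpha>)) ` \<Phi>)"
    have m_ge: "cmod (cpair X \<alpha>) \<le> m" if "\<alpha> \<in> \<Phi>" for \<alpha> using fin\<Phi> that by (simp add: m_def)
    have "m \<in> (\<lambda>\<alpha>. cmod (cpair X \<alpha>)) ` \<Phi>" unfolding m_def using fin\<Phi> \<Phi>(2) by (intro Max_in) auto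
    then obtain \<alpha>0 where \<alpha>0: "\<alpha>0 \<in> \<Phi>" "cmod (cpair X \<alpha>0) = m" by auto
    have posneg: "\<alpha> \<in> P \<or> - \<alpha> \<in> P" if "\<alpha> \<in> \<Phi>" for \<alpha>
      using v[OF that] root_set_uminus[OF \<Phi>(1) that] that by (auto simp: P_def pos_roots_def)
    have m: "m > 0"
      using posneg[OF \<alpha>0(1)] reg \<alpha>0(2) by (force simp: cpair_minus_right)
    \<comment> \<open>By the choice of \<open>\<epsilon>\<close>, all roots in the span of \<open>S\<close> are at most \<open>m / 2\<close> on \<open>X\<close>, so the subsystem is proper.\<close>
    define S where "S = {\<alpha>\<in>\<Phi>. cmod (cpair X \<alpha>) \<le> \<epsilon> * m}"
    define \<Psi> where "\<Psi> = \<Phi> \<inter> span S"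
    have "\<alpha>0 \<notin> \<Psi>"
    proof
      assume "\<alpha>0 \<in> \<Psi>"
      then have "cmod (cpair X \<alpha>0) \<le> K * (\<epsilon> * m)"
        using m \<epsilon> by (intro K(2)[of S]) (auto simp: S_def \<Psi>_def)
      also have "K * (\<epsilon> * m) = m / 2" using \<epsilon>(3) by (simp flip: mult.assoc)
      finally show False using \<alpha>0(2) m by simp
    qed
    then have ne: "\<Phi> \<inter> span S \<noteq> \<Phi>" using \<alpha>0(1) by (auto simp: \<Psi>_def)
    have bd\<Psi>: "cmod (alt_sum \<Psi> z X) \<le> C0 * root_prod (pos_roots v \<Psi>) z X * exp_sum \<Psi> z X * decay_sum v \<Psi> z X" for z X
      unfolding \<Psi>_def by (rule C0(2)[OF _ ne]) (simp add: S_def)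
    have \<Psi>: "root_set \<Psi>" "\<Psi> \<subseteq> \<Phi>" unfolding \<Psi>_def by (rule root_set_sub[OF \<Phi>(1)]) simp
    have big: "cmod (cpair X \<alpha>) \<ge> \<epsilon> * m" if "\<alpha> \<in> \<Phi> - \<Psi>" for \<alpha>
    proof -
      have "\<alpha> \<notin> S" using that span_base[of \<alpha> S] by (auto simp: \<Psi>_def)
      then show ?thesis using that by (auto simp: S_def)
    qed
    define zt where "zt t = z + csc (t / of_real m) (u, 0)" for t
    have zt_pair: "cpair (zt t) \<alpha> = cpair z \<alpha> + t / of_real m * of_real (u \<bullet> \<alpha>)" for t \<alpha>
      by (simp add: zt_def cpair_add cpair_csc cpair_real)
    have zt_bil: "cbil (act w (zt t)) X = cbil (act w z) X + t / of_real m * cpair X (w u)" if "w \<in> ?W" for w t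
      using reflection_group_linear[OF that]
      by (simp add: zt_def act_add act_csc act_real cbil_add_left cbil_csc_left cbil_real_left)
    define a where "a \<alpha> = - of_real m * cpair z \<alpha> / of_real (u \<bullet> \<alpha>)" for \<alpha>
    have zt_a: "cpair (zt t) \<alpha> = of_real ((u \<bullet> \<alpha>) / m) * (t - a \<alpha>)" if "\<alpha> \<in> P" for t \<alpha>
      using upos[OF that] m by (simp add: zt_pair a_def field_simps)
    have a_norm: "cmod (a \<alpha>) * ((u \<bullet> \<alpha>) / m) = cmod (cpair z \<alpha>)" if "\<alpha> \<in> P" for \<alpha>
      using upos[OF that] m by (simp add: a_def norm_mult norm_divide)
    have inj: "inj_on a P"
    proof (rule inj_onI, rule ccontr)
      fix \<alpha> \<beta> assume ab: "\<alpha> \<in> P" "\<beta> \<in> P" "a \<alpha> = a \<beta>" "\<alpha> \<noteq> \<beta>"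
      then have "of_real m * (cpair z \<alpha> / of_real (u \<bullet> \<alpha>)) = of_real m * (cpair z \<beta> / of_real (u \<bullet> \<beta>))"
        by (simp add: a_def)
      then have "cpair z \<alpha> / of_real (u \<bullet> \<alpha>) = cpair z \<beta> / of_real (u \<bullet> \<beta>)"
        using m by (simp only: mult_cancel_left of_real_eq_0_iff) simp
      then have "cpair z ((1 / (u \<bullet> \<alpha>)) *\<^sub>R \<alpha> - (1 / (u \<bullet> \<beta>)) *\<^sub>R \<beta>) = 0"
        by (simp add: cpair_diff_right cpair_scaleR_right)
      then show False using gen ab by blast
    qed
    \<comment> \<open>On the circle of radius \<open>r\<close> all linear factors are bounded below as required by the coset step.\<close>
    obtain r where r: "1 \<le> r" "r \<le> real N + 1" "\<And>\<alpha>. \<alpha> \<in> P \<Longrightarrow> \<bar>cmod (a \<alpha>) - r\<bar> \<ge> 1/2"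
      using separated_radius[OF finP, of "\<lambda>\<alpha>. cmod (a \<alpha>)"] by (auto simp: N_def)
    define f where "f t = alt_sum \<Phi> (zt t) X" for t
    define E where "E = exp_sum \<Phi> z X"
    define R where "R = decay_sum v \<Phi> z X"
    have hol: "f holomorphic_on UNIV"
    proof -
      have "f = (\<lambda>t. \<Sum>w\<in>?W. of_real (det (matrix w)) * exp (cbil (act w z) X + t / of_real m * cpair X (w u)))"
        by (rule ext) (simp add: f_def alt_sum_def zt_bil)
      moreover have "\<dots> holomorphic_on UNIV" using m by (intro holomorphic_intros) auto
      ultimately show ?thesis by simp
    qed
    have zero: "f (a \<alpha>) = 0" if "\<alpha> \<in> P" for \<alpha>
      unfolding f_def using that P\<Phi> by (intro alt_sum_zero[OF \<Phi>(1), of \<alpha>]) (auto simp: zt_a)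
    have circle: "cmod (f t) \<le> (C * E * R * (\<Prod>\<alpha>\<in>P. (u \<bullet> \<alpha>) / m * cmod (cpair X \<alpha>))) * (\<Prod>\<alpha>\<in>P. cmod (t - a \<alpha>))"
      if t: "cmod t = r" for t
    proof -
      have lowP: "cmod (cpair (zt t) \<alpha>) \<ge> \<kappa> * (1 / m + cmod (cpair z \<alpha>))" if \<alpha>: "\<alpha> \<in> P" for \<alpha>
      proof -
        have "\<kappa> * (1 / m + cmod (cpair z \<alpha>)) \<le> ((u \<bullet> \<alpha>) / m + cmod (cpair z \<alpha>)) / (4 * real N + 6)"
        proof -
          have "\<delta> * (1 / m + cmod (cpair z \<alpha>)) = \<delta> / m + \<delta> * cmod (cpair z \<alpha>)" by (simp add: distrib_left)
          also have "\<dots> \<le> (u \<bullet> \<alpha>) / m + 1 * cmod (cpair z \<alpha>)"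
            using \<delta> m \<alpha> by (intro add_mono divide_right_mono mult_right_mono) auto
          finally show ?thesis unfolding \<kappa>_def times_divide_eq_left by (intro divide_right_mono) auto
        qed
        also have "(u \<bullet> \<alpha>) / m + cmod (cpair z \<alpha>) = (u \<bullet> \<alpha>) / m * (1 + cmod (a \<alpha>))"
          using a_norm[OF \<alpha>, symmetric] by (simp add: add_divide_distrib distrib_left mult.commute)
        also have "(u \<bullet> \<alpha>) / m * (1 + cmod (a \<alpha>)) / (4 * real N + 6) \<le> (u \<bullet> \<alpha>) / m * cmod (t - a \<alpha>)"
          unfolding times_divide_eq_right[symmetric] using upos[OF \<alpha>] m
          by (intro mult_left_mono separated_radius_growth[OF t r(1,2) _ r(3)[OF \<alpha>]]) auto
        also have "\<dots> = cmod (cpair (zt t) \<alpha>)" using upos[OF \<alpha>] m by (simp add: zt_a[OF \<alpha>] norm_mult norm_divide)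
        finally show ?thesis .
      qed
      have low: "cmod (cpair (zt t) \<alpha>) \<ge> \<kappa> * (1 / m + cmod (cpair z \<alpha>))" if "\<alpha> \<in> \<Phi>" for \<alpha>
        using posneg[OF that] lowP[of \<alpha>] lowP[of "- \<alpha>"] by (auto simp: cpair_minus_right)
      have "cmod (f t) \<le> D * root_prod P (zt t) X * exp_sum \<Phi> (zt t) X * R"
        using coset_step[OF \<Phi>(1) \<Psi> v C0(1) bd\<Psi> m m_ge \<epsilon>(1,2) big \<kappa> low]
        by (simp add: f_def D_def N_def P_def R_def)
      also have "\<dots> \<le> D * root_prod P (zt t) X * (exp ((real N + 1) * real N) * E) * R"
      proof (intro mult_right_mono mult_left_mono)
        show "exp_sum \<Phi> (zt t) X \<le> exp ((real N + 1) * real N) * E"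
          unfolding exp_sum_def E_def sum_distrib_left
        proof (rule sum_mono)
          fix w assume w: "w \<in> ?W"
          have "cmod (cpair X (w u)) \<le> (\<Sum>\<alpha>\<in>P. cmod (cpair X (w \<alpha>)))"
            unfolding u_def linear_sum[OF reflection_group_linear[OF w]] cpair_sum_right by (rule norm_sum)
          also have "\<dots> \<le> (\<Sum>\<alpha>\<in>P. m)"
            using P\<Phi> reflection_group_maps[OF w \<Phi>(1)] by (intro sum_mono m_ge) auto
          finally have "cmod (cpair X (w u)) \<le> real N * m" by (simp add: N_def)
          then have "r / m * cmod (cpair X (w u)) \<le> (real N + 1) / m * (real N * m)"
            using r m by (intro mult_mono divide_right_mono) auto
          then have "cmod (t / of_real m * cpair X (w u)) \<le> (real N + 1) * real N"
            using m t by (simp add: norm_mult norm_divide)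
          then have "Re (t / of_real m * cpair X (w u)) \<le> (real N + 1) * real N"
            using complex_Re_le_cmod order_trans by blast
          then show "exp (Re (cbil (act w (zt t)) X)) \<le> exp ((real N + 1) * real N) * exp (Re (cbil (act w z) X))"
            by (simp add: zt_bil[OF w] flip: exp_add)
        qed
      qed (use D in \<open>simp_all add: R_def decay_sum_nonneg root_prod_nonneg\<close>)
      also have "root_prod P (zt t) X = (\<Prod>\<alpha>\<in>P. (u \<bullet> \<alpha>) / m * cmod (cpair X \<alpha>)) * (\<Prod>\<alpha>\<in>P. cmod (t - a \<alpha>))"
        unfolding root_prod_def prod.distrib[symmetric]
        by (rule prod.cong) (use m in \<open>auto simp: zt_a norm_mult norm_divide abs_of_pos[OF upos]\<close>)
      finally show ?thesis by (simp add: C_def mult.assoc mult.left_commute mult.commute)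
    qed
    have r0: "r > 0" using r(1) by simp
    have rne: "cmod (a \<alpha>) \<noteq> r" if "\<alpha> \<in> P" for \<alpha> using r(3)[OF that] by auto
    have "cmod (f 0) \<le> (C * E * R * (\<Prod>\<alpha>\<in>P. (u \<bullet> \<alpha>) / m * cmod (cpair X \<alpha>))) * (\<Prod>\<alpha>\<in>P. cmod (a \<alpha>))"
      by (rule max_principle_quotient[OF finP hol inj zero r0 rne circle])
    also have "\<dots> = C * E * R * (\<Prod>\<alpha>\<in>P. ((u \<bullet> \<alpha>) / m * cmod (cpair X \<alpha>)) * cmod (a \<alpha>))"
      by (simp only: prod.distrib mult.assoc)
    also have "(\<Prod>\<alpha>\<in>P. ((u \<bullet> \<alpha>) / m * cmod (cpair X \<alpha>)) * cmod (a \<alpha>)) = root_prod P z X"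
      unfolding root_prod_def by (rule prod.cong) (simp_all add: a_norm[symmetric] algebra_simps)
    also have "f 0 = alt_sum \<Phi> z X" by (simp add: f_def zt_def csc_def zero_prod_def[symmetric])
    finally show ?thesis by (simp add: E_def R_def mult.assoc mult.left_commute mult.commute)
  qed
  moreover have "C \<ge> 0" using D by (simp add: C_def)
  ultimately show ?thesis by blast
qed

text \<open>Both sides are continuous, so the bound extends from the generic points to all points. Distinctness
  of the zeros is generic because no two positive roots are proportional.\<close>

lemma alt_sum_bound:
  fixes \<Phi> :: "(real^'r) set"
  assumes "root_set \<Phi>" and "\<And>\<alpha>. \<alpha> \<in> \<Phi> \<Longrightarrow> \<alpha> \<bullet> v \<noteq> 0"
  shows "\<exists>C\<ge>0. \<forall>z X. cmod (alt_sum \<Phi> z X) \<le> C * root_prod (pos_roots v \<Phi>) z X * exp_sum \<Phi> z X * decay_sum v \<Phi> z X"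
  using assms
proof (induction "card \<Phi>" arbitrary: \<Phi> rule: less_induct)
  case less
  note \<Phi> = less.prems(1) and v = less.prems(2)
  have fin\<Phi>: "finite \<Phi>" using \<Phi> by (simp add: root_set_def)
  show ?case
  proof (cases "\<Phi> = {}")
    case True
    have "det (matrix (id :: real^'r \<Rightarrow> real^'r)) = 1" by (simp only: matrix_id_mat_1 det_I)
    then show ?thesis unfolding True
      by (intro exI[of _ 1]) (simp add: alt_sum_def root_prod_def exp_sum_def decay_sum_def decay_def
          reflection_group_empty pos_roots_def act_id)
  next
    case False
    define P where "P = pos_roots v \<Phi>"
    define u where "u = (\<Sum>\<alpha>\<in>P. \<alpha>)"
    have finP: "finite P" and P\<Phi>: "P \<subseteq> \<Phi>" using fin\<Phi> by (auto simp: P_def pos_roots_def)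
    have "\<forall>S\<in>Pow \<Phi>. \<exists>C\<ge>0. \<Phi> \<inter> span S \<noteq> \<Phi> \<longrightarrow> (\<forall>z X. cmod (alt_sum (\<Phi> \<inter> span S) z X) \<le>
       C * root_prod (pos_roots v (\<Phi> \<inter> span S)) z X * exp_sum (\<Phi> \<inter> span S) z X * decay_sum v (\<Phi> \<inter> span S) z X)"
    proof
      fix S assume "S \<in> Pow \<Phi>"
      show "\<exists>C\<ge>0. \<Phi> \<inter> span S \<noteq> \<Phi> \<longrightarrow> (\<forall>z X. cmod (alt_sum (\<Phi> \<inter> span S) z X) \<le>
       C * root_prod (pos_roots v (\<Phi> \<inter> span S)) z X * exp_sum (\<Phi> \<inter> span S) z X * decay_sum v (\<Phi> \<inter> span S) z X)"
      proof (cases "\<Phi> \<inter> span S = \<Phi>")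
        case False
        then have "card (\<Phi> \<inter> span S) < card \<Phi>" using fin\<Phi> by (intro psubset_card_mono) auto
        from less.hyps[OF this root_set_sub[OF \<Phi>]] v show ?thesis by blast
      qed auto
    qed
    then obtain c where c: "\<And>S. S \<subseteq> \<Phi> \<Longrightarrow> c S \<ge> (0::real)" "\<And>S z X. S \<subseteq> \<Phi> \<Longrightarrow> \<Phi> \<inter> span S \<noteq> \<Phi> \<Longrightarrow> cmod (alt_sum (\<Phi> \<inter> span S) z X) \<le>
       c S * root_prod (pos_roots v (\<Phi> \<inter> span S)) z X * exp_sum (\<Phi> \<inter> span S) z X * decay_sum v (\<Phi> \<inter> span S) z X"
      unfolding Ball_def Pow_iff by metis
    define C0 where "C0 = sum c (Pow \<Phi>)"
    have C0: "C0 \<ge> 0" unfolding C0_def using c(1) by (intro sum_nonneg) auto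
    have "cmod (alt_sum (\<Phi> \<inter> span S) z X) \<le>
       C0 * root_prod (pos_roots v (\<Phi> \<inter> span S)) z X * exp_sum (\<Phi> \<inter> span S) z X * decay_sum v (\<Phi> \<inter> span S) z X"
      if S: "S \<subseteq> \<Phi>" "\<Phi> \<inter> span S \<noteq> \<Phi>" for S z X
    proof -
      have "c S \<le> C0" unfolding C0_def using c(1) S fin\<Phi> by (intro member_le_sum) auto
      then show ?thesis
        by (intro order_trans[OF c(2)[OF S]] mult_right_mono root_prod_nonneg exp_sum_nonneg decay_sum_nonneg)
    qed
    from alt_sum_bound_generic[OF \<Phi> False v C0 this]
    obtain C where C: "C \<ge> 0" and bd: "\<And>z X. \<lbrakk>\<forall>\<alpha>\<in>P. cpair X \<alpha> \<noteq> 0;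
      \<forall>\<alpha>\<in>P. \<forall>\<beta>\<in>P. \<alpha> \<noteq> \<beta> \<longrightarrow> cpair z ((1 / (u \<bullet> \<alpha>)) *\<^sub>R \<alpha> - (1 / (u \<bullet> \<beta>)) *\<^sub>R \<beta>) \<noteq> 0\<rbrakk> \<Longrightarrow>
      cmod (alt_sum \<Phi> z X) \<le> C * root_prod P z X * exp_sum \<Phi> z X * decay_sum v \<Phi> z X"
      unfolding P_def[symmetric] u_def[symmetric] by blast
    \<comment> \<open>The zeros for \<open>\<alpha>\<close> and \<open>\<beta>\<close> coincide exactly when \<open>z\<close> annihilates this vector.\<close>
    define T where "T = (\<lambda>(\<alpha>, \<beta>). (1 / (u \<bullet> \<alpha>)) *\<^sub>R \<alpha> - (1 / (u \<bullet> \<beta>)) *\<^sub>R \<beta>) ` {(\<alpha>, \<beta>) \<in> P \<times> P. \<alpha> \<noteq> \<beta>}"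
    have upos: "u \<bullet> \<alpha> > 0" if "\<alpha> \<in> P" for \<alpha>
      using sum_pos_dominant[OF \<Phi>] that by (simp add: u_def P_def)
    have "finite {(\<alpha>, \<beta>) \<in> P \<times> P. \<alpha> \<noteq> \<beta>}"
      by (rule finite_subset[of _ "P \<times> P"]) (use finP in auto)
    then have "finite T" unfolding T_def by (rule finite_imageI)
    moreover have "0 \<notin> T"
    proof
      assume "0 \<in> T"
      then obtain \<alpha> \<beta> where ab: "\<alpha> \<in> P" "\<beta> \<in> P" "\<alpha> \<noteq> \<beta>" "(1 / (u \<bullet> \<alpha>)) *\<^sub>R \<alpha> = (1 / (u \<bullet> \<beta>)) *\<^sub>R \<beta>"
        by (auto simp: T_def)
      then have "(u \<bullet> \<beta>) *\<^sub>R ((1 / (u \<bullet> \<alpha>)) *\<^sub>R \<alpha>) = \<beta>" using upos[OF ab(2)] by simp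
      then have eq: "\<beta> = ((u \<bullet> \<beta>) / (u \<bullet> \<alpha>)) *\<^sub>R \<alpha>" by simp
      then have "(u \<bullet> \<beta>) / (u \<bullet> \<alpha>) = 1 \<or> (u \<bullet> \<beta>) / (u \<bullet> \<alpha>) = - 1"
        using \<Phi> ab P\<Phi> unfolding root_set_def by (metis subsetD)
      moreover have "(u \<bullet> \<beta>) / (u \<bullet> \<alpha>) > 0" using upos ab by simp
      ultimately show False using eq ab by auto
    qed
    ultimately have "\<exists>d. \<forall>b\<in>T. b \<bullet> d \<noteq> 0" by (rule avoid_hyperplanes)
    then obtain d where d: "\<And>b. b \<in> T \<Longrightarrow> b \<bullet> d \<noteq> 0" by (elim exE) (rule that, erule bspec)
    have "cmod (alt_sum \<Phi> z X) \<le> C * root_prod P z X * exp_sum \<Phi> z X * decay_sum v \<Phi> z X" for z X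
    proof -
      let ?z = "\<lambda>n. z + inverse (real (Suc n)) *\<^sub>R (d, 0)" and ?X = "\<lambda>n. X + inverse (real (Suc n)) *\<^sub>R (v, 0)"
      note zX = tendsto_perturb[of z "(d, 0)"] tendsto_perturb[of X "(v, 0)"]
      have "\<forall>\<^sub>F n in sequentially. \<forall>\<alpha>\<in>P. cpair (?X n) \<alpha> \<noteq> 0"
        using v P\<Phi> by (intro eventually_cpair_nonzero finP) auto
      moreover have "\<forall>\<^sub>F n in sequentially. \<forall>\<alpha>\<in>T. cpair (?z n) \<alpha> \<noteq> 0"
        by (intro eventually_cpair_nonzero \<open>finite T\<close> d)
      ultimately have ev: "\<forall>\<^sub>F n in sequentially. cmod (alt_sum \<Phi> (?z n) (?X n)) \<le>
          C * root_prod P (?z n) (?X n) * exp_sum \<Phi> (?z n) (?X n) * decay_sum v \<Phi> (?z n) (?X n)"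
      proof eventually_elim
        case (elim n)
        show ?case
        proof (rule bd)
          show "\<forall>\<alpha>\<in>P. \<forall>\<beta>\<in>P. \<alpha> \<noteq> \<beta> \<longrightarrow> cpair (?z n) ((1 / (u \<bullet> \<alpha>)) *\<^sub>R \<alpha> - (1 / (u \<bullet> \<beta>)) *\<^sub>R \<beta>) \<noteq> 0"
          proof (intro ballI impI)
            fix \<alpha> \<beta> assume ab: "\<alpha> \<in> P" "\<beta> \<in> P" "\<alpha> \<noteq> \<beta>"
            have "(1 / (u \<bullet> \<alpha>)) *\<^sub>R \<alpha> - (1 / (u \<bullet> \<beta>)) *\<^sub>R \<beta> \<in> T"
              unfolding T_def by (rule image_eqI[of _ _ "(\<alpha>, \<beta>)"]) (use ab in auto)
            then show "cpair (?z n) ((1 / (u \<bullet> \<alpha>)) *\<^sub>R \<alpha> - (1 / (u \<bullet> \<beta>)) *\<^sub>R \<beta>) \<noteq> 0"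
              by (rule bspec[OF elim(2)])
          qed
        qed (use elim in blast)
      qed
      show ?thesis
        by (rule tendsto_le[OF _ _ _ ev])
          (intro sequentially_bot tendsto_intros tendsto_root_prod tendsto_exp_sum tendsto_decay_sum tendsto_alt_sum zX)+
    qed
    then show ?thesis unfolding P_def by (intro exI[of _ C] conjI allI C)
  qed
qed

section \<open>Functions holomorphic along complex lines\<close>

text \<open>A complex normed space, with the scalar multiplication as a parameter since the type carries only a
  real structure.\<close>

locale complex_scaling =
  fixes sc :: "complex \<Rightarrow> 'v::real_normed_vector \<Rightarrow> 'v"
  assumes sc_add_left: "sc (s + t) x = sc s x + sc t x"
    and sc_add_right: "sc t (x + y) = sc t x + sc t y"
    and sc_sc: "sc s (sc t x) = sc (s * t) x"
    and sc_real: "sc (of_real r) x = r *\<^sub>R x"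
    and norm_sc: "norm (sc t x) = cmod t * norm x"
begin

lemma sc_0 [simp]: "sc 0 x = 0" using sc_real[of 0 x] by simp
lemma sc_1 [simp]: "sc 1 x = x" using sc_real[of 1 x] by simp
lemma sc_zero [simp]: "sc t 0 = 0" using norm_sc[of t 0] by simp
text \<open>Together with continuity this is holomorphy in several variables.\<close>

definition line_holomorphic :: "('v \<Rightarrow> complex) \<Rightarrow> 'v set \<Rightarrow> bool" where
  "line_holomorphic f U \<longleftrightarrow> (\<forall>x \<xi>. (\<lambda>t. f (x + sc t \<xi>)) holomorphic_on {t. x + sc t \<xi> \<in> U})"

lemma bounded_linear_sc: "bounded_linear (\<lambda>t. sc t \<xi>)"
proof (rule bounded_linear_intro[where K = "norm \<xi>"])
  show "sc (r *\<^sub>R t) \<xi> = r *\<^sub>R sc t \<xi>" for r t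
    by (simp add: scaleR_conv_of_real flip: sc_sc) (simp add: sc_real)
qed (auto simp: sc_add_left norm_sc)

lemma continuous_line: "continuous_on S (\<lambda>t. x + sc t \<xi>)"
  by (intro continuous_intros bounded_linear.continuous_on[OF bounded_linear_sc])

lemma open_line: "open U \<Longrightarrow> open {t. x + sc t \<xi> \<in> U}"
  using open_vimage[OF _ continuous_line[of UNIV x \<xi>], of U] by (simp add: vimage_def)

lemma line_holomorphicD:
  assumes "line_holomorphic f U" "\<And>t. t \<in> S \<Longrightarrow> x + sc t \<xi> \<in> U"
  shows "(\<lambda>t. f (x + sc t \<xi>)) holomorphic_on S"
  using assms unfolding line_holomorphic_def by (blast intro: holomorphic_on_subset)

lemma line_holomorphicI:
  assumes "\<And>x \<xi>. x \<in> U \<Longrightarrow> (\<lambda>t. f (x + sc t \<xi>)) field_differentiable (at 0)" and "open U"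
  shows "line_holomorphic f U"
  unfolding line_holomorphic_def holomorphic_on_def
proof (intro allI ballI)
  fix x \<xi> t assume t: "t \<in> {t. x + sc t \<xi> \<in> U}"
  have "(\<lambda>s. f ((x + sc t \<xi>) + sc s \<xi>)) field_differentiable (at (t - t))"
    using assms(1)[of "x + sc t \<xi>" \<xi>] t by simp
  then have "(\<lambda>s. f ((x + sc t \<xi>) + sc s \<xi>)) \<circ> (\<lambda>s. s - t) field_differentiable (at t)"
    by (intro field_differentiable_compose derivative_intros) (auto intro!: derivative_intros)
  then have "(\<lambda>s. f (x + sc s \<xi>)) field_differentiable (at t)"
    by (simp add: o_def add.assoc flip: sc_add_left)
  then show "(\<lambda>s. f (x + sc s \<xi>)) field_differentiable (at t within {t. x + sc t \<xi> \<in> U})"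
    by (rule field_differentiable_at_within)
qed

text \<open>On a complex line through a regular point only finitely many points are singular, so \<open>f\<close> extends along
  the line. Cauchy's inequality there makes \<open>f\<close> locally Lipschitz on the regular set, with constants that do
  not depend on the distance to the hyperplanes. Hence \<open>f\<close> has a continuous extension. Along a line inside
  a hyperplane this extension is the uniform limit of its values on parallel lines through regular
  points, and so it is holomorphic.\<close>

lemma Riemann_extension:
  fixes L :: "('v \<Rightarrow> complex) set" and f :: "'v \<Rightarrow> complex"
  assumes L: "finite L" "\<And>l x y. l \<in> L \<Longrightarrow> l (x + y) = l x + l y" "\<And>l t x. l \<in> L \<Longrightarrow> l (sc t x) = t * l x"
      "\<And>l. l \<in> L \<Longrightarrow> continuous_on UNIV l" "\<And>l. l \<in> L \<Longrightarrow> l d \<noteq> 0"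
  defines "reg \<equiv> {x. \<forall>l\<in>L. l x \<noteq> 0}"
  assumes f: "line_holomorphic f reg"
    and bd: "\<And>x. \<exists>r>0. \<exists>M. \<forall>y\<in>ball x r \<inter> reg. cmod (f y) \<le> M"
  obtains g where "continuous_on UNIV g" "line_holomorphic g UNIV" "\<And>x. x \<in> reg \<Longrightarrow> g x = f x"
proof -
  have oreg: "open reg"
  proof -
    have "reg = (\<Inter>l\<in>L. l -` (- {0}))" by (auto simp: reg_def)
    moreover have "open (l -` (- {0}))" if "l \<in> L" for l
      using L(4)[OF that] by (intro open_vimage) auto
    ultimately show ?thesis using L(1) by auto
  qed
  have pert: "\<forall>\<^sub>F n in sequentially. x + inverse (real (Suc n)) *\<^sub>R d \<in> reg" for x
  proof -
    have "\<forall>\<^sub>F n in sequentially. \<forall>l\<in>L. l (x + inverse (real (Suc n)) *\<^sub>R d) \<noteq> 0"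
      unfolding eventually_ball_finite_distrib[OF L(1)]
    proof
      fix l assume l: "l \<in> L"
      have eq: "l (x + inverse (real (Suc n)) *\<^sub>R d) = l x + of_real (inverse (real (Suc n))) * l d" for n
        by (simp only: L(2)[OF l] L(3)[OF l] flip: sc_real)
      show "\<forall>\<^sub>F n in sequentially. l (x + inverse (real (Suc n)) *\<^sub>R d) \<noteq> 0"
        unfolding eq by (rule eventually_affine_nonzero[OF L(5)[OF l]])
    qed
    then show ?thesis by (simp add: reg_def)
  qed
  note pert_lim = tendsto_perturb[of _ d]
  have finite_bad: "finite {t. x + sc t \<xi> \<notin> reg}" if "x \<in> reg" for x \<xi>
  proof (rule finite_subset)
    show "{t. x + sc t \<xi> \<notin> reg} \<subseteq> (\<lambda>l. - l x / l \<xi>) ` L"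
    proof
      fix t assume "t \<in> {t. x + sc t \<xi> \<notin> reg}"
      then obtain l where l: "l \<in> L" "l x + t * l \<xi> = 0" by (auto simp: reg_def L)
      have "l x \<noteq> 0" using that l(1) by (auto simp: reg_def)
      then have "l \<xi> \<noteq> 0" using l(2) by auto
      then have "t = - l x / l \<xi>" using l(2) by (simp add: field_simps add_eq_0_iff)
      then show "t \<in> (\<lambda>l. - l x / l \<xi>) ` L" using l(1) by blast
    qed
  qed (use L(1) in simp)
  have lip: "\<exists>r>0. \<exists>C. \<forall>y\<in>ball x r \<inter> reg. \<forall>y'\<in>ball x r \<inter> reg. cmod (f y - f y') \<le> C * dist y y'" for x
  proof -
    obtain r M where r: "r > 0" "\<And>y. y \<in> ball x r \<inter> reg \<Longrightarrow> cmod (f y) \<le> M" using bd[of x] by blast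
    have "cmod (f y - f y') \<le> (M / (r / 3)) * dist y y'"
      if y: "y \<in> ball x (r / 6) \<inter> reg" "y' \<in> ball x (r / 6) \<inter> reg" for y y'
    proof (cases "y = y'")
      case False
      define n where "n = norm (y' - y)"
      have n: "n > 0" "n < r / 3"
      proof -
        have "dist y y' < r / 6 + r / 6" using y by (metis IntE dist_commute dist_triangle_lt mem_ball dist_triangle_less_add)
        then show "n < r / 3" by (simp add: n_def dist_norm norm_minus_commute)
      qed (use False in \<open>simp add: n_def\<close>)
      define \<xi> where "\<xi> = (1 / n) *\<^sub>R (y' - y)"
      have n\<xi>: "norm \<xi> = 1" using n by (simp add: \<xi>_def flip: n_def)
      let ?K = "{t. y + sc t \<xi> \<notin> reg}"
      have inb: "y + sc t \<xi> \<in> ball x r" if "t \<in> ball 0 (2 * (r / 3))" for t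
      proof -
        have "dist x (y + sc t \<xi>) \<le> dist x y + dist y (y + sc t \<xi>)" by (rule dist_triangle)
        also have "dist y (y + sc t \<xi>) = cmod t" by (simp add: dist_norm norm_sc n\<xi>)
        finally show ?thesis using y that r(1) by auto
      qed
      obtain g where g: "g holomorphic_on ball 0 (2 * (r / 3))"
        "\<And>t. t \<in> ball 0 (2 * (r / 3)) - ?K \<Longrightarrow> g t = f (y + sc t \<xi>)"
      proof -
        have "(\<lambda>t. f (y + sc t \<xi>)) holomorphic_on ball 0 (2 * (r / 3)) - ?K"
          by (rule line_holomorphicD[OF f]) auto
        moreover have "cmod (f (y + sc t \<xi>)) \<le> M" if "t \<in> ball 0 (2 * (r / 3)) - ?K" for t
          using inb[of t] that by (intro r(2)) auto
        ultimately show ?thesis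
          using bounded_holomorphic_extend[OF finite_bad[of y \<xi>], of "ball 0 (2 * (r / 3))"] y that by blast
      qed
      have gM: "cmod (g t) \<le> M" if t: "t \<in> ball 0 (2 * (r / 3))" for t
      proof -
        have c: "(g \<longlongrightarrow> g t) (at t)"
          using holomorphic_on_imp_continuous_on[OF g(1)] t
          by (metis continuous_on_eq_continuous_at isContD open_ball)
        have "open (ball 0 (2 * (r / 3)) - (?K - {t}))"
          using finite_bad[of y \<xi>] y by (intro open_Diff finite_imp_closed) auto
        then have "\<forall>\<^sub>F s in at t. s \<in> ball 0 (2 * (r / 3)) - (?K - {t}) - {t}"
          using t by (intro eventually_at_in_open) auto
        then have "\<forall>\<^sub>F s in at t. norm (g s) \<le> M"
        proof eventually_elim
          case (elim s)
          then show ?case using inb[of s] g(2)[of s] r(2)[of "y + sc s \<xi>"] by auto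
        qed
        then show ?thesis using tendsto_norm[OF c] tendsto_upperbound by (metis at_neq_bot)
      qed
      have "cmod (g (of_real n) - g 0) \<le> M / (r / 3) * cmod (of_real n)"
        using n by (intro bounded_holomorphic_increment[OF g(1) gM]) auto
      moreover have "g 0 = f y" using g(2)[of 0] y r(1) by auto
      moreover have "y + sc (of_real n) \<xi> = y'" using n by (simp add: sc_real \<xi>_def)
      then have "g (of_real n) = f y'" using g(2)[of "of_real n"] y n r(1) by auto
      ultimately show ?thesis using n by (simp add: n_def dist_norm norm_minus_commute)
    qed simp
    then show ?thesis using r(1) by (intro exI[of _ "r / 6"] conjI exI[of _ "M / (r / 3)"]) auto
  qed
  have lim_ex: "\<exists>c. (\<lambda>n. f (x + inverse (real (Suc n)) *\<^sub>R d)) \<longlonglongrightarrow> c" for x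
  proof -
    obtain r C where r: "r > 0" "\<And>y y'. y \<in> ball x r \<inter> reg \<Longrightarrow> y' \<in> ball x r \<inter> reg \<Longrightarrow> cmod (f y - f y') \<le> C * dist y y'"
      using lip[of x] by blast
    have uc: "uniformly_continuous_on (ball x r \<inter> reg) f"
    proof (rule lipschitz_on_uniformly_continuous[of "\<bar>C\<bar>"], rule lipschitz_onI)
      fix y y' assume "y \<in> ball x r \<inter> reg" "y' \<in> ball x r \<inter> reg"
      then have "dist (f y) (f y') \<le> C * dist y y'" using r(2) by (simp add: dist_norm)
      also have "\<dots> \<le> \<bar>C\<bar> * dist y y'" by (intro mult_right_mono) auto
      finally show "dist (f y) (f y') \<le> \<bar>C\<bar> * dist y y'" .
    qed simp
    have ev: "\<forall>\<^sub>F n in sequentially. x + inverse (real (Suc n)) *\<^sub>R d \<in> ball x r \<inter> reg"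
      using pert[of x] topological_tendstoD[OF pert_lim[of x] open_ball, of x r] r(1)
      by (auto elim: eventually_elim2)
    then obtain N where N: "\<And>n. n \<ge> N \<Longrightarrow> x + inverse (real (Suc n)) *\<^sub>R d \<in> ball x r \<inter> reg"
      by (auto simp: eventually_sequentially)
    have "Cauchy (\<lambda>n. f (x + inverse (real (Suc (n + N))) *\<^sub>R d))"
    proof (rule uniformly_continuous_on_Cauchy[OF uc])
      show "Cauchy (\<lambda>n. x + inverse (real (Suc (n + N))) *\<^sub>R d)"
        using LIMSEQ_ignore_initial_segment[OF pert_lim[of x], of N] by (rule LIMSEQ_imp_Cauchy)
      show "x + inverse (real (Suc (n + N))) *\<^sub>R d \<in> ball x r \<inter> reg" for n by (rule N) simp
    qed
    then obtain c where "(\<lambda>n. f (x + inverse (real (Suc (n + N))) *\<^sub>R d)) \<longlonglongrightarrow> c"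
      using convergent_eq_Cauchy by blast
    then show ?thesis
      by (intro exI[of _ c] LIMSEQ_offset[of "\<lambda>n. f (x + inverse (real (Suc n)) *\<^sub>R d)" N c])
  qed
  \<comment> \<open>The vector \<open>d\<close> is regular, so all but finitely many of these points are regular.\<close>
  define g where "g x = lim (\<lambda>n. f (x + inverse (real (Suc n)) *\<^sub>R d))" for x
  have g_lim: "(\<lambda>n. f (x + inverse (real (Suc n)) *\<^sub>R d)) \<longlonglongrightarrow> g x" for x
    using lim_ex[of x] unfolding g_def by (simp add: convergent_LIMSEQ_iff[symmetric] convergent_def)
  have glip: "\<exists>r>0. \<exists>C. C \<ge> 0 \<and> (\<forall>y\<in>ball x r. \<forall>y'\<in>ball x r. cmod (g y - g y') \<le> C * dist y y')" for x
  proof -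
    obtain r C where r: "r > 0" "\<And>y y'. y \<in> ball x r \<inter> reg \<Longrightarrow> y' \<in> ball x r \<inter> reg \<Longrightarrow> cmod (f y - f y') \<le> C * dist y y'"
      using lip[of x] by blast
    have "cmod (g y - g y') \<le> \<bar>C\<bar> * dist y y'" if y: "y \<in> ball x r" "y' \<in> ball x r" for y y'
    proof -
      let ?y = "\<lambda>n. y + inverse (real (Suc n)) *\<^sub>R d" and ?y' = "\<lambda>n. y' + inverse (real (Suc n)) *\<^sub>R d"
      have ev: "\<forall>\<^sub>F n in sequentially. cmod (f (?y n) - f (?y' n)) \<le> \<bar>C\<bar> * dist (?y n) (?y' n)"
        using pert[of y] pert[of y'] topological_tendstoD[OF pert_lim[of y] open_ball y(1)]
          topological_tendstoD[OF pert_lim[of y'] open_ball y(2)]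
      proof eventually_elim
        case (elim n)
        then have "cmod (f (?y n) - f (?y' n)) \<le> C * dist (?y n) (?y' n)" by (intro r(2)) auto
        also have "\<dots> \<le> \<bar>C\<bar> * dist (?y n) (?y' n)" by (intro mult_right_mono) auto
        finally show ?case .
      qed
      show ?thesis
        by (rule tendsto_le[OF sequentially_bot _ _ ev]) (intro tendsto_intros pert_lim g_lim)+
    qed
    then show ?thesis using r(1) by (intro exI[of _ r] conjI exI[of _ "\<bar>C\<bar>"]) auto
  qed
  have gcont: "continuous_on UNIV g"
  proof (rule continuous_at_imp_continuous_on, rule ballI)
    fix x
    obtain r C where r: "r > 0" "C \<ge> 0" "\<forall>y\<in>ball x r. \<forall>y'\<in>ball x r. cmod (g y - g y') \<le> C * dist y y'"
      using glip[of x] by blast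
    have "continuous_on (ball x r) g"
      by (rule lipschitz_on_continuous_on[of C], rule lipschitz_onI) (use r in \<open>auto simp: dist_norm\<close>)
    then show "isCont g x" using r(1) by (simp add: continuous_on_eq_continuous_at)
  qed
  have gf: "g x = f x" if x: "x \<in> reg" for x
  proof -
    obtain r C where r: "r > 0" "\<And>y y'. y \<in> ball x r \<inter> reg \<Longrightarrow> y' \<in> ball x r \<inter> reg \<Longrightarrow> cmod (f y - f y') \<le> C * dist y y'"
      using lip[of x] by blast
    let ?x = "\<lambda>n. x + inverse (real (Suc n)) *\<^sub>R d"
    have xb: "x \<in> ball x r" using r(1) by simp
    have ev: "\<forall>\<^sub>F n in sequentially. norm (f (?x n) - f x) \<le> C * dist (?x n) x"
      using pert[of x] topological_tendstoD[OF pert_lim[of x] open_ball xb]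
      by eventually_elim (use r x xb in auto)
    have "(\<lambda>n. C * dist (?x n) x) \<longlonglongrightarrow> C * dist x x" by (intro tendsto_intros pert_lim)
    then have "(\<lambda>n. f (?x n) - f x) \<longlonglongrightarrow> 0" using ev by (intro Lim_null_comparison[OF ev]) simp
    then have "(\<lambda>n. f (?x n)) \<longlonglongrightarrow> f x" by (rule LIM_zero_cancel)
    then show ?thesis using g_lim[of x] LIMSEQ_unique by blast
  qed
  have "line_holomorphic g UNIV"
  proof (rule line_holomorphicI)
    fix x \<xi> :: 'v
    obtain r C where r: "r > 0" "C \<ge> 0" "\<And>y y'. y \<in> ball x r \<Longrightarrow> y' \<in> ball x r \<Longrightarrow> cmod (g y - g y') \<le> C * dist y y'"
      using glip[of x] by blast
    define k where "k = norm \<xi> + 1"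
    define e where "e = r / (2 * k)"
    have np: "k > 0" "norm \<xi> < k" by (simp_all add: k_def add_nonneg_pos)
    have "e * norm \<xi> = (r / 2) * (norm \<xi> / k)" by (simp add: e_def)
    also have "\<dots> < (r / 2) * 1" using r(1) np by (intro mult_strict_left_mono) (auto simp: divide_less_eq)
    finally have e: "e > 0" "e * norm \<xi> < r / 2" using r(1) np by (auto simp: e_def)
    let ?x = "\<lambda>n. x + inverse (real (Suc n)) *\<^sub>R d"
    have xb: "x \<in> ball x (r / 2)" using r(1) by simp
    have near: "\<forall>\<^sub>F n in sequentially. ?x n \<in> ball x (r / 2) \<and> ?x n \<in> reg"
      using pert[of x] topological_tendstoD[OF pert_lim[of x] open_ball xb] by eventually_elim auto
    have inb: "y + sc t \<xi> \<in> ball x r" if "y \<in> ball x (r / 2)" "t \<in> cball 0 e" for y t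
    proof -
      have "dist x (y + sc t \<xi>) \<le> dist x y + dist y (y + sc t \<xi>)" by (rule dist_triangle)
      also have "dist y (y + sc t \<xi>) = cmod t * norm \<xi>" by (simp add: dist_norm norm_sc)
      also have "\<dots> \<le> e * norm \<xi>" using that by (intro mult_right_mono) auto
      finally show ?thesis using e that by auto
    qed
    have gc: "continuous_on S (\<lambda>t. g (y + sc t \<xi>))" for S y
      by (rule continuous_on_compose2[OF gcont continuous_line]) auto
    have cont: "\<forall>\<^sub>F n in sequentially. continuous_on (cball 0 e) (\<lambda>t. g (?x n + sc t \<xi>)) \<and>
        (\<lambda>t. g (?x n + sc t \<xi>)) holomorphic_on ball 0 e"
      using near
    proof eventually_elim
      case (elim n)
      let ?K = "{t. ?x n + sc t \<xi> \<notin> reg}"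
      have "(\<lambda>t. f (?x n + sc t \<xi>)) holomorphic_on ball 0 e - ?K"
        by (rule line_holomorphicD[OF f]) auto
      then have "(\<lambda>t. g (?x n + sc t \<xi>)) holomorphic_on ball 0 e - ?K"
        by (rule holomorphic_transform) (auto simp: gf)
      then show ?case
        using no_isolated_singularity[OF gc _ open_ball finite_bad] elim gc by blast
    qed
    have ul: "uniform_limit (cball 0 e) (\<lambda>n t. g (?x n + sc t \<xi>)) (\<lambda>t. g (x + sc t \<xi>)) sequentially"
    proof (rule uniform_limitI)
      fix \<epsilon> :: real assume \<epsilon>: "\<epsilon> > 0"
      have "(\<lambda>n. C * dist (?x n) x) \<longlonglongrightarrow> C * dist x x" by (intro tendsto_intros pert_lim)
      then have "\<forall>\<^sub>F n in sequentially. C * dist (?x n) x < \<epsilon>" using \<epsilon> by (auto intro: order_tendstoD)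
      then show "\<forall>\<^sub>F n in sequentially. \<forall>t\<in>cball 0 e. dist (g (?x n + sc t \<xi>)) (g (x + sc t \<xi>)) < \<epsilon>"
        using near
      proof eventually_elim
        case (elim n)
        show ?case
        proof
          fix t :: complex assume t: "t \<in> cball 0 e"
          have "dist (g (?x n + sc t \<xi>)) (g (x + sc t \<xi>)) \<le> C * dist (?x n + sc t \<xi>) (x + sc t \<xi>)"
            unfolding dist_norm[of "g _"] by (intro r(3) inb t) (use elim xb in auto)
          also have "dist (?x n + sc t \<xi>) (x + sc t \<xi>) = dist (?x n) x" by (simp add: dist_norm)
          finally show "dist (g (?x n + sc t \<xi>)) (g (x + sc t \<xi>)) < \<epsilon>" using elim by simp
        qed
      qed
    qed
    obtain "(\<lambda>t. g (x + sc t \<xi>)) holomorphic_on ball 0 e"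
      using holomorphic_uniform_limit[OF cont ul] by auto
    then show "(\<lambda>t. g (x + sc t \<xi>)) field_differentiable (at 0)"
      using e(1) by (simp add: holomorphic_on_imp_differentiable_at)
  qed simp
  then show ?thesis using that gcont gf by blast
qed

definition cderiv :: "'v \<Rightarrow> ('v \<Rightarrow> complex) \<Rightarrow> 'v \<Rightarrow> complex" where
  "cderiv \<xi> f x = deriv (\<lambda>t. f (x + sc t \<xi>)) 0"

lemma cderiv_works:
  assumes "line_holomorphic f U" "open U" "x \<in> U"
  shows "((\<lambda>t. f (x + sc t \<xi>)) has_field_derivative cderiv \<xi> f x) (at 0)"
  unfolding cderiv_def
  by (rule holomorphic_derivI[OF line_holomorphicD[OF assms(1)] open_line[OF assms(2)]]) (use assms(3) in auto)

lemma cderiv_bound: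
  assumes f: "line_holomorphic f U" "open U" and r: "r > 0"
    and B: "\<And>t. cmod t \<le> r \<Longrightarrow> x + sc t \<xi> \<in> U \<and> cmod (f (x + sc t \<xi>)) \<le> M"
  shows "cmod (cderiv \<xi> f x) \<le> M / r"
proof -
  have h: "(\<lambda>t. f (x + sc t \<xi>)) holomorphic_on cball 0 r"
    by (rule line_holomorphicD[OF f(1)]) (use B in auto)
  have "cmod ((deriv ^^ 1) (\<lambda>t. f (x + sc t \<xi>)) 0) \<le> fact 1 * M / r ^ 1"
  proof (rule Cauchy_inequality)
    show "(\<lambda>t. f (x + sc t \<xi>)) holomorphic_on ball 0 r"
      using h ball_subset_cball holomorphic_on_subset by blast
  qed (use r B h holomorphic_on_imp_continuous_on in auto)
  then show ?thesis by (simp add: cderiv_def)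
qed

lemma cderiv_quotient:
  assumes f: "line_holomorphic f U" and r: "r > 0"
    and B: "\<And>t. cmod t < 4 * r \<Longrightarrow> x + sc t \<xi> \<in> U \<and> cmod (f (x + sc t \<xi>)) \<le> M"
    and h: "0 < h" "h < r"
  shows "cmod ((f (x + h *\<^sub>R \<xi>) - f x) / of_real h - cderiv \<xi> f x) \<le> M / r\<^sup>2 * h"
proof -
  have "(\<lambda>t. f (x + sc t \<xi>)) holomorphic_on ball 0 (4 * r)"
    by (rule line_holomorphicD[OF f]) (use B in auto)
  from holomorphic_difference_quotient[OF this, of M "of_real h"] B h
  show ?thesis by (simp add: cderiv_def sc_real)
qed

text \<open>The difference quotients with increments \<open>1 / (n + 1)\<close> are continuous and holomorphic along lines, and by
  the second order estimate they converge locally uniformly to the derivative.\<close>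

lemma cderiv_line_holomorphic:
  assumes f: "line_holomorphic f U" "continuous_on U f" and U: "open U"
  shows "line_holomorphic (cderiv \<xi> f) U \<and> continuous_on U (cderiv \<xi> f)"
proof -
  define q where "q n x = (f (x + inverse (real (Suc n)) *\<^sub>R \<xi>) - f x) / of_real (inverse (real (Suc n)))" for n x
  have key: "\<exists>e>0. ball x e \<subseteq> U \<and> uniform_limit (ball x e) q (cderiv \<xi> f) sequentially \<and>
      (\<forall>\<^sub>F n in sequentially. continuous_on (ball x e) (q n) \<and> (\<forall>y\<in>ball x e. y + inverse (real (Suc n)) *\<^sub>R \<xi> \<in> U))"
    if x: "x \<in> U" for x
  proof -
    have "isCont f x" using f(2) U x by (simp add: continuous_on_eq_continuous_at)
    then have "\<forall>\<^sub>F y in at x. dist (f y) (f x) < 1" using tendstoD isContD by (metis zero_less_one)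
    then obtain e1 where e1: "e1 > 0" "\<And>y. y \<noteq> x \<Longrightarrow> dist y x < e1 \<Longrightarrow> dist (f y) (f x) < 1"
      by (auto simp: eventually_at)
    obtain e2 where e2: "e2 > 0" "ball x e2 \<subseteq> U" using U x open_contains_ball by blast
    define e where "e = min e1 e2 / 2"
    have e: "e > 0" "e \<le> e1 / 2" "e \<le> e2 / 2" using e1 e2 by (auto simp: e_def)
    define M where "M = cmod (f x) + 1"
    have M: "y \<in> U \<and> cmod (f y) \<le> M" if "y \<in> ball x (2 * e)" for y
    proof
      show "y \<in> U" using that e e2 by auto
      show "cmod (f y) \<le> M"
      proof (cases "y = x")
        case False
        then have "dist (f y) (f x) < 1" using e1(2)[of y] that e by (auto simp: dist_commute)
        then show ?thesis unfolding M_def dist_norm using norm_triangle_ineq2[of "f y" "f x"] by linarith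
      qed (simp add: M_def)
    qed
    define k where "k = norm \<xi> + 1"
    define r where "r = e / (4 * k)"
    have np: "k > 0" "norm \<xi> \<le> k" by (simp_all add: k_def add_nonneg_pos)
    have "4 * r * norm \<xi> = e * (norm \<xi> / k)" by (simp add: r_def)
    also have "\<dots> \<le> e * 1" using e(1) np by (intro mult_left_mono) (auto simp: divide_le_eq)
    finally have r: "r > 0" "4 * r * norm \<xi> \<le> e" using e(1) np by (auto simp: r_def)
    have seg: "y + sc t \<xi> \<in> ball x (2 * e)" if "y \<in> ball x e" "cmod t < 4 * r" for y t
    proof -
      have "dist x (y + sc t \<xi>) \<le> dist x y + dist y (y + sc t \<xi>)" by (rule dist_triangle)
      also have "dist y (y + sc t \<xi>) = cmod t * norm \<xi>" by (simp add: dist_norm norm_sc)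
      also have "\<dots> \<le> 4 * r * norm \<xi>" using that by (intro mult_right_mono) auto
      finally show ?thesis using r that by auto
    qed
    have h0: "(\<lambda>n. inverse (real (Suc n))) \<longlonglongrightarrow> 0" by (rule LIMSEQ_inverse_real_of_nat)
    then have hr: "\<forall>\<^sub>F n in sequentially. inverse (real (Suc n)) < r" using r by (auto intro: order_tendstoD)
    have ul: "uniform_limit (ball x e) q (cderiv \<xi> f) sequentially"
    proof (rule uniform_limitI)
      fix \<epsilon> :: real assume "\<epsilon> > 0"
      have "(\<lambda>n. M / r\<^sup>2 * inverse (real (Suc n))) \<longlonglongrightarrow> M / r\<^sup>2 * 0" by (intro tendsto_intros h0)
      then have "\<forall>\<^sub>F n in sequentially. M / r\<^sup>2 * inverse (real (Suc n)) < \<epsilon>"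
        using \<open>\<epsilon> > 0\<close> by (auto intro: order_tendstoD)
      then show "\<forall>\<^sub>F n in sequentially. \<forall>y\<in>ball x e. dist (q n y) (cderiv \<xi> f y) < \<epsilon>"
        using hr
      proof eventually_elim
        case (elim n)
        show ?case
        proof
          fix y assume y: "y \<in> ball x e"
          have "cmod ((f (y + inverse (real (Suc n)) *\<^sub>R \<xi>) - f y) / of_real (inverse (real (Suc n))) - cderiv \<xi> f y)
              \<le> M / r\<^sup>2 * inverse (real (Suc n))"
            by (rule cderiv_quotient[OF f(1) r(1) M[OF seg[OF y]]]) (use elim in simp_all)
          then show "dist (q n y) (cderiv \<xi> f y) < \<epsilon>" using elim(1) by (simp add: q_def dist_norm)
        qed
      qed
    qed
    have "\<forall>\<^sub>F n in sequentially. continuous_on (ball x e) (q n) \<and> (\<forall>y\<in>ball x e. y + inverse (real (Suc n)) *\<^sub>R \<xi> \<in> U)"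
      using hr
    proof eventually_elim
      case (elim n)
      have inU: "y + inverse (real (Suc n)) *\<^sub>R \<xi> \<in> U" if y: "y \<in> ball x e" for y
      proof -
        have "cmod (of_real (inverse (real (Suc n)))) = inverse (real (Suc n))"
          by (subst norm_of_real) (simp del: of_nat_Suc)
        then have "cmod (of_real (inverse (real (Suc n)))) < 4 * r" using elim r(1) by linarith
        from M[OF seg[OF y this]] show ?thesis by (simp only: sc_real)
      qed
      have "continuous_on (ball x e) (\<lambda>y. f (y + inverse (real (Suc n)) *\<^sub>R \<xi>))"
        by (rule continuous_on_compose2[OF f(2)]) (use inU in \<open>auto intro!: continuous_intros\<close>)
      moreover have "continuous_on (ball x e) f"
        by (rule continuous_on_subset[OF f(2)]) (use e(3) e(1) e2(2) in auto)
      ultimately have "continuous_on (ball x e) (q n)" unfolding q_def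
        by (intro continuous_intros) (simp_all del: of_nat_Suc)
      then show ?case using inU by blast
    qed
    moreover have "ball x e \<subseteq> U" using e e2 by auto
    ultimately show ?thesis using e(1) ul by blast
  qed
  have "continuous_on U (cderiv \<xi> f)"
  proof (rule continuous_at_imp_continuous_on, rule ballI)
    fix x assume "x \<in> U"
    then obtain e where e: "e > 0" "uniform_limit (ball x e) q (cderiv \<xi> f) sequentially"
      and ev: "\<forall>\<^sub>F n in sequentially. continuous_on (ball x e) (q n) \<and> (\<forall>y\<in>ball x e. y + inverse (real (Suc n)) *\<^sub>R \<xi> \<in> U)"
      using key[of x] by blast
    have "\<forall>\<^sub>F n in sequentially. continuous_on (ball x e) (q n)" using ev by (rule eventually_mono) (rule conjunct1)
    note e = e this
    have "continuous_on (ball x e) (cderiv \<xi> f)" using uniform_limit_theorem[OF e(3,2)] by simp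
    then show "isCont (cderiv \<xi> f) x" using e(1) by (simp add: continuous_on_eq_continuous_at)
  qed
  moreover have "line_holomorphic (cderiv \<xi> f) U"
  proof (rule line_holomorphicI[OF _ U])
    fix x \<eta> :: 'v assume "x \<in> U"
    then obtain e where e: "e > 0" "ball x e \<subseteq> U" "uniform_limit (ball x e) q (cderiv \<xi> f) sequentially"
      and ev: "\<forall>\<^sub>F n in sequentially. continuous_on (ball x e) (q n) \<and> (\<forall>y\<in>ball x e. y + inverse (real (Suc n)) *\<^sub>R \<xi> \<in> U)"
      using key[of x] by blast
    define k where "k = norm \<eta> + 1"
    define d where "d = e / k"
    have np: "k > 0" "norm \<eta> < k" by (simp_all add: k_def add_nonneg_pos)
    have "d * norm \<eta> = e * (norm \<eta> / k)" by (simp add: d_def)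
    also have "\<dots> < e * 1" using e(1) np by (intro mult_strict_left_mono) (auto simp: divide_less_eq)
    finally have d: "d > 0" "d * norm \<eta> < e" using e(1) np by (auto simp: d_def)
    have inb: "x + sc t \<eta> \<in> ball x e" if "t \<in> cball 0 d" for t :: complex
    proof -
      have "dist x (x + sc t \<eta>) = cmod t * norm \<eta>" by (simp add: dist_norm norm_sc)
      also have "\<dots> \<le> d * norm \<eta>" using that by (intro mult_right_mono) auto
      finally show ?thesis using d by simp
    qed
    have "\<forall>\<^sub>F n in sequentially. continuous_on (cball 0 d) (\<lambda>t. q n (x + sc t \<eta>)) \<and> (\<lambda>t. q n (x + sc t \<eta>)) holomorphic_on ball 0 d"
      using ev
    proof eventually_elim
      case (elim n)
      have "(\<lambda>t. f ((x + inverse (real (Suc n)) *\<^sub>R \<xi>) + sc t \<eta>)) holomorphic_on ball 0 d"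
      proof (rule line_holomorphicD[OF f(1)])
        fix t :: complex assume "t \<in> ball 0 d"
        then have "x + sc t \<eta> + inverse (real (Suc n)) *\<^sub>R \<xi> \<in> U" using elim inb[of t] by auto
        then show "x + inverse (real (Suc n)) *\<^sub>R \<xi> + sc t \<eta> \<in> U" by (simp add: algebra_simps)
      qed
      moreover have "(\<lambda>t. f (x + sc t \<eta>)) holomorphic_on ball 0 d"
        by (rule line_holomorphicD[OF f(1)]) (use inb e(2) in auto)
      ultimately have "(\<lambda>t. (f ((x + inverse (real (Suc n)) *\<^sub>R \<xi>) + sc t \<eta>) - f (x + sc t \<eta>)) / of_real (inverse (real (Suc n)))) holomorphic_on ball 0 d"
        by (intro holomorphic_intros) auto
      then have "(\<lambda>t. q n (x + sc t \<eta>)) holomorphic_on ball 0 d"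
        by (simp add: q_def algebra_simps)
      moreover have "continuous_on (cball 0 d) (\<lambda>t. q n (x + sc t \<eta>))"
        by (rule continuous_on_compose2[OF conjunct1[OF elim] continuous_line]) (use inb in auto)
      ultimately show ?case by blast
    qed
    moreover have "uniform_limit (cball 0 d) (\<lambda>n t. q n (x + sc t \<eta>)) (\<lambda>t. cderiv \<xi> f (x + sc t \<eta>)) sequentially"
      using e(3) inb unfolding uniform_limit_iff by (auto elim!: eventually_mono)
    ultimately obtain "(\<lambda>t. cderiv \<xi> f (x + sc t \<eta>)) holomorphic_on ball 0 d"
      using holomorphic_uniform_limit[of 0 d "\<lambda>n t. q n (x + sc t \<eta>)" sequentially] by auto
    then show "(\<lambda>t. cderiv \<xi> f (x + sc t \<eta>)) field_differentiable (at 0)"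
      using d(1) by (simp add: holomorphic_on_imp_differentiable_at)
  qed
  ultimately show ?thesis by blast
qed

lemma foldr_cderiv_line_holomorphic:
  assumes "line_holomorphic f U" "continuous_on U f" "open U"
  shows "line_holomorphic (foldr cderiv \<xi>s f) U \<and> continuous_on U (foldr cderiv \<xi>s f)"
  by (induction \<xi>s) (use assms cderiv_line_holomorphic in auto)

text \<open>One Cauchy estimate with radius \<open>r\<close> for each derivative; the points reached stay within \<open>k r\<close> of \<open>x\<close>.\<close>

lemma foldr_cderiv_bound:
  assumes f: "line_holomorphic f U" "continuous_on U f" "open U" and r: "r > 0"
    and \<xi>: "\<forall>\<xi>\<in>set \<xi>s. norm \<xi> = 1"
    and B: "\<And>y. dist x y \<le> real (length \<xi>s) * r \<Longrightarrow> y \<in> U \<and> cmod (f y) \<le> M"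
  shows "cmod (foldr cderiv \<xi>s f x) \<le> M / r ^ length \<xi>s"
  using \<xi> B
proof (induction \<xi>s arbitrary: x)
  case Nil
  then show ?case by simp
next
  case (Cons \<xi> \<xi>s)
  have "cmod (cderiv \<xi> (foldr cderiv \<xi>s f) x) \<le> (M / r ^ length \<xi>s) / r"
  proof (rule cderiv_bound[OF _ f(3) r])
    show "line_holomorphic (foldr cderiv \<xi>s f) U" using foldr_cderiv_line_holomorphic[OF f] by blast
    fix t assume t: "cmod t \<le> r"
    have d: "dist x (x + sc t \<xi>) \<le> r" using t Cons.prems(1) by (simp add: dist_norm norm_sc)
    have near: "y \<in> U \<and> cmod (f y) \<le> M" if "dist (x + sc t \<xi>) y \<le> real (length \<xi>s) * r" for y
    proof (rule Cons.prems(2))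
      have "dist x y \<le> dist x (x + sc t \<xi>) + dist (x + sc t \<xi>) y" by (rule dist_triangle)
      then show "dist x y \<le> real (length (\<xi> # \<xi>s)) * r" using d that by (simp add: algebra_simps)
    qed
    have "x + sc t \<xi> \<in> U" using near[of "x + sc t \<xi>"] r by simp
    moreover have "cmod (foldr cderiv \<xi>s f (x + sc t \<xi>)) \<le> M / r ^ length \<xi>s"
      using Cons.IH[of "x + sc t \<xi>"] Cons.prems(1) near by simp
    ultimately show "x + sc t \<xi> \<in> U \<and> cmod (foldr cderiv \<xi>s f (x + sc t \<xi>)) \<le> M / r ^ length \<xi>s" by blast
  qed
  then show ?case by (simp add: mult.commute)
qed

end

section \<open>The Harish-Chandra quotient\<close>

lemma norm_csc: "norm (csc t z) = cmod t * norm z"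
proof -
  have "(norm (csc t z))\<^sup>2 = (norm (fst (csc t z)))\<^sup>2 + (norm (snd (csc t z)))\<^sup>2"
    by (simp add: norm_prod_def)
  also have "\<dots> = (cmod t)\<^sup>2 * ((norm (fst z))\<^sup>2 + (norm (snd z))\<^sup>2)"
    unfolding csc_def fst_conv snd_conv cmod_power2 power2_norm_eq_inner
    by (simp add: inner_diff_left inner_diff_right inner_add_left inner_add_right
        inner_commute power2_eq_square algebra_simps)
  also have "\<dots> = (cmod t * norm z)\<^sup>2" by (simp add: norm_prod_def power_mult_distrib)
  finally show ?thesis by (simp add: power2_eq_iff_nonneg)
qed

lemma csc_scaling: "complex_scaling csc"
proof
  show "norm (csc t x) = cmod t * norm x" for t x by (rule norm_csc)
qed (auto simp: csc_def algebra_simps intro!: prod_eqI)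

lemma csc2_scaling: "complex_scaling (\<lambda>t p. (csc t (fst p), csc t (snd p)))"
proof -
  interpret csp: complex_scaling csc by (rule csc_scaling)
  show ?thesis
  proof
    show "norm (csc t (fst x), csc t (snd x)) = cmod t * norm x" for t x
      by (cases x) (simp only: fst_conv snd_conv norm_Pair norm_csc power_mult_distrib
          distrib_left[symmetric] real_sqrt_mult, simp)
  qed (auto simp: csp.sc_add_left csp.sc_add_right csp.sc_sc csp.sc_real intro!: prod_eqI)
qed

interpretation csp: complex_scaling csc by (rule csc_scaling)
interpretation csp2: complex_scaling "\<lambda>t p. (csc t (fst p), csc t (snd p))" by (rule csc2_scaling)

definition cprod :: "(real^'r) set \<Rightarrow> 'r::finite spectral \<Rightarrow> complex" where
  "cprod P z = (\<Prod>\<alpha>\<in>P. cpair z \<alpha>)"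

lemma root_prod_cprod: "root_prod P z X = cmod (cprod P z * cprod P X)"
  by (simp add: root_prod_def cprod_def norm_mult prod_norm prod.distrib)

lemma cprod_csc: "cprod P (csc t z) = t ^ card P * cprod P z"
  by (simp add: cprod_def cpair_csc prod.distrib)

lemma cprod_nonzero: "finite P \<Longrightarrow> cprod P z \<noteq> 0 \<longleftrightarrow> (\<forall>\<alpha>\<in>P. cpair z \<alpha> \<noteq> 0)"
  by (simp add: cprod_def)

lemma tendsto_cprod: "(f \<longlongrightarrow> z) F \<Longrightarrow> ((\<lambda>x. cprod P (f x)) \<longlongrightarrow> cprod P z) F"
  unfolding cprod_def by (intro tendsto_intros)

lemma eventually_cprod_nonzero:
  assumes "finite P" "\<And>a. a \<in> P \<Longrightarrow> a \<bullet> d \<noteq> 0"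
  shows "\<forall>\<^sub>F n in sequentially. cprod P (z + inverse (real (Suc n)) *\<^sub>R (d, 0)) \<noteq> 0"
  unfolding cprod_nonzero[OF assms(1)] by (rule eventually_cpair_nonzero[OF assms])

lemma cpair_continuous: "continuous_on UNIV (\<lambda>p. cpair (fst p) \<alpha>)" "continuous_on UNIV (\<lambda>p. cpair (snd p) \<alpha>)"
  unfolding continuous_on_def
  by (intro ballI tendsto_cpair tendsto_fst tendsto_snd tendsto_ident_at)+

text \<open>The main estimate bounds the quotient of the alternating sum by the products of roots on the regular set
  by a continuous function, so the Riemann extension applies. Identity and bound pass to all points by
  density.\<close>

lemma Harish_Chandra_quotient:
  fixes \<Phi> :: "(real^'r) set"
  assumes \<Phi>: "root_set \<Phi>" and v: "\<And>\<alpha>. \<alpha> \<in> \<Phi> \<Longrightarrow> \<alpha> \<bullet> v \<noteq> 0"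
  defines "P \<equiv> pos_roots v \<Phi>"
  obtains F :: "'r spectral \<times> 'r spectral \<Rightarrow> complex" and C where
    "continuous_on UNIV F" "csp2.line_holomorphic F UNIV"
    "\<And>z X. alt_sum \<Phi> z X = cprod P z * cprod P X * F (z, X)"
    "C \<ge> 0" "\<And>z X. cmod (F (z, X)) \<le> C * exp_sum \<Phi> z X * decay_sum v \<Phi> z X"
proof -
  have finP: "finite P" and P\<Phi>: "P \<subseteq> \<Phi>" using \<Phi> by (auto simp: P_def pos_roots_def root_set_def)
  have Pv: "\<alpha> \<bullet> v \<noteq> 0" if "\<alpha> \<in> P" for \<alpha> using v P\<Phi> that by blast
  obtain C where C: "C \<ge> 0" "\<And>z X. cmod (alt_sum \<Phi> z X) \<le> C * root_prod P z X * exp_sum \<Phi> z X * decay_sum v \<Phi> z X"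
    using alt_sum_bound[OF \<Phi> v] unfolding P_def by blast
  define L where "L = (\<lambda>\<alpha> p. cpair (fst p) \<alpha>) ` P \<union> (\<lambda>\<alpha> (p :: 'r spectral \<times> 'r spectral). cpair (snd p) \<alpha>) ` P"
  define f where "f p = alt_sum \<Phi> (fst p) (snd p) / (cprod P (fst p) * cprod P (snd p))" for p
  have reg: "{x. \<forall>l\<in>L. l x \<noteq> 0} = {p. cprod P (fst p) \<noteq> 0 \<and> cprod P (snd p) \<noteq> 0}"
    by (auto simp: L_def cprod_nonzero[OF finP])
  have fbd: "cmod (f p) \<le> C * exp_sum \<Phi> (fst p) (snd p) * decay_sum v \<Phi> (fst p) (snd p)"
    if "cprod P (fst p) \<noteq> 0 \<and> cprod P (snd p) \<noteq> 0" for p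
  proof -
    have "cmod (f p) = cmod (alt_sum \<Phi> (fst p) (snd p)) / root_prod P (fst p) (snd p)"
      by (simp add: f_def norm_divide root_prod_cprod)
    moreover have "root_prod P (fst p) (snd p) > 0" using that by (simp add: root_prod_cprod)
    ultimately show ?thesis using C(2)[of "fst p" "snd p"]
      by (simp add: divide_le_eq mult.assoc mult.left_commute mult.commute)
  qed
  have fhol: "csp2.line_holomorphic f {x. \<forall>l\<in>L. l x \<noteq> 0}"
    unfolding reg csp2.line_holomorphic_def
  proof (intro allI)
    fix p \<xi> :: "'r spectral \<times> 'r spectral"
    have lin: "linear w" if "w \<in> reflection_group \<Phi>" for w using reflection_group_linear[OF that] .
    have "(\<lambda>t. f (p + (csc t (fst \<xi>), csc t (snd \<xi>)))) holomorphic_on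
        {t. cprod P (fst p + csc t (fst \<xi>)) \<noteq> 0 \<and> cprod P (snd p + csc t (snd \<xi>)) \<noteq> 0}"
    proof -
      have eq: "(\<lambda>t. alt_sum \<Phi> (fst p + csc t (fst \<xi>)) (snd p + csc t (snd \<xi>))) =
        (\<lambda>t. \<Sum>w\<in>reflection_group \<Phi>. of_real (det (matrix w)) * exp (cbil (act w (fst p)) (snd p) + t * cbil (act w (fst \<xi>)) (snd p) +
           t * (cbil (act w (fst p)) (snd \<xi>) + t * cbil (act w (fst \<xi>)) (snd \<xi>))))"
        unfolding alt_sum_def
        by (intro ext sum.cong HOL.refl) (simp add: act_add act_csc lin cbil_add_left cbil_add_right cbil_csc_left cbil_csc_right algebra_simps)
      have 1: "(\<lambda>t. alt_sum \<Phi> (fst p + csc t (fst \<xi>)) (snd p + csc t (snd \<xi>))) holomorphic_on S" for S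
        unfolding eq by (intro holomorphic_intros)
      have 2: "(\<lambda>t. cprod P (z + csc t y)) holomorphic_on S" for z y S
        unfolding cprod_def cpair_add cpair_csc by (intro holomorphic_intros)
      show ?thesis unfolding f_def fst_add snd_add fst_conv snd_conv
        by (intro holomorphic_on_divide holomorphic_on_mult 1 2) auto
    qed
    then show "(\<lambda>t. f (p + (csc t (fst \<xi>), csc t (snd \<xi>)))) holomorphic_on
      {t. p + (csc t (fst \<xi>), csc t (snd \<xi>)) \<in> {p. cprod P (fst p) \<noteq> 0 \<and> cprod P (snd p) \<noteq> 0}}"
      by simp
  qed
  have flb: "\<exists>r>0. \<exists>M. \<forall>y\<in>ball x r \<inter> {x. \<forall>l\<in>L. l x \<noteq> 0}. cmod (f y) \<le> M" for x
  proof -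
    define G where "G p = C * exp_sum \<Phi> (fst p) (snd p) * decay_sum v \<Phi> (fst p) (snd p)" for p
    have "(G \<longlongrightarrow> G x) (at x)" unfolding G_def
      by (intro tendsto_intros tendsto_exp_sum tendsto_decay_sum tendsto_fst tendsto_snd)
    then have "\<forall>\<^sub>F y in at x. G y < G x + 1" by (rule order_tendstoD) simp
    then obtain r where r: "r > 0" "\<And>y. y \<noteq> x \<Longrightarrow> dist y x < r \<Longrightarrow> G y < G x + 1"
      by (auto simp: eventually_at)
    have "cmod (f y) \<le> G x + 1" if "y \<in> ball x r \<inter> {x. \<forall>l\<in>L. l x \<noteq> 0}" for y
    proof -
      have "cmod (f y) \<le> G y" unfolding G_def by (rule fbd) (use that reg in blast)
      also have "G y \<le> G x + 1" using r(2)[of y] that by (cases "y = x") (auto simp: dist_commute)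
      finally show ?thesis .
    qed
    then show ?thesis using r(1) by blast
  qed
  obtain F where F: "continuous_on UNIV F" "csp2.line_holomorphic F UNIV" "\<And>x. \<forall>l\<in>L. l x \<noteq> 0 \<Longrightarrow> F x = f x"
  proof (rule csp2.Riemann_extension[of L "((v, 0), (v, 0))" f])
    show "finite L" using finP by (simp add: L_def)
    show "l (x + y) = l x + l y" if "l \<in> L" for l x y using that by (auto simp: L_def cpair_add)
    show "l (csc t (fst x), csc t (snd x)) = t * l x" if "l \<in> L" for l t x using that by (auto simp: L_def cpair_csc)
    show "continuous_on UNIV l" if "l \<in> L" for l using that by (auto simp: L_def intro: cpair_continuous)
    show "l ((v, 0), v, 0) \<noteq> 0" if "l \<in> L" for l using that Pv by (auto simp: L_def cpair_real inner_commute)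
  qed (use fhol flb in auto)
  have Freg: "F p = f p" if "cprod P (fst p) \<noteq> 0" "cprod P (snd p) \<noteq> 0" for p
    using F(3)[of p] reg that by blast
  have lim: "(\<lambda>n. F (z + inverse (real (Suc n)) *\<^sub>R (v, 0), X + inverse (real (Suc n)) *\<^sub>R (v, 0))) \<longlonglongrightarrow> F (z, X)" for z X
    by (rule continuous_on_tendsto_compose[OF F(1)]) (intro tendsto_Pair tendsto_perturb, simp_all)
  have evreg: "\<forall>\<^sub>F n in sequentially. cprod P (z + inverse (real (Suc n)) *\<^sub>R (v, 0)) \<noteq> 0 \<and>
      cprod P (X + inverse (real (Suc n)) *\<^sub>R (v, 0)) \<noteq> 0" for z X :: "'r spectral"
    by (intro eventually_conj eventually_cprod_nonzero finP Pv)
  have id: "alt_sum \<Phi> z X = cprod P z * cprod P X * F (z, X)" for z X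
  proof -
    let ?z = "\<lambda>n. z + inverse (real (Suc n)) *\<^sub>R (v, 0)" and ?X = "\<lambda>n. X + inverse (real (Suc n)) *\<^sub>R (v, 0)"
    have "\<forall>\<^sub>F n in sequentially. alt_sum \<Phi> (?z n) (?X n) = cprod P (?z n) * cprod P (?X n) * F (?z n, ?X n)"
      using evreg[of z X] by eventually_elim (simp add: Freg f_def)
    moreover have "(\<lambda>n. alt_sum \<Phi> (?z n) (?X n)) \<longlonglongrightarrow> alt_sum \<Phi> z X"
      by (intro tendsto_alt_sum tendsto_perturb)
    ultimately have "(\<lambda>n. cprod P (?z n) * cprod P (?X n) * F (?z n, ?X n)) \<longlonglongrightarrow> alt_sum \<Phi> z X"
      by (rule Lim_transform_eventually[rotated])
    moreover have "(\<lambda>n. cprod P (?z n) * cprod P (?X n) * F (?z n, ?X n)) \<longlonglongrightarrow> cprod P z * cprod P X * F (z, X)"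
      by (intro tendsto_mult tendsto_cprod tendsto_perturb lim)
    ultimately show ?thesis by (rule LIMSEQ_unique)
  qed
  have bd: "cmod (F (z, X)) \<le> C * exp_sum \<Phi> z X * decay_sum v \<Phi> z X" for z X
  proof -
    let ?z = "\<lambda>n. z + inverse (real (Suc n)) *\<^sub>R (v, 0)" and ?X = "\<lambda>n. X + inverse (real (Suc n)) *\<^sub>R (v, 0)"
    have ev: "\<forall>\<^sub>F n in sequentially. cmod (F (?z n, ?X n)) \<le> C * exp_sum \<Phi> (?z n) (?X n) * decay_sum v \<Phi> (?z n) (?X n)"
      using evreg[of z X]
    proof eventually_elim
      case (elim n)
      then show ?case using fbd[of "(?z n, ?X n)"] Freg[of "(?z n, ?X n)"] by simp
    qed
    show ?thesis
      by (rule tendsto_le[OF sequentially_bot _ _ ev])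
        (intro tendsto_mult tendsto_const tendsto_norm tendsto_exp_sum tendsto_decay_sum tendsto_perturb lim)+
  qed
  show ?thesis using that F(1,2) id C(1) bd by blast
qed

section \<open>Normalization\<close>

text \<open>Expanding one of the \<open>n + 1\<close> inner products in an orthonormal basis turns the kernel into a sum of kernels
  of degree \<open>n\<close> with new coefficients. In other words, it is the squared norm of a combination of tensor
  powers.\<close>

lemma power_kernel_nonneg:
  fixes x :: "'i \<Rightarrow> 'a::euclidean_space" and c :: "'i \<Rightarrow> real"
  shows "(\<Sum>i\<in>I. \<Sum>k\<in>I. c i * c k * (x i \<bullet> x k) ^ n) \<ge> 0"
proof (induction n arbitrary: c)
  case 0
  have "(\<Sum>i\<in>I. \<Sum>k\<in>I. c i * c k * (x i \<bullet> x k) ^ 0) = (\<Sum>i\<in>I. c i) * (\<Sum>i\<in>I. c i)"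
    by (simp add: sum_product)
  then show ?case by simp
next
  case (Suc n)
  have "c i * c k * (x i \<bullet> x k) ^ Suc n =
      (\<Sum>b\<in>Basis. (c i * (x i \<bullet> b)) * (c k * (x k \<bullet> b)) * (x i \<bullet> x k) ^ n)" for i k
    by (simp add: euclidean_inner[of "x i" "x k"] sum_distrib_left sum_distrib_right algebra_simps)
  then have "(\<Sum>i\<in>I. \<Sum>k\<in>I. c i * c k * (x i \<bullet> x k) ^ Suc n) =
     (\<Sum>i\<in>I. \<Sum>k\<in>I. \<Sum>b\<in>Basis. (c i * (x i \<bullet> b)) * (c k * (x k \<bullet> b)) * (x i \<bullet> x k) ^ n)"
    by simp
  also have "\<dots> = (\<Sum>i\<in>I. \<Sum>b\<in>Basis. \<Sum>k\<in>I. (c i * (x i \<bullet> b)) * (c k * (x k \<bullet> b)) * (x i \<bullet> x k) ^ n)"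
    by (intro sum.cong HOL.refl sum.swap)
  also have "\<dots> = (\<Sum>b\<in>Basis. \<Sum>i\<in>I. \<Sum>k\<in>I. (c i * (x i \<bullet> b)) * (c k * (x k \<bullet> b)) * (x i \<bullet> x k) ^ n)"
    by (rule sum.swap)
  also have "\<dots> \<ge> 0" by (intro sum_nonneg Suc.IH)
  finally show ?case .
qed

lemma exp_kernel_nonneg:
  fixes x :: "'i \<Rightarrow> 'a::euclidean_space" and c :: "'i \<Rightarrow> real"
  shows "(\<Sum>i\<in>I. \<Sum>k\<in>I. c i * c k * exp (x i \<bullet> x k)) \<ge> 0"
proof -
  have 1: "(\<lambda>n. \<Sum>i\<in>I. \<Sum>k\<in>I. c i * c k * ((x i \<bullet> x k) ^ n /\<^sub>R fact n)) sums (\<Sum>i\<in>I. \<Sum>k\<in>I. c i * c k * exp (x i \<bullet> x k))"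
    by (intro sums_sum sums_mult exp_converges)
  have 2: "0 \<le> (\<Sum>i\<in>I. \<Sum>k\<in>I. c i * c k * ((x i \<bullet> x k) ^ n /\<^sub>R fact n))" for n
  proof -
    have "(\<Sum>i\<in>I. \<Sum>k\<in>I. c i * c k * ((x i \<bullet> x k) ^ n /\<^sub>R fact n)) =
      inverse (fact n) * (\<Sum>i\<in>I. \<Sum>k\<in>I. c i * c k * (x i \<bullet> x k) ^ n)"
      by (simp add: sum_distrib_left mult.left_commute mult.commute)
    then show ?thesis using power_kernel_nonneg[where I=I and c=c and x=x and n=n] by simp
  qed
  show ?thesis by (rule sums_le[OF 2 sums_zero 1])
qed

text \<open>Up to the order of the group, the sum is the quadratic form of the positive semidefinite kernel
  \<open>exp (x \<bullet> y)\<close> on the orbit of \<open>x\<close>, with the determinants as coefficients.\<close>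

lemma alt_sum_diagonal:
  assumes \<Phi>: "root_set \<Phi>"
  obtains r where "r \<ge> 0" "alt_sum \<Phi> (x, 0) (x, 0) = of_real r"
proof
  let ?W = "reflection_group \<Phi>"
  let ?s = "\<lambda>w. det (matrix w)"
  define r where "r = (\<Sum>w\<in>?W. ?s w * exp (w x \<bullet> x))"
  have fin: "finite ?W" by (rule finite_reflection_group[OF \<Phi>])
  show "alt_sum \<Phi> (x, 0) (x, 0) = of_real r"
    unfolding alt_sum_def r_def of_real_sum
    by (intro sum.cong HOL.refl)
      (simp add: act_real reflection_group_linear cbil_real_right cpair_real exp_of_real)
  have "(\<Sum>u\<in>?W. \<Sum>w\<in>?W. ?s u * ?s w * exp (u x \<bullet> w x)) = (\<Sum>u\<in>?W. r)"
  proof (rule sum.cong[OF HOL.refl])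
    fix u assume u: "u \<in> ?W"
    have "(\<Sum>w\<in>?W. ?s u * ?s w * exp (u x \<bullet> w x)) = (\<Sum>w\<in>?W. ?s u * ?s (u \<circ> w) * exp (u x \<bullet> (u \<circ> w) x))"
      by (rule sum.reindex_bij_betw[OF bij_comp_left[OF u], symmetric])
    also have "\<dots> = r" unfolding r_def
    proof (rule sum.cong[OF HOL.refl])
      fix w assume w: "w \<in> ?W"
      have "?s u * ?s (u \<circ> w) = ?s w"
        using reflection_group_det[OF u] \<Phi> by (auto simp: det_comp[OF u w] root_set_def)
      then show "?s u * ?s (u \<circ> w) * exp (u x \<bullet> (u \<circ> w) x) = ?s w * exp (w x \<bullet> x)"
        using reflection_group_inner[OF u, of x "w x"] by (simp add: inner_commute)
    qed
    finally show "(\<Sum>w\<in>?W. ?s u * ?s w * exp (u x \<bullet> w x)) = r" .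
  qed
  then have "real (card ?W) * r \<ge> 0"
    using exp_kernel_nonneg[where I="?W" and c="?s" and x="\<lambda>w. w x"] by simp
  moreover have "card ?W > 0" using fin reflection_group_id[of \<Phi>] by (auto simp: card_gt_0_iff)
  ultimately show "r \<ge> 0" by (simp add: zero_le_mult_iff)
qed

text \<open>The sign does not depend on \<open>G\<close>: passing to another positive system changes the product over the roots
  other than \<open>\<alpha>\<close> by a sign that is the same for all odd functions. Choose a vector \<open>X\<close> orthogonal to \<open>\<alpha>\<close> and
  to no other root but \<open>- \<alpha>\<close>. The roots that are positive on \<open>X\<close> are permuted by the reflection, and the root \<open>\<alpha>\<close>
  itself contributes the factor \<open>-1\<close>.\<close>

lemma prod_pos_odd:
  fixes \<Phi> :: "(real^'r) set" and G :: "real^'r \<Rightarrow> real"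
  assumes \<Phi>: "root_set \<Phi>" and v: "\<And>\<alpha>. \<alpha> \<in> \<Phi> \<Longrightarrow> \<alpha> \<bullet> v \<noteq> 0" and a\<Phi>: "\<alpha> \<in> \<Phi>" and odd: "\<And>\<beta>. G (- \<beta>) = - G \<beta>"
  shows "(\<Prod>\<beta>\<in>pos_roots v \<Phi>. G (reflection \<alpha> \<beta>)) = - (\<Prod>\<beta>\<in>pos_roots v \<Phi>. G \<beta>)"
proof -
  let ?P = "pos_roots v \<Phi>"
  have fin: "finite \<Phi>" "finite ?P" using \<Phi> by (auto simp: root_set_def pos_roots_def)
  define a where "a = (if \<alpha> \<bullet> v > 0 then \<alpha> else - \<alpha>)"
  have refl_a: "reflection \<alpha> = reflection a" by (auto simp: a_def reflection_def fun_eq_iff)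
  have aP: "a \<in> ?P" using a\<Phi> v[OF a\<Phi>] root_set_uminus[OF \<Phi> a\<Phi>] by (auto simp: a_def pos_roots_def)
  then have a\<Phi>: "a \<in> \<Phi>" and a0: "a \<noteq> 0" using \<Phi> by (auto simp: pos_roots_def root_set_def)
  define pr where "pr \<beta> = \<beta> - ((\<beta> \<bullet> a) / (a \<bullet> a)) *\<^sub>R a" for \<beta>
  have "\<exists>d. \<forall>b\<in>pr ` (\<Phi> - {a, - a}). b \<bullet> d \<noteq> 0"
  proof (rule avoid_hyperplanes)
    show "0 \<notin> pr ` (\<Phi> - {a, - a})"
    proof
      assume "0 \<in> pr ` (\<Phi> - {a, - a})"
      then obtain \<beta> where "0 = pr \<beta>" "\<beta> \<in> \<Phi> - {a, - a}" by (rule imageE)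
      then have b: "\<beta> \<in> \<Phi>" "\<beta> \<noteq> a" "\<beta> \<noteq> - a" "\<beta> = ((\<beta> \<bullet> a) / (a \<bullet> a)) *\<^sub>R a"
        by (auto simp only: pr_def Diff_iff insert_iff eq_iff_diff_eq_0[of \<beta>])
      then have "(\<beta> \<bullet> a) / (a \<bullet> a) = 1 \<or> (\<beta> \<bullet> a) / (a \<bullet> a) = - 1"
        using \<Phi> a\<Phi> unfolding root_set_def by metis
      then show False using b by (metis scaleR_minus1_left scaleR_one)
    qed
  qed (use fin in simp)
  then obtain d where d: "\<And>\<beta>. \<beta> \<in> \<Phi> \<Longrightarrow> \<beta> \<noteq> a \<Longrightarrow> \<beta> \<noteq> - a \<Longrightarrow> pr \<beta> \<bullet> d \<noteq> 0" by auto
  define X where "X = pr d"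
  have X: "\<beta> \<bullet> X = pr \<beta> \<bullet> d" for \<beta> by (simp add: X_def pr_def inner_diff_left inner_diff_right inner_commute)
  have aX: "a \<bullet> X = 0" using a0 by (simp add: X pr_def inner_diff_left)
  have sX: "reflection a \<beta> \<bullet> X = \<beta> \<bullet> X" for \<beta>
    using reflection_inner[of a \<beta> X] reflection_fixes[OF aX] by simp
  let ?Q = "?P - {a}" and ?PX = "{\<beta>\<in>\<Phi>. \<beta> \<bullet> X > 0}"
  define sg where "sg \<beta> = (if \<beta> \<bullet> X > 0 then 1 else -1 :: real)" for \<beta>
  define nn where "nn \<beta> = (if \<beta> \<bullet> X > 0 then \<beta> else - \<beta>)" for \<beta>
  have QX: "\<beta> \<bullet> X \<noteq> 0" if "\<beta> \<in> ?Q" for \<beta>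
  proof -
    have "\<beta> \<noteq> - a" using that aP by (auto simp: pos_roots_def)
    then show ?thesis using d[of \<beta>] that X by (auto simp: pos_roots_def)
  qed
  have bij: "bij_betw nn ?Q ?PX"
  proof (rule bij_betwI[where g = "\<lambda>\<beta>. if \<beta> \<bullet> v > 0 then \<beta> else - \<beta>"])
    show "nn \<in> ?Q \<rightarrow> ?PX"
      using QX root_set_uminus[OF \<Phi>] by (fastforce simp: nn_def pos_roots_def)
    show "(\<lambda>\<beta>. if \<beta> \<bullet> v > 0 then \<beta> else - \<beta>) \<in> ?PX \<rightarrow> ?Q"
    proof
      fix \<beta> assume b: "\<beta> \<in> ?PX"
      then have "\<beta> \<noteq> a" "- \<beta> \<noteq> a" using aX by auto
      then show "(if \<beta> \<bullet> v > 0 then \<beta> else - \<beta>) \<in> ?Q"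
        using b v[of \<beta>] root_set_uminus[OF \<Phi>, of \<beta>] by (auto simp: pos_roots_def)
    qed
  qed (auto simp: nn_def pos_roots_def)
  have key: "(\<Prod>\<beta>\<in>?Q. H \<beta>) = (\<Prod>\<beta>\<in>?Q. sg \<beta>) * (\<Prod>\<beta>\<in>?PX. H \<beta>)" if "\<And>\<beta>. H (- \<beta>) = - H \<beta>" for H :: "real^'r \<Rightarrow> real"
  proof -
    have "(\<Prod>\<beta>\<in>?Q. H \<beta>) = (\<Prod>\<beta>\<in>?Q. sg \<beta> * H (nn \<beta>))"
      by (intro prod.cong) (auto simp: sg_def nn_def that)
    then show ?thesis using prod.reindex_bij_betw[OF bij, of H] by (simp add: prod.distrib)
  qed
  have bij2: "bij_betw (reflection a) ?PX ?PX"
    by (rule bij_betwI[where g = "reflection a"]) (use \<Phi> a\<Phi> in \<open>auto simp: sX reflection_reflection root_set_def\<close>)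
  have "(\<Prod>\<beta>\<in>?Q. G \<beta>) = (\<Prod>\<beta>\<in>?Q. sg \<beta>) * (\<Prod>\<beta>\<in>?PX. G \<beta>)"
    by (rule key) (rule odd)
  moreover have "(\<Prod>\<beta>\<in>?Q. G (reflection a \<beta>)) = (\<Prod>\<beta>\<in>?Q. sg \<beta>) * (\<Prod>\<beta>\<in>?PX. G (reflection a \<beta>))"
    by (rule key[of "\<lambda>\<beta>. G (reflection a \<beta>)"]) (simp add: odd linear_neg[OF linear_reflection])
  ultimately have "(\<Prod>\<beta>\<in>?Q. G (reflection a \<beta>)) = (\<Prod>\<beta>\<in>?Q. G \<beta>)"
    by (simp only: prod.reindex_bij_betw[OF bij2])
  moreover have "(\<Prod>\<beta>\<in>?P. H \<beta>) = H a * (\<Prod>\<beta>\<in>?Q. H \<beta>)" for H :: "real^'r \<Rightarrow> real"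
    by (rule prod.remove[OF fin(2) aP])
  ultimately show ?thesis by (simp add: refl_a reflection_self odd)
qed

text \<open>Weyl's denominator, at \<open>2 x\<close>: the form in which it divides the spherical function.\<close>

definition Weyl_denominator :: "(real^'r) set \<Rightarrow> real^'r \<Rightarrow> real" where
  "Weyl_denominator P x = (\<Prod>\<alpha>\<in>P. exp (\<alpha> \<bullet> x) - exp (- (\<alpha> \<bullet> x)))"

lemma Weyl_denominator_alternating:
  fixes \<Phi> :: "(real^'r) set"
  assumes \<Phi>: "root_set \<Phi>" and v: "\<And>\<alpha>. \<alpha> \<in> \<Phi> \<Longrightarrow> \<alpha> \<bullet> v \<noteq> 0" and w: "w \<in> reflection_group \<Phi>"
  shows "Weyl_denominator (pos_roots v \<Phi>) (w x) = det (matrix w) * Weyl_denominator (pos_roots v \<Phi>) x"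
  using w
proof (induction rule: reflection_group.induct)
  case reflection_group_id
  show ?case by (simp only: matrix_id_mat_1 det_I) simp
next
  case (reflection_group_step \<alpha> w)
  have a0: "\<alpha> \<noteq> 0" using reflection_group_step(1) \<Phi> by (auto simp: root_set_def)
  have in': "\<beta> \<bullet> reflection \<alpha> y = reflection \<alpha> \<beta> \<bullet> y" for \<beta> y
    using reflection_inner[of \<alpha> \<beta> "reflection \<alpha> y"] by (simp add: reflection_reflection)
  have "Weyl_denominator (pos_roots v \<Phi>) (reflection \<alpha> (w x)) = - Weyl_denominator (pos_roots v \<Phi>) (w x)"
    unfolding Weyl_denominator_def in'
    by (rule prod_pos_odd[OF \<Phi> v reflection_group_step(1)]) simp_all
  moreover have "det (matrix (reflection \<alpha> \<circ> w)) = - det (matrix w)"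
    using det_comp[OF reflection_in_group[OF reflection_group_step(1)] reflection_group_step(2)] det_reflection[OF a0] by simp
  ultimately show ?case
    unfolding comp_apply[of "reflection \<alpha>" w x] using reflection_group_step.IH
    by (metis mult_minus_left)
qed

text \<open>Multiplying out gives a signed sum of exponentials; averaging over the group, with determinants,
  does nothing on the left, where the product is already alternating, and turns the exponentials into
  alternating sums. This replaces Weyl's denominator formula in the next proof.\<close>

lemma Weyl_denominator_expansion:
  fixes \<Phi> :: "(real^'r) set"
  assumes \<Phi>: "root_set \<Phi>" and v: "\<And>\<alpha>. \<alpha> \<in> \<Phi> \<Longrightarrow> \<alpha> \<bullet> v \<noteq> 0"
  defines "P \<equiv> pos_roots v \<Phi>"
  shows "of_real (real (card (reflection_group \<Phi>)) * Weyl_denominator P x) =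
    (\<Sum>S\<in>Pow P. (-1) ^ card (P - S) * alt_sum \<Phi> (x, 0) (\<Sum>S - \<Sum>(P - S), 0))"
proof -
  let ?W = "reflection_group \<Phi>"
  let ?s = "\<lambda>w. det (matrix w)"
  have finP: "finite P" using \<Phi> by (auto simp: P_def pos_roots_def root_set_def)
  have D: "Weyl_denominator P y = (\<Sum>S\<in>Pow P. (-1) ^ card (P - S) * exp (y \<bullet> (\<Sum>S - \<Sum>(P - S))))" for y
  proof -
    have "Weyl_denominator P y = (\<Prod>\<alpha>\<in>P. exp (\<alpha> \<bullet> y) + - exp (- (\<alpha> \<bullet> y)))" by (simp add: Weyl_denominator_def)
    also have "\<dots> = (\<Sum>S\<in>Pow P. (\<Prod>\<alpha>\<in>S. exp (\<alpha> \<bullet> y)) * (\<Prod>\<alpha>\<in>P - S. - exp (- (\<alpha> \<bullet> y))))"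
      by (rule prod_add[OF finP])
    also have "\<dots> = (\<Sum>S\<in>Pow P. (-1) ^ card (P - S) * exp (y \<bullet> (\<Sum>S - \<Sum>(P - S))))"
    proof (rule sum.cong[OF HOL.refl])
      fix S assume "S \<in> Pow P"
      then have fS: "finite S" "finite (P - S)" using finP finite_subset by auto
      have "(\<Prod>\<alpha>\<in>P - S. - exp (- (\<alpha> \<bullet> y))) = (-1) ^ card (P - S) * exp (- (\<Sum>\<alpha>\<in>P - S. \<alpha> \<bullet> y))"
        using fS by (simp add: prod_uminus exp_sum flip: sum_negf)
      then show "(\<Prod>\<alpha>\<in>S. exp (\<alpha> \<bullet> y)) * (\<Prod>\<alpha>\<in>P - S. - exp (- (\<alpha> \<bullet> y))) = (-1) ^ card (P - S) * exp (y \<bullet> (\<Sum>S - \<Sum>(P - S)))"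
        using fS by (simp add: exp_sum[symmetric] inner_diff_right inner_sum_right inner_commute exp_diff exp_minus field_simps)
    qed
    finally show ?thesis .
  qed
  have "real (card ?W) * Weyl_denominator P x = (\<Sum>w\<in>?W. ?s w * Weyl_denominator P (w x))"
  proof -
    have "?s w * Weyl_denominator P (w x) = Weyl_denominator P x" if w: "w \<in> ?W" for w
      using Weyl_denominator_alternating[OF \<Phi> v w, of x] reflection_group_det[OF w] \<Phi>
      by (auto simp: P_def root_set_def)
    then show ?thesis by simp
  qed
  also have "\<dots> = (\<Sum>w\<in>?W. \<Sum>S\<in>Pow P. (-1) ^ card (P - S) * (?s w * exp (w x \<bullet> (\<Sum>S - \<Sum>(P - S)))))"
    unfolding D by (simp add: sum_distrib_left mult.left_commute)
  also have "\<dots> = (\<Sum>S\<in>Pow P. (-1) ^ card (P - S) * (\<Sum>w\<in>?W. ?s w * exp (w x \<bullet> (\<Sum>S - \<Sum>(P - S)))))"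
    by (subst sum.swap) (simp add: sum_distrib_left)
  finally have "real (card ?W) * Weyl_denominator P x = \<dots>" .
  moreover have "complex_of_real (\<Sum>w\<in>?W. ?s w * exp (w x \<bullet> y)) = alt_sum \<Phi> (x, 0) (y, 0)" for y
    unfolding alt_sum_def of_real_sum
    by (intro sum.cong HOL.refl) (simp add: act_real reflection_group_linear cbil_real_right cpair_real exp_of_real)
  ultimately show ?thesis by simp
qed

text \<open>Moving a scalar from \<open>z\<close> to \<open>X\<close> changes neither the alternating sum nor the product of roots. Letting the
  scalar tend to \<open>0\<close> gives \<open>F (0, X) = F (z, 0)\<close>, a constant. It is nonnegative as the limit of
  \<open>F (h v, h v)\<close> for \<open>h \<rightarrow> 0\<close>, by positive semidefiniteness. If it were zero, then, by the expansion of
  the product \<open>\<Prod>\<^sub>\<alpha> 2 sinh \<alpha>(x)\<close>, the quotient of this product by \<open>\<Prod>\<^sub>\<alpha> \<alpha>(x)\<close> would tend to \<open>0\<close> at the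
  origin, whereas it is at least \<open>1\<close> for dominant \<open>x\<close>.\<close>

lemma Harish_Chandra_normalization:
  fixes \<Phi> :: "(real^'r) set"
  assumes \<Phi>: "root_set \<Phi>" and v: "\<And>\<alpha>. \<alpha> \<in> \<Phi> \<Longrightarrow> \<alpha> \<bullet> v \<noteq> 0"
  defines "P \<equiv> pos_roots v \<Phi>"
  assumes F: "continuous_on UNIV F" "\<And>z X. alt_sum \<Phi> z X = cprod P z * cprod P X * F (z, X)"
  obtains c where "c > 0" "\<And>X. F (0, X) = of_real c"
proof -
  have finP: "finite P" and P\<Phi>: "P \<subseteq> \<Phi>" using \<Phi> by (auto simp: P_def pos_roots_def root_set_def)
  have Pv: "\<alpha> \<bullet> v > 0" if "\<alpha> \<in> P" for \<alpha> using that by (simp add: P_def pos_roots_def)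
  have Fl: "((\<lambda>n. F (z n, X n)) \<longlonglongrightarrow> F (z', X'))" if "z \<longlonglongrightarrow> z'" "X \<longlonglongrightarrow> X'" for z X z' X'
    using that by (intro continuous_on_tendsto_compose[OF F(1)] tendsto_Pair) auto
  let ?h = "\<lambda>n. inverse (real (Suc n))"
  let ?v = "\<lambda>n. ?h n *\<^sub>R (v, 0 :: real^'r)"
  have h0: "?h \<longlonglongrightarrow> 0" by (rule LIMSEQ_inverse_real_of_nat)
  have hz: "(\<lambda>n. ?h n *\<^sub>R z) \<longlonglongrightarrow> 0" for z :: "'r spectral"
    using tendsto_perturb[of 0 z] by simp
  have cpv: "cprod P (?v n) = of_real (\<Prod>\<alpha>\<in>P. ?h n * (\<alpha> \<bullet> v))" for n
    by (simp add: cprod_def cpair_scaleR cpair_real inner_commute del: of_nat_Suc)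
  have cpv0: "cprod P (?v n) \<noteq> 0" for n
    unfolding cprod_nonzero[OF finP] using Pv by (force simp: cpair_scaleR cpair_real inner_commute simp del: of_nat_Suc)
  have sym: "F (0, X) = F (z, 0)" if "cprod P z \<noteq> 0" "cprod P X \<noteq> 0" for z X
  proof -
    have "F (?h n *\<^sub>R z, X) = F (z, ?h n *\<^sub>R X)" for n
    proof -
      have hn: "complex_of_real (?h n) \<noteq> 0" by (simp del: of_nat_Suc)
      have "alt_sum \<Phi> (csc (of_real (?h n)) z) X = alt_sum \<Phi> z (csc (of_real (?h n)) X)"
        by (simp add: alt_sum_def act_csc reflection_group_linear cbil_csc_left cbil_csc_right)
      then have "of_real (?h n) ^ card P * cprod P z * cprod P X * F (csc (of_real (?h n)) z, X) =
          of_real (?h n) ^ card P * cprod P z * cprod P X * F (z, csc (of_real (?h n)) X)"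
        unfolding F(2) cprod_csc by (simp only: mult.assoc mult.left_commute mult.commute)
      then have "F (csc (of_real (?h n)) z, X) = F (z, csc (of_real (?h n)) X)"
        using that hn by (simp only: mult_cancel_left mult_eq_0_iff power_eq_0_iff) auto
      then show ?thesis by (simp only: csp.sc_real)
    qed
    moreover have "(\<lambda>n. F (?h n *\<^sub>R z, X)) \<longlonglongrightarrow> F (0, X)" by (intro Fl hz tendsto_const)
    moreover have "(\<lambda>n. F (z, ?h n *\<^sub>R X)) \<longlonglongrightarrow> F (z, 0)" by (intro Fl hz tendsto_const)
    ultimately show ?thesis using LIMSEQ_unique by simp
  qed
  have const: "F (0, X) = F (0, 0)" for X
  proof -
    have reg: "F (0, X) = F (0, 0)" if "cprod P X \<noteq> 0" for X
    proof -
      have "(\<lambda>n. F (?v n, 0)) \<longlonglongrightarrow> F (0, 0)" by (intro Fl hz tendsto_const)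
      moreover have "F (?v n, 0) = F (0, X)" for n using sym[OF cpv0 that] by simp
      ultimately show ?thesis by (simp add: LIMSEQ_const_iff)
    qed
    have "\<forall>\<^sub>F n in sequentially. F (0, X + ?v n) = F (0, 0)"
    proof -
      have "\<forall>\<^sub>F n in sequentially. cprod P (X + ?v n) \<noteq> 0"
        by (rule eventually_cprod_nonzero[OF finP]) (use Pv in force)
      then show ?thesis by eventually_elim (rule reg)
    qed
    moreover have "(\<lambda>n. F (0, X + ?v n)) \<longlonglongrightarrow> F (0, X)" by (intro Fl tendsto_perturb tendsto_const)
    ultimately have "(\<lambda>n. F (0, 0)) \<longlonglongrightarrow> F (0, X)" by (rule Lim_transform_eventually[rotated])
    then show ?thesis by (simp add: LIMSEQ_const_iff)
  qed
  have nonneg: "Re (F (0, 0)) \<ge> 0 \<and> Im (F (0, 0)) = 0"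
  proof -
    have vv: "Re (F (?v n, ?v n)) \<ge> 0 \<and> Im (F (?v n, ?v n)) = 0" for n
    proof -
      obtain r where r: "r \<ge> 0" "alt_sum \<Phi> (?v n) (?v n) = of_real r"
        using alt_sum_diagonal[OF \<Phi>, of "?h n *\<^sub>R v"] by auto
      define p where "p = (\<Prod>\<alpha>\<in>P. ?h n * (\<alpha> \<bullet> v))"
      have "p \<noteq> 0" using cpv0[of n] unfolding cpv p_def[symmetric] by simp
      have "of_real r = of_real (p * p) * F (?v n, ?v n)" using r(2) unfolding F(2) cpv p_def by simp
      then have "F (?v n, ?v n) = of_real (r / (p * p))" using \<open>p \<noteq> 0\<close> by (simp add: field_simps)
      then show ?thesis using r(1) by simp
    qed
    have l: "(\<lambda>n. F (?v n, ?v n)) \<longlonglongrightarrow> F (0, 0)" by (intro Fl hz)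
    have "Re (F (0, 0)) \<ge> 0" by (rule tendsto_lowerbound[OF tendsto_Re[OF l]]) (use vv in auto)
    moreover have "Im (F (0, 0)) = 0" using tendsto_Im[OF l] vv by (simp add: LIMSEQ_const_iff)
    ultimately show ?thesis by blast
  qed
  have "F (0, 0) \<noteq> 0"
  proof
    assume z: "F (0, 0) = 0"
    let ?T = "\<lambda>n. \<Sum>S\<in>Pow P. (-1) ^ card (P - S) * cprod P (\<Sum>S - \<Sum>(P - S), 0) * F (?v n, (\<Sum>S - \<Sum>(P - S), 0))"
    have "?T \<longlonglongrightarrow> (\<Sum>S\<in>Pow P. (-1) ^ card (P - S) * cprod P (\<Sum>S - \<Sum>(P - S), 0) * F (0, (\<Sum>S - \<Sum>(P - S), 0)))"
      by (intro tendsto_sum tendsto_mult tendsto_const Fl hz)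
    moreover have "F (0, X) = 0" for X by (simp only: const[of X] z)
    ultimately have "?T \<longlonglongrightarrow> 0" by simp
    then have lim: "(\<lambda>n. cmod (?T n)) \<longlonglongrightarrow> 0" by (rule tendsto_norm_zero)
    have "cmod (?T n) \<ge> 1" for n
    proof -
      define y where "y \<alpha> = ?h n * (\<alpha> \<bullet> v)" for \<alpha>
      have y: "y \<alpha> > 0" if "\<alpha> \<in> P" for \<alpha> using Pv[OF that] by (simp add: y_def del: of_nat_Suc)
      let ?p = "\<Prod>\<alpha>\<in>P. y \<alpha>"
      have p: "?p > 0" using y by (intro prod_pos) auto
      have wd: "Weyl_denominator P (?h n *\<^sub>R v) \<ge> ?p"
        unfolding Weyl_denominator_def
      proof (rule prod_mono, rule conjI)
        fix \<alpha> assume a: "\<alpha> \<in> P"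
        have "exp (y \<alpha>) \<ge> 1 + y \<alpha>" "exp (- y \<alpha>) \<le> 1" using y[OF a] by (auto intro: exp_ge_add_one_self)
        moreover have "\<alpha> \<bullet> ?h n *\<^sub>R v = y \<alpha>" by (simp add: y_def del: of_nat_Suc)
        ultimately show "y \<alpha> \<le> exp (\<alpha> \<bullet> ?h n *\<^sub>R v) - exp (- (\<alpha> \<bullet> ?h n *\<^sub>R v))" by (simp only:)
      qed (use y in \<open>auto intro: less_imp_le\<close>)
      have vn: "?v n = (?h n *\<^sub>R v, 0)" by simp
      have "complex_of_real (real (card (reflection_group \<Phi>)) * Weyl_denominator P (?h n *\<^sub>R v)) =
          (\<Sum>S\<in>Pow P. (-1) ^ card (P - S) * alt_sum \<Phi> (?h n *\<^sub>R v, 0) (\<Sum>S - \<Sum>(P - S), 0))"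
        by (rule Weyl_denominator_expansion[OF \<Phi> v, folded P_def])
      also have "\<dots> = cprod P (?v n) * ?T n"
        unfolding F(2) vn sum_distrib_left by (intro sum.cong HOL.refl) (simp only: mult_ac)
      finally have eq: "complex_of_real (real (card (reflection_group \<Phi>)) * Weyl_denominator P (?h n *\<^sub>R v)) = cprod P (?v n) * ?T n" .
      have "real (card (reflection_group \<Phi>)) * \<bar>Weyl_denominator P (?h n *\<^sub>R v)\<bar> = ?p * cmod (?T n)"
      proof -
        have "real (card (reflection_group \<Phi>)) * \<bar>Weyl_denominator P (?h n *\<^sub>R v)\<bar> =
            cmod (complex_of_real (real (card (reflection_group \<Phi>)) * Weyl_denominator P (?h n *\<^sub>R v)))"
          unfolding norm_of_real abs_mult by simp
        also have "\<dots> = cmod (cprod P (?v n)) * cmod (?T n)" unfolding eq by (rule norm_mult)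
        also have "cmod (cprod P (?v n)) = ?p" using p unfolding cpv norm_of_real y_def by (rule abs_of_pos)
        finally show ?thesis .
      qed
      moreover have "real (card (reflection_group \<Phi>)) \<ge> 1"
        using finite_reflection_group[OF \<Phi>] reflection_group_id[of \<Phi>] by (simp add: Suc_le_eq card_gt_0_iff) blast
      then have "1 * ?p \<le> real (card (reflection_group \<Phi>)) * \<bar>Weyl_denominator P (?h n *\<^sub>R v)\<bar>"
        using wd p by (intro mult_mono) auto
      ultimately have "?p * 1 \<le> ?p * cmod (?T n)" by simp
      then show ?thesis using p by (simp only: mult_le_cancel_left_pos)
    qed
    then have "(1::real) \<le> 0" by (intro tendsto_lowerbound[OF lim]) auto
    then show False by simp
  qed
  then have "Re (F (0, 0)) > 0" "F (0, 0) = of_real (Re (F (0, 0)))" using nonneg by (auto simp: complex_eq_iff)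
  then show ?thesis using that[of "Re (F (0, 0))"] const by metis
qed

section \<open>Estimates for the hyperbolic sine\<close>

text \<open>Comparable with \<open>s / sinh s\<close>, also near the real axis.\<close>

definition sinhc_weight :: "real \<Rightarrow> real" where
  "sinhc_weight s = (1 + \<bar>s\<bar>) * exp (- \<bar>s\<bar>)"

lemma sinhc_weight_nonneg: "sinhc_weight s \<ge> 0" by (simp add: sinhc_weight_def)

lemma sinhc_weight_shift:
  assumes "\<bar>d\<bar> \<le> 1"
  shows "sinhc_weight (s + d) \<le> 2 * exp 1 * sinhc_weight s"
proof -
  have "sinhc_weight (s + d) \<le> (2 * (1 + \<bar>s\<bar>)) * exp (1 - \<bar>s\<bar>)"
    unfolding sinhc_weight_def using assms by (intro mult_mono) auto
  then show ?thesis by (simp add: sinhc_weight_def exp_diff exp_minus field_simps)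
qed

lemma cmod_sinh_square: "(cmod (sinh x))\<^sup>2 = (sinh (Re x))\<^sup>2 + (sin (Im x))\<^sup>2"
proof -
  have re: "Re (sinh x) = sinh (Re x) * cos (Im x)" and im: "Im (sinh x) = cosh (Re x) * sin (Im x)"
    by (simp_all add: sinh_field_def cosh_field_def Re_exp Im_exp algebra_simps)
  have "(cmod (sinh x))\<^sup>2 = (sinh (Re x))\<^sup>2 * (cos (Im x))\<^sup>2 + (1 + (sinh (Re x))\<^sup>2) * (sin (Im x))\<^sup>2"
    by (simp add: cmod_power2 re im power_mult_distrib cosh_square_eq add.commute)
  also have "\<dots> = (sinh (Re x))\<^sup>2 * ((cos (Im x))\<^sup>2 + (sin (Im x))\<^sup>2) + (sin (Im x))\<^sup>2"
    by (simp add: sin_squared_eq algebra_simps)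
  finally show ?thesis by simp
qed

lemma abs_sinh_ge_half: "\<bar>sinh y\<bar> \<ge> \<bar>y\<bar> / 2" for y :: real
proof -
  have "u / 2 \<le> sinh u" if "u \<ge> 0" for u :: real
  proof -
    have "exp u \<ge> 1 + u" by (rule exp_ge_add_one_self)
    moreover have "exp (- u) \<le> 1" using that by simp
    ultimately have "u \<le> exp u - exp (- u)" by linarith
    then show ?thesis by (simp add: sinh_field_def)
  qed
  from this[of "\<bar>y\<bar>"] show ?thesis by (cases "y \<ge> 0") auto
qed

lemma abs_sin_ge_half: "\<bar>sin b\<bar> \<ge> \<bar>b\<bar> / 2" if "\<bar>b\<bar> \<le> 1" for b :: real
proof -
  have pos: "sin u \<ge> u / 2" if u: "0 < u" "u \<le> 1" for u :: real
  proof -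
    obtain z where z: "0 < z" "z < u" "sin u - sin 0 = (u - 0) * cos z"
      using MVT2[of 0 u sin cos] u by (auto intro: DERIV_sin)
    have "z \<le> pi / 3" using z u pi_gt3 by linarith
    then have "cos (pi / 3) \<le> cos z" using z pi_gt3 by (subst cos_mono_le_eq) auto
    then have "cos z \<ge> 1 / 2" by (simp add: cos_60)
    then have "u * (1 / 2) \<le> u * cos z" using u by (intro mult_left_mono) auto
    then show ?thesis using z by simp
  qed
  consider "b = 0" | "b > 0" | "b < 0" by linarith
  then show ?thesis
  proof cases
    case 3
    then show ?thesis using pos[of "- b"] that by auto
  qed (use pos[of b] that in auto)
qed

text \<open>For \<open>|Re x| \<ge> 1\<close> the real part alone makes \<open>sinh x\<close> of order \<open>exp |Re x|\<close>. Near the imaginary axis both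
  parts of \<open>|sinh x|\<^sup>2 = sinh\<^sup>2 (Re x) + sin\<^sup>2 (Im x)\<close> are needed.\<close>

lemma cmod_le_sinh:
  assumes "\<bar>Im x\<bar> \<le> 1"
  shows "cmod x \<le> 8 * sinhc_weight (Re x) * cmod (sinh x)"
proof -
  define a where "a = Re x"
  define b where "b = Im x"
  have sq: "(cmod (sinh x))\<^sup>2 = (sinh a)\<^sup>2 + (sin b)\<^sup>2" by (simp add: cmod_sinh_square a_def b_def)
  show ?thesis
  proof (cases "\<bar>a\<bar> \<ge> 1")
    case True
    have "exp \<bar>a\<bar> \<ge> 2" using exp_ge_add_one_self[of "\<bar>a\<bar>"] True by linarith
    moreover have "exp (- \<bar>a\<bar>) \<le> 1" by simp
    ultimately have "exp \<bar>a\<bar> / 2 \<le> exp \<bar>a\<bar> - exp (- \<bar>a\<bar>)" by linarith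
    then have "exp \<bar>a\<bar> / 4 \<le> sinh \<bar>a\<bar>" by (simp add: sinh_field_def)
    moreover have "sinh \<bar>a\<bar> \<le> cmod (sinh x)"
    proof (rule power2_le_imp_le)
      have "(sinh \<bar>a\<bar>)\<^sup>2 = (sinh a)\<^sup>2" by (cases "a \<ge> 0") auto
      then show "(sinh \<bar>a\<bar>)\<^sup>2 \<le> (cmod (sinh x))\<^sup>2" by (simp add: sq)
    qed simp
    ultimately have s: "exp \<bar>a\<bar> \<le> 4 * cmod (sinh x)" by simp
    have "cmod x \<le> \<bar>Re x\<bar> + \<bar>Im x\<bar>" by (rule cmod_le)
    also have "\<dots> \<le> 1 + \<bar>a\<bar>" using assms by (simp add: a_def)
    also have "\<dots> = sinhc_weight a * exp \<bar>a\<bar>" by (simp add: sinhc_weight_def exp_minus)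
    also have "\<dots> \<le> sinhc_weight a * (4 * cmod (sinh x))" by (intro mult_left_mono s sinhc_weight_nonneg)
    also have "\<dots> \<le> 8 * sinhc_weight a * cmod (sinh x)" using sinhc_weight_nonneg[of a] by simp
    finally show ?thesis by (simp add: a_def)
  next
    case False
    have "cmod x \<le> 2 * cmod (sinh x)"
    proof (rule power2_le_imp_le)
      have "(\<bar>a\<bar> / 2)\<^sup>2 \<le> \<bar>sinh a\<bar>\<^sup>2" "(\<bar>b\<bar> / 2)\<^sup>2 \<le> \<bar>sin b\<bar>\<^sup>2"
        using power_mono[OF abs_sinh_ge_half[of a], of 2] power_mono[OF abs_sin_ge_half[of b], of 2] assms
        by (auto simp: b_def)
      moreover have "(cmod x)\<^sup>2 = a\<^sup>2 + b\<^sup>2" by (simp add: cmod_power2 a_def b_def)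
      ultimately show "(cmod x)\<^sup>2 \<le> (2 * cmod (sinh x))\<^sup>2"
        by (simp add: power_mult_distrib sq power_divide)
    qed simp
    moreover have "sinhc_weight a \<ge> 1 / 4"
    proof -
      have "exp (\<bar>a\<bar>) \<le> exp 1" using False by simp
      also have "\<dots> \<le> 3" by (rule exp_le)
      finally have "exp (- \<bar>a\<bar>) \<ge> 1 / 3" by (simp add: exp_minus field_simps)
      then have "1 * (1/3) \<le> (1 + \<bar>a\<bar>) * exp (- \<bar>a\<bar>)" by (intro mult_mono) auto
      then show ?thesis by (simp add: sinhc_weight_def)
    qed
    then have "2 * cmod (sinh x) \<le> 8 * sinhc_weight a * cmod (sinh x)" by (intro mult_right_mono) auto
    ultimately have "cmod x \<le> 8 * sinhc_weight a * cmod (sinh x)" by (rule order_trans)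
    then show ?thesis by (simp only: a_def)
  qed
qed

lemma sinh_le_weight:
  assumes u: "u > 0"
  shows "sinhc_weight u / 2 \<le> u / sinh u"
proof -
  have e: "exp u * exp (- u) = 1" by (simp add: exp_minus)
  have s: "sinh u * exp (- u) = (1 - exp (- 2 * u)) / 2"
    by (simp add: sinh_field_def algebra_simps e flip: exp_add)
  have "exp (- 2 * u) \<ge> 1 + (- 2 * u)" by (rule exp_ge_add_one_self)
  then have 1: "sinh u * exp (- u) \<le> u" unfolding s by simp
  have 2: "sinh u * exp (- u) \<le> 1 / 2" unfolding s by simp
  have "(1 + u) * (sinh u * exp (- u)) \<le> 2 * u"
  proof (cases "u \<le> 1")
    case True
    have "(1 + u) * (sinh u * exp (- u)) \<le> 2 * u" using 1 True u by (intro mult_mono) auto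
    then show ?thesis .
  next
    case False
    have "(1 + u) * (sinh u * exp (- u)) \<le> (2 * u) * (1 / 2)" using 2 False u
      by (intro mult_mono) auto
    then show ?thesis using u by simp
  qed
  then have "sinhc_weight u * sinh u \<le> 2 * u" using u by (simp add: sinhc_weight_def mult.assoc mult.commute mult.left_commute)
  then show ?thesis using u by (simp add: field_simps)
qed

text \<open>The entire function \<open>s\<close> is \<open>sinh x / x\<close>; the spherical functions involve its reciprocal, which is
  free of poles on the strip \<open>|Im x| \<le> 1\<close>.\<close>

lemma sinhc_exists:
  obtains s :: "complex \<Rightarrow> complex" where "s holomorphic_on UNIV" "\<And>x. sinh x = x * s x"
    "\<And>x. \<bar>Im x\<bar> \<le> 1 \<Longrightarrow> s x \<noteq> 0 \<and> inverse (cmod (s x)) \<le> 8 * sinhc_weight (Re x)"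
    "\<And>y. \<exists>r. s (of_real y) = of_real r \<and> r > 0 \<and> sinhc_weight y / 2 \<le> inverse r"
proof -
  have "(sinh :: complex \<Rightarrow> complex) holomorphic_on UNIV"
    unfolding sinh_field_def[abs_def] by (intro holomorphic_intros) auto
  then obtain s where s: "s holomorphic_on UNIV" "\<And>x::complex. sinh x = x * s x"
    by (rule holomorphic_divide_root[of sinh 0]) auto
  have s0: "s 0 = 1"
  proof -
    have "(s has_field_derivative deriv s 0) (at 0)" using holomorphic_derivI[OF s(1), of 0] by simp
    then have "((\<lambda>x. x * s x) has_field_derivative (1 * s 0 + deriv s 0 * 0)) (at 0)"
      by (intro DERIV_mult DERIV_ident)
    moreover have "((\<lambda>x. x * s x) has_field_derivative (1::complex)) (at 0)"
    proof -
      have "((\<lambda>x::complex. sinh x) has_field_derivative cosh 0 * 1) (at 0)" by (intro derivative_intros)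
      then show ?thesis by (simp add: s(2))
    qed
    ultimately show ?thesis using DERIV_unique by fastforce
  qed
  have b: "s x \<noteq> 0 \<and> inverse (cmod (s x)) \<le> 8 * sinhc_weight (Re x)" if im: "\<bar>Im x\<bar> \<le> 1" for x
  proof (cases "x = 0")
    case True
    then show ?thesis by (simp add: s0 sinhc_weight_def)
  next
    case False
    have "cmod x * 1 \<le> cmod x * (8 * sinhc_weight (Re x) * cmod (s x))"
      using cmod_le_sinh[OF im] unfolding s(2) by (simp add: norm_mult mult.left_commute mult.commute)
    then have 1: "1 \<le> 8 * sinhc_weight (Re x) * cmod (s x)" 
      using False mult_le_cancel_left_pos[of "cmod x" 1 "8 * sinhc_weight (Re x) * cmod (s x)"] by simp
    then have "s x \<noteq> 0" by auto
    then show ?thesis using 1 by (simp add: field_simps)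
  qed
  have r: "\<exists>r. s (of_real y) = of_real r \<and> r > 0 \<and> sinhc_weight y / 2 \<le> inverse r" for y
  proof (cases "y = 0")
    case True
    then show ?thesis by (intro exI[of _ 1]) (simp add: s0 sinhc_weight_def)
  next
    case False
    have sr: "sinh (complex_of_real y) = of_real (sinh y)"
      by (simp add: sinh_field_def exp_of_real flip: of_real_minus)
    have "s (of_real y) = of_real (sinh y / y)"
      using s(2)[of "of_real y"] False unfolding sr by (simp add: field_simps)
    moreover have eq: "sinh y / y = sinh \<bar>y\<bar> / \<bar>y\<bar>" by (cases "y > 0") auto
    moreover have "sinh \<bar>y\<bar> / \<bar>y\<bar> > 0" using False by simp
    moreover have "sinhc_weight y / 2 \<le> inverse (sinh \<bar>y\<bar> / \<bar>y\<bar>)"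
      using sinh_le_weight[of "\<bar>y\<bar>"] False by (simp add: sinhc_weight_def)
    ultimately show ?thesis by (intro exI[of _ "sinh y / y"]) simp
  qed
  show ?thesis using that s b r by blast
qed

section \<open>Directional derivatives on the real subspace\<close>

text \<open>Complex derivatives in real directions are real derivatives, and by induction this holds for their
  restrictions to the real subspace of the complexification.\<close>

lemma foldr_dir_deriv_cderiv:
  fixes f :: "'r::finite spectral \<Rightarrow> complex"
  assumes f: "csp.line_holomorphic f U" "continuous_on U f" "open U" and U: "\<And>X. (X, 0) \<in> U"
    and h: "\<And>X. h X = f (X, 0)"
  shows "foldr dir_deriv \<xi>s h X = foldr csp.cderiv (map (\<lambda>\<xi>. (\<xi>, 0)) \<xi>s) f (X, 0)"
proof (induction \<xi>s arbitrary: X)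
  case Nil
  then show ?case by (simp add: h)
next
  case (Cons \<xi> \<xi>s)
  let ?g = "foldr csp.cderiv (map (\<lambda>\<xi>. (\<xi>, 0)) \<xi>s) f"
  have g: "csp.line_holomorphic ?g U" using csp.foldr_cderiv_line_holomorphic[OF f] by blast
  have "((\<lambda>t. ?g ((X, 0) + csc t (\<xi>, 0))) has_field_derivative csp.cderiv (\<xi>, 0) ?g (X, 0)) (at (of_real 0))"
    using csp.cderiv_works[OF g f(3) U] by simp
  then have "((\<lambda>t. ?g ((X, 0) + csc (of_real t) (\<xi>, 0))) has_vector_derivative csp.cderiv (\<xi>, 0) ?g (X, 0)) (at 0)"
    by (rule has_vector_derivative_real_field)
  moreover have "(\<lambda>t. ?g ((X, 0) + csc (of_real t) (\<xi>, 0))) = (\<lambda>t. foldr dir_deriv \<xi>s h (X + t *\<^sub>R \<xi>))"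
    by (simp add: Cons.IH csp.sc_real)
  ultimately have "vector_derivative (\<lambda>t. foldr dir_deriv \<xi>s h (X + t *\<^sub>R \<xi>)) (at 0) = csp.cderiv (\<xi>, 0) ?g (X, 0)"
    by (simp add: vector_derivative_at)
  then show ?case by (simp add: dir_deriv_def[of \<xi>])
qed

section \<open>The estimate for spherical functions\<close>

lemma cmod_cbil_le: "cmod (cbil z X) \<le> 2 * norm z * norm X"
proof -
  have "cbil z X = cpair z (fst X) + \<i> * cpair z (snd X)"
    by (simp add: cbil_def cpair_def complex_eq_iff)
  then have "cmod (cbil z X) \<le> cmod (cpair z (fst X)) + cmod (cpair z (snd X))"
    by (metis norm_triangle_ineq norm_mult norm_ii mult_1)
  also have "\<dots> \<le> norm z * norm X + norm z * norm X"
    using norm_fst_le[of "fst X" "snd X"] norm_snd_le[of "snd X" "fst X"]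
    by (intro add_mono order_trans[OF cmod_cpair_le] mult_left_mono) auto
  finally show ?thesis by (simp add: mult_ac)
qed

lemma norm_act: "w \<in> reflection_group \<Phi> \<Longrightarrow> norm (act w z) = norm z"
  using reflection_group_inner[of w \<Phi> "fst z" "fst z"] reflection_group_inner[of w \<Phi> "snd z" "snd z"]
  by (simp add: act_def norm_prod_def power2_norm_eq_inner)

lemma exp_sum_shift:
  assumes \<Phi>: "root_set \<Phi>" and d: "norm z * norm \<delta> \<le> 1"
  shows "exp_sum \<Phi> z (X + \<delta>) \<le> exp 2 * exp_sum \<Phi> z X"
  unfolding exp_sum_def sum_distrib_left
proof (rule sum_mono)
  fix w assume w: "w \<in> reflection_group \<Phi>"
  have "Re (cbil (act w z) \<delta>) \<le> cmod (cbil (act w z) \<delta>)" by (rule complex_Re_le_cmod)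
  also have "\<dots> \<le> 2 * (norm z * norm \<delta>)" using cmod_cbil_le[of "act w z" \<delta>] norm_act[OF w] by simp
  also have "\<dots> \<le> 2" using d by simp
  finally show "exp (Re (cbil (act w z) (X + \<delta>))) \<le> exp 2 * exp (Re (cbil (act w z) X))"
    by (simp add: cbil_add_right flip: exp_add)
qed

lemma inverse_le_scaled:
  fixes x y :: real
  assumes "y \<le> k * x" "0 < x" "0 < y"
  shows "inverse x \<le> k * inverse y"
  using assms by (simp add: field_simps)

text \<open>A displacement of size \<open>1 / (c \<parallel>z\<parallel>)\<close> changes \<open>|\<langle>X, \<alpha>\<rangle>| |\<langle>w z, \<alpha>\<rangle>|\<close> by at most \<open>c\<close>.\<close>

lemma decay_sum_shift:
  assumes \<Phi>: "root_set \<Phi>" and c: "c \<ge> 0" "\<And>\<alpha>. \<alpha> \<in> pos_roots v \<Phi> \<Longrightarrow> norm \<alpha> \<le> c"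
    and d: "c * norm z * norm \<delta> \<le> 1"
  shows "decay_sum v \<Phi> z (X + \<delta>) \<le> (1 + c) ^ card (pos_roots v \<Phi>) * decay_sum v \<Phi> z X"
  unfolding decay_sum_def sum_distrib_left
proof (rule sum_mono)
  fix w assume w: "w \<in> reflection_group \<Phi>"
  have fin: "finite (pos_roots v \<Phi>)" using \<Phi> by (simp add: pos_roots_def root_set_def)
  show "decay (pos_roots v \<Phi>) (act w z) (X + \<delta>) \<le> (1 + c) ^ card (pos_roots v \<Phi>) * decay (pos_roots v \<Phi>) (act w z) X"
    unfolding decay_def
  proof (rule prod_factor_bound[OF fin])
    fix \<alpha> assume a: "\<alpha> \<in> pos_roots v \<Phi>"
    let ?x = "cmod (cpair X \<alpha>)" and ?y = "cmod (cpair (X + \<delta>) \<alpha>)" and ?t = "cmod (cpair (act w z) \<alpha>)"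
    have na: "norm \<alpha> \<le> c" by (rule c(2)[OF a])
    have "?x \<le> ?y + cmod (cpair \<delta> \<alpha>)"
      using norm_triangle_ineq4[of "cpair (X + \<delta>) \<alpha>" "cpair \<delta> \<alpha>"] by (simp add: cpair_add)
    then have "?x * ?t \<le> (?y + cmod (cpair \<delta> \<alpha>)) * ?t" by (intro mult_right_mono) auto
    moreover have "cmod (cpair \<delta> \<alpha>) * ?t \<le> c"
    proof -
      have t1: "cmod (cpair \<delta> \<alpha>) \<le> norm \<delta> * c"
        using cmod_cpair_le[of \<delta> \<alpha>] mult_left_mono[OF na norm_ge_zero[of \<delta>]] by linarith
      have t2: "?t \<le> norm z * c"
        using cmod_cpair_le[of "act w z" \<alpha>] norm_act[OF w, of z] mult_left_mono[OF na norm_ge_zero[of z]] by simp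
      have "cmod (cpair \<delta> \<alpha>) * ?t \<le> (norm \<delta> * c) * (norm z * c)"
        using t1 t2 c(1) by (intro mult_mono) auto
      also have "\<dots> = c * (c * norm z * norm \<delta>)" by (simp add: mult_ac)
      also have "\<dots> \<le> c * 1" using d c(1) by (intro mult_left_mono) auto
      finally show ?thesis by simp
    qed
    ultimately have "1 + ?x * ?t \<le> 1 + ?y * ?t + c" by (simp add: distrib_right)
    also have "\<dots> \<le> (1 + c) * (1 + ?y * ?t)" using c(1) by (simp add: algebra_simps)
    finally have "inverse (1 + ?y * ?t) \<le> (1 + c) * inverse (1 + ?x * ?t)"
      using c(1) by (intro inverse_le_scaled) (auto intro!: add_pos_nonneg)
    then show "0 \<le> inverse (1 + ?y * ?t) \<and> inverse (1 + ?y * ?t) \<le> (1 + c) * inverse (1 + ?x * ?t)"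
      by simp
  qed (use c(1) in auto)
qed

lemma decay_sum_le_R_fun:
  fixes \<zeta> :: "'r::finite spectral"
  assumes \<Phi>: "root_set \<Phi>" and c: "c \<ge> 1" "\<And>\<alpha>. \<alpha> \<in> pos_roots v \<Phi> \<Longrightarrow> 2 / (\<alpha> \<bullet> \<alpha>) \<le> c"
  shows "decay_sum v \<Phi> (csc \<i> \<zeta>) (X, 0) \<le> c ^ card (pos_roots v \<Phi>) * R_fun (reflection_group \<Phi>) (pos_roots v \<Phi>) \<zeta> X"
  unfolding decay_sum_def R_fun_def sum_distrib_left
proof (rule sum_mono)
  fix w assume w: "w \<in> reflection_group \<Phi>"
  have fin: "finite (pos_roots v \<Phi>)" using \<Phi> by (simp add: pos_roots_def root_set_def)
  show "decay (pos_roots v \<Phi>) (act w (csc \<i> \<zeta>)) (X, 0) \<le> c ^ card (pos_roots v \<Phi>) *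
      (\<Prod>\<alpha>\<in>pos_roots v \<Phi>. inverse (1 + \<bar>\<alpha> \<bullet> X\<bar> * cmod (cpair (act w \<zeta>) (coroot \<alpha>))))"
    unfolding decay_def
  proof (rule prod_factor_bound[OF fin])
    fix \<alpha> assume a: "\<alpha> \<in> pos_roots v \<Phi>"
    let ?x = "\<bar>\<alpha> \<bullet> X\<bar>" and ?t = "cmod (cpair (act w \<zeta>) \<alpha>)" and ?k = "2 / (\<alpha> \<bullet> \<alpha>)"
    have k: "?k \<ge> 0" by simp
    have e1: "cmod (cpair (X, 0) \<alpha>) = ?x" by (simp add: cpair_real inner_commute)
    have e2: "cmod (cpair (act w (csc \<i> \<zeta>)) \<alpha>) = ?t"
      by (simp add: act_csc reflection_group_linear[OF w] cpair_csc norm_mult)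
    have e3: "cmod (cpair (act w \<zeta>) (coroot \<alpha>)) = ?k * ?t"
      by (simp add: coroot_def cpair_scaleR_right norm_mult norm_divide)
    have "?x * (?k * ?t) \<le> ?x * (c * ?t)" using c(2)[OF a] by (intro mult_left_mono mult_right_mono) auto
    then have "1 + ?x * (?k * ?t) \<le> c * (1 + ?x * ?t)" using c(1) by (simp add: algebra_simps)
    then have "inverse (1 + ?x * ?t) \<le> c * inverse (1 + ?x * (?k * ?t))"
      by (intro inverse_le_scaled) (auto intro!: add_pos_nonneg mult_nonneg_nonneg)
    then show "0 \<le> inverse (1 + cmod (cpair (X, 0) \<alpha>) * cmod (cpair (act w (csc \<i> \<zeta>)) \<alpha>)) \<and>
       inverse (1 + cmod (cpair (X, 0) \<alpha>) * cmod (cpair (act w (csc \<i> \<zeta>)) \<alpha>)) \<le>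
       c * inverse (1 + \<bar>\<alpha> \<bullet> X\<bar> * cmod (cpair (act w \<zeta>) (coroot \<alpha>)))"
      unfolding e1 e2 e3 by simp
  qed (use c(1) in auto)
qed

lemma exp_sum_le_h_fun:
  assumes \<Phi>: "root_set \<Phi>"
  shows "exp_sum \<Phi> (csc \<i> \<zeta>) (X, 0) \<le> real (card (reflection_group \<Phi>)) * exp (h_fun (reflection_group \<Phi>) (snd \<zeta>) X)"
proof -
  let ?W = "reflection_group \<Phi>"
  have "exp_sum \<Phi> (csc \<i> \<zeta>) (X, 0) \<le> (\<Sum>w\<in>?W. exp (h_fun ?W (snd \<zeta>) X))"
    unfolding exp_sum_def
  proof (rule sum_mono)
    fix w assume w: "w \<in> ?W"
    have "Re (cbil (act w (csc \<i> \<zeta>)) (X, 0)) = - (w (snd \<zeta>) \<bullet> X)"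
      using reflection_group_linear[OF w]
      by (simp add: act_csc cbil_csc_left cbil_real_right cpair_csc) (simp add: cpair_def act_def)
    also have "\<dots> \<le> h_fun ?W (snd \<zeta>) X"
      unfolding h_fun_def using w finite_reflection_group[OF \<Phi>] by (intro Max_ge) auto
    finally show "exp (Re (cbil (act w (csc \<i> \<zeta>)) (X, 0))) \<le> exp (h_fun ?W (snd \<zeta>) X)" by simp
  qed
  then show ?thesis by simp
qed

text \<open>On the regular set the formula for the spherical function is the right-hand side, which is continuous
  everywhere; the regular set accumulates at every point, so the limit that defines the extension is
  the right-hand side too. The constant is positive because the sum of the positive roots is regular
  dominant.\<close>

lemma spherical_extension:
  fixes \<Phi> :: "(real^'r) set" and s :: "complex \<Rightarrow> complex"
  assumes \<Phi>: "root_set \<Phi>" and v: "\<And>\<alpha>. \<alpha> \<in> \<Phi> \<Longrightarrow> \<alpha> \<bullet> v \<noteq> 0"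
  defines "P \<equiv> pos_roots v \<Phi>"
  assumes F: "continuous_on UNIV F" "\<And>z X. alt_sum \<Phi> z X = cprod P z * cprod P X * F (z, X)"
    and s: "s holomorphic_on UNIV" "\<And>x. sinh x = x * s x" "\<And>y. s (of_real y) \<noteq> 0"
  obtains \<kappa> where "\<kappa> > 0" "\<And>\<zeta> X. spherical (reflection_group \<Phi>) P \<zeta> X =
     of_real \<kappa> * F (csc \<i> \<zeta>, (X, 0)) * (\<Prod>\<alpha>\<in>P. inverse (s (cpair (X, 0) \<alpha>)))"
proof -
  let ?W = "reflection_group \<Phi>"
  have finP: "finite P" and P\<Phi>: "P \<subseteq> \<Phi>" using \<Phi> by (auto simp: P_def pos_roots_def root_set_def)
  define N where "N = card P"
  define kP where "kP = (\<Prod>\<alpha>\<in>P. 2 / (\<alpha> \<bullet> \<alpha>))"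
  have a0: "\<alpha> \<noteq> 0" if "\<alpha> \<in> P" for \<alpha> using that P\<Phi> \<Phi> by (auto simp: root_set_def)
  have kP: "kP > 0" unfolding kP_def using a0 by (intro prod_pos) auto
  have pi: "pi_vee P \<nu> = of_real kP * cprod P \<nu>" for \<nu>
    by (simp add: pi_vee_def cprod_def kP_def coroot_def cpair_scaleR_right flip: prod.distrib)
  define \<rho>P where "\<rho>P = (\<Prod>\<alpha>\<in>P. (\<Sum>\<beta>\<in>P. \<beta>) \<bullet> \<alpha>)"
  have \<rho>P: "\<rho>P > 0" unfolding \<rho>P_def
    using sum_pos_dominant[OF \<Phi>] by (intro prod_pos) (auto simp: P_def)
  define \<kappa> where "\<kappa> = \<rho>P / 2 ^ N"
  have \<kappa>: "\<kappa> > 0" using \<rho>P by (simp add: \<kappa>_def)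
  have pi2: "pi_vee P (2 *\<^sub>R rho P, 0) = of_real kP * of_real \<rho>P"
    by (simp add: pi rho_def \<rho>P_def cprod_def cpair_real)
  define \<phi> where "\<phi> p = of_real \<kappa> * F (csc \<i> (fst p), (snd p, 0)) * (\<Prod>\<alpha>\<in>P. inverse (s (cpair (snd p, 0) \<alpha>)))"
    for p :: "'r spectral \<times> (real^'r)"
  have reg: "spherical_regular ?W P (fst p) (snd p) = \<phi> p" if "p \<in> regular_set P" for p
  proof -
    obtain \<zeta> X where p: "p = (\<zeta>, X)" by (cases p)
    have r: "\<And>\<alpha>. \<alpha> \<in> P \<Longrightarrow> cpair \<zeta> (coroot \<alpha>) \<noteq> 0" "\<And>\<alpha>. \<alpha> \<in> P \<Longrightarrow> \<alpha> \<bullet> X \<noteq> 0"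
      using that unfolding p regular_set_def by auto
    have nz: "cprod P (csc \<i> \<zeta>) \<noteq> 0" "cprod P (X, 0) \<noteq> 0"
      using r a0 unfolding cprod_nonzero[OF finP]
      by (auto simp: cpair_csc cpair_real inner_commute coroot_def cpair_scaleR_right)
    have ti: "times_i \<zeta> = csc \<i> \<zeta>" by (simp add: times_i_def csc_def)
    have num: "(\<Sum>w\<in>?W. of_real (det (matrix w)) * exp (\<i> * cpair (act w \<zeta>) X)) = cprod P (csc \<i> \<zeta>) * cprod P (X, 0) * F (csc \<i> \<zeta>, (X, 0))"
      unfolding F(2)[symmetric] alt_sum_def
      by (intro sum.cong HOL.refl) (simp add: act_csc reflection_group_linear cbil_csc_left cbil_real_right cpair_csc)
    have "complex_of_real (\<Prod>\<alpha>\<in>P. 2 * sinh (\<alpha> \<bullet> X)) = (\<Prod>\<alpha>\<in>P. 2 * (cpair (X, 0) \<alpha> * s (cpair (X, 0) \<alpha>)))"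
      unfolding of_real_prod s(2)[symmetric] cpair_real
      by (intro prod.cong HOL.refl) (simp add: sinh_field_def exp_of_real inner_commute flip: of_real_minus)
    also have "\<dots> = 2 ^ N * cprod P (X, 0) * (\<Prod>\<alpha>\<in>P. s (cpair (X, 0) \<alpha>))"
      by (simp add: prod.distrib N_def cprod_def)
    finally have den: "complex_of_real (\<Prod>\<alpha>\<in>P. 2 * sinh (\<alpha> \<bullet> X)) = 2 ^ N * cprod P (X, 0) * (\<Prod>\<alpha>\<in>P. s (cpair (X, 0) \<alpha>))" .
    have S: "(\<Prod>\<alpha>\<in>P. s (cpair (X, 0) \<alpha>)) \<noteq> 0" using finP s(3) by (simp add: cpair_real)
    have "spherical_regular ?W P \<zeta> X = (of_real kP * of_real \<rho>P) / (of_real kP * cprod P (csc \<i> \<zeta>)) *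
      (cprod P (csc \<i> \<zeta>) * cprod P (X, 0) * F (csc \<i> \<zeta>, (X, 0)) / (2 ^ N * cprod P (X, 0) * (\<Prod>\<alpha>\<in>P. s (cpair (X, 0) \<alpha>))))"
      unfolding spherical_regular_def num den pi2 unfolding pi ti by simp
    also have "\<dots> = of_real \<kappa> * F (csc \<i> \<zeta>, (X, 0)) * inverse (\<Prod>\<alpha>\<in>P. s (cpair (X, 0) \<alpha>))"
      using nz S kP by (simp add: field_simps \<kappa>_def)
    also have "inverse (\<Prod>\<alpha>\<in>P. s (cpair (X, 0) \<alpha>)) = (\<Prod>\<alpha>\<in>P. inverse (s (cpair (X, 0) \<alpha>)))"
      using prod_inversef[of "\<lambda>\<alpha>. s (cpair (X, 0) \<alpha>)" P] by (simp add: o_def)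
    also have "of_real \<kappa> * F (csc \<i> \<zeta>, (X, 0)) * \<dots> = \<phi> p" by (simp add: p \<phi>_def)
    finally show ?thesis by (simp add: p)
  qed
  have cont: "(\<phi> \<longlongrightarrow> \<phi> p) (at p within S)" for p S
  proof -
    have F': "((\<lambda>p. F (csc \<i> (fst p), (snd p, 0))) \<longlongrightarrow> F (csc \<i> (fst p), (snd p, 0))) (at p within S)"
      by (rule continuous_on_tendsto_compose[OF F(1)])
        (intro tendsto_intros bounded_linear.tendsto[OF bounded_linear_Pair], auto simp: csc_def intro!: tendsto_intros)
    have sc: "isCont s x" for x using holomorphic_on_imp_continuous_on[OF s(1)] by (simp add: continuous_on_eq_continuous_at)
    have s': "((\<lambda>p. inverse (s (cpair (snd p, 0) \<alpha>))) \<longlongrightarrow> inverse (s (cpair (snd p, 0) \<alpha>))) (at p within S)" for \<alpha>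
      by (intro tendsto_inverse isCont_tendsto_compose[OF sc] tendsto_cpair tendsto_Pair tendsto_snd tendsto_const tendsto_ident_at)
        (simp add: cpair_real s(3))
    show ?thesis unfolding \<phi>_def by (intro tendsto_mult tendsto_const F' tendsto_prod s')
  qed
  have nb: "at p within regular_set P \<noteq> bot" for p :: "'r spectral \<times> (real^'r)"
  proof -
    \<comment> \<open>The axis is added to the root vectors to make \<open>d\<close> nonzero even when there are no roots.\<close>
    obtain k :: 'r where True by simp
    have "\<exists>d. \<forall>a\<in>insert (axis k 1) P. a \<bullet> d \<noteq> 0"
      using finP a0 by (intro avoid_hyperplanes) (auto simp: axis_eq_0_iff)
    then obtain d where d: "\<And>a. a \<in> P \<Longrightarrow> a \<bullet> d \<noteq> 0" "axis k 1 \<bullet> d \<noteq> 0" by auto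
    then have d0: "d \<noteq> 0" by auto
    let ?p = "\<lambda>n. p + inverse (real (Suc n)) *\<^sub>R ((d, 0), d)"
    have "\<forall>\<^sub>F n in sequentially. \<forall>a\<in>P. cpair (fst p + inverse (real (Suc n)) *\<^sub>R (d, 0)) a \<noteq> 0"
      by (rule eventually_cpair_nonzero[OF finP d(1)])
    moreover have "\<forall>\<^sub>F n in sequentially. \<forall>a\<in>P. cpair ((snd p, 0) + inverse (real (Suc n)) *\<^sub>R (d, 0)) a \<noteq> 0"
      by (rule eventually_cpair_nonzero[OF finP d(1)])
    ultimately have ev: "\<forall>\<^sub>F n in sequentially. ?p n \<in> regular_set P - {p}"
    proof eventually_elim
      case (elim n)
      have mem: "q \<in> regular_set P \<longleftrightarrow> (\<forall>\<alpha>\<in>P. cpair (fst q) (coroot \<alpha>) \<noteq> 0 \<and> \<alpha> \<bullet> snd q \<noteq> 0)"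
        for q :: "'r spectral \<times> (real^'r)"
        by (cases q) (simp add: regular_set_def)
      have "inverse (real (Suc n)) *\<^sub>R ((d, 0 :: real^'r), d) \<noteq> 0" using d0 by (simp add: zero_prod_def del: of_nat_Suc)
      then have "?p n \<noteq> p" by simp
      moreover have "?p n \<in> regular_set P"
        unfolding mem
      proof (intro ballI conjI)
        fix \<alpha> assume a: "\<alpha> \<in> P"
        show "cpair (fst (?p n)) (coroot \<alpha>) \<noteq> 0"
          using bspec[OF elim(1) a] a0[OF a] by (simp add: coroot_def cpair_scaleR_right del: of_nat_Suc)
        have "(snd p, 0) + inverse (real (Suc n)) *\<^sub>R (d, 0) = (snd (?p n), 0 :: real^'r)" by simp
        then show "\<alpha> \<bullet> snd (?p n) \<noteq> 0"
          using bspec[OF elim(2) a] by (simp only: cpair_real inner_commute of_real_eq_0_iff) simp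
      qed
      ultimately show ?case by blast
    qed
    have lim: "?p \<longlonglongrightarrow> p" by (rule tendsto_perturb)
    obtain M where M: "\<And>n. n \<ge> M \<Longrightarrow> ?p n \<in> regular_set P - {p}" using ev by (auto simp: eventually_sequentially)
    have "p islimpt regular_set P"
      unfolding islimpt_sequential
      by (intro exI[of _ "\<lambda>n. ?p (n + M)"] conjI allI M LIMSEQ_ignore_initial_segment[OF lim]) simp
    then show ?thesis by (simp add: trivial_limit_within)
  qed
  have "spherical ?W P \<zeta> X = \<phi> (\<zeta>, X)" for \<zeta> X
    unfolding spherical_def
  proof (rule tendsto_Lim[OF nb])
    show "((\<lambda>(\<zeta>', X'). spherical_regular ?W P \<zeta>' X') \<longlongrightarrow> \<phi> (\<zeta>, X)) (at (\<zeta>, X) within regular_set P)"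
      by (rule Lim_transform_within[OF cont zero_less_one]) (use reg in \<open>auto simp: case_prod_beta\<close>)
  qed
  then show ?thesis using that[OF \<kappa>] by (simp add: \<phi>_def)
qed


text \<open>On the tube \<open>|Im \<langle>Y, \<alpha>\<rangle>| < 1\<close> the spherical function extends to \<open>f \<zeta> Y\<close>. If \<open>Y\<close> has distance at most
  \<open>1 / (2 a (1 + \<parallel>\<zeta>\<parallel>))\<close> from \<open>X\<close>, the bounds for \<open>F\<close> and for the factors \<open>\<alpha>(Y) / sinh \<alpha>(Y)\<close> at \<open>Y\<close> are
  bounded by constant multiples of those at \<open>X\<close>. Iterated Cauchy estimates, with a fraction \<open>1 / (k + 1)\<close> of this radius for
  each of the \<open>k\<close> derivatives, give the result.\<close>

theorem reflection_group_estimate: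
  fixes \<Phi> :: "(real^'r) set"
  assumes \<Phi>: "root_set \<Phi>" and v: "\<And>\<alpha>. \<alpha> \<in> \<Phi> \<Longrightarrow> \<alpha> \<bullet> v \<noteq> 0"
  defines "P \<equiv> pos_roots v \<Phi>" and "W \<equiv> reflection_group \<Phi>"
  shows "\<exists>C>0. \<forall>(\<zeta> :: 'r spectral) (X :: real^'r) (\<xi>s :: (real^'r) list).
           length \<xi>s = k \<and> (\<forall>\<xi>\<in>set \<xi>s. norm \<xi> = 1) \<longrightarrow>
           cmod (foldr dir_deriv \<xi>s (spherical W P \<zeta>) X) \<le>
             C * (1 + norm \<zeta>) ^ k * spherical0 W P X * exp (h_fun W (snd \<zeta>) X) * R_fun W P \<zeta> X"
proof -
  have finP: "finite P" and P\<Phi>: "P \<subseteq> \<Phi>" using \<Phi> by (auto simp: P_def pos_roots_def root_set_def)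
  define N where "N = card P"
  obtain F C where F: "continuous_on UNIV F" "csp2.line_holomorphic F UNIV"
    "\<And>z X. alt_sum \<Phi> z X = cprod P z * cprod P X * F (z, X)"
    "C \<ge> 0" "\<And>z X. cmod (F (z, X)) \<le> C * exp_sum \<Phi> z X * decay_sum v \<Phi> z X"
    using Harish_Chandra_quotient[OF \<Phi> v] unfolding P_def by blast
  obtain c where c: "c > 0" "\<And>X. F (0, X) = of_real c"
    using Harish_Chandra_normalization[OF \<Phi> v F(1) F(3)[unfolded P_def]] by blast
  obtain s :: "complex \<Rightarrow> complex" where s: "s holomorphic_on UNIV" "\<And>x. sinh x = x * s x"
    "\<And>x. \<bar>Im x\<bar> \<le> 1 \<Longrightarrow> s x \<noteq> 0 \<and> inverse (cmod (s x)) \<le> 8 * sinhc_weight (Re x)"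
    "\<And>y. \<exists>r. s (of_real y) = of_real r \<and> r > 0 \<and> sinhc_weight y / 2 \<le> inverse r"
    using sinhc_exists by blast
  obtain \<kappa> where \<kappa>: "\<kappa> > 0" "\<And>\<zeta> X. spherical W P \<zeta> X =
     of_real \<kappa> * F (csc \<i> \<zeta>, (X, 0)) * (\<Prod>\<alpha>\<in>P. inverse (s (cpair (X, 0) \<alpha>)))"
  proof (rule spherical_extension[OF \<Phi> v F(1) F(3)[unfolded P_def] s(1,2)])
    show "s (of_real y) \<noteq> 0" for y using s(3)[of "of_real y"] by simp
  qed (auto simp: P_def W_def)
  have g: "sinhc_weight y \<ge> 0" for y by (rule sinhc_weight_nonneg)
  have sph0: "spherical0 W P X \<ge> \<kappa> * c * (1 / 2) ^ N * (\<Prod>\<alpha>\<in>P. sinhc_weight (\<alpha> \<bullet> X))" for X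
  proof -
    obtain r where r: "\<And>y. s (of_real y) = of_real (r y)" "\<And>y. r y > 0" "\<And>y. sinhc_weight y / 2 \<le> inverse (r y)"
      using s(4) by metis
    have zero: "csc \<i> (0, 0 :: real^'r) = 0" by (simp add: csc_def zero_prod_def)
    have "spherical W P (0, 0) X = of_real (\<kappa> * c * (\<Prod>\<alpha>\<in>P. inverse (r (\<alpha> \<bullet> X))))"
      by (simp add: \<kappa>(2) zero c(2) cpair_real r(1) inner_commute)
    then have "spherical0 W P X = \<kappa> * c * (\<Prod>\<alpha>\<in>P. inverse (r (\<alpha> \<bullet> X)))"
      unfolding spherical0_def by (simp only: Re_complex_of_real)
    moreover have "(1 / 2) ^ N * (\<Prod>\<alpha>\<in>P. sinhc_weight (\<alpha> \<bullet> X)) = (\<Prod>\<alpha>\<in>P. sinhc_weight (\<alpha> \<bullet> X) / 2)"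
      by (simp add: prod_dividef N_def power_one_over)
    moreover have "\<dots> \<le> (\<Prod>\<alpha>\<in>P. inverse (r (\<alpha> \<bullet> X)))"
      using r(3) g by (intro prod_mono) auto
    ultimately show ?thesis using \<kappa>(1) c(1) by (simp add: mult.assoc)
  qed
  \<comment> \<open>Crude common bounds for the lengths of the roots and for the ratios of coroots to roots.\<close>
  define a where "a = 1 + (\<Sum>\<alpha>\<in>P. norm \<alpha>)"
  have a: "a \<ge> 1" "\<And>\<alpha>. \<alpha> \<in> P \<Longrightarrow> norm \<alpha> \<le> a"
    using member_le_sum[of _ P norm] finP by (fastforce simp: a_def intro: sum_nonneg)+
  define b where "b = 1 + (\<Sum>\<alpha>\<in>P. 2 / (\<alpha> \<bullet> \<alpha>))"
  have b: "b \<ge> 1" "\<And>\<alpha>. \<alpha> \<in> P \<Longrightarrow> 2 / (\<alpha> \<bullet> \<alpha>) \<le> b"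
    using member_le_sum[of _ P "\<lambda>\<alpha>. 2 / (\<alpha> \<bullet> \<alpha>)"] finP by (fastforce simp: b_def intro: sum_nonneg)+
  define D where "D = \<kappa> * C * exp 2 * real (card W) * (1 + a) ^ N * b ^ N * (16 * exp 1) ^ N"
  have D: "D \<ge> 0" using \<kappa>(1) F(4) a(1) b(1) by (simp add: D_def)
  define U where "U = {Y :: 'r spectral. \<forall>\<alpha>\<in>P. \<bar>Im (cpair Y \<alpha>)\<bar> < 1}"
  have cont_cpair: "continuous_on S (\<lambda>Y. cpair Y \<alpha>)" for S :: "'r spectral set" and \<alpha>
    unfolding continuous_on_def by (intro ballI tendsto_cpair tendsto_ident_at)
  have Uopen: "open U"
  proof -
    have "U = (\<Inter>\<alpha>\<in>P. {Y. \<bar>Im (cpair Y \<alpha>)\<bar> < 1})" by (auto simp: U_def)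
    moreover have "open {Y :: 'r spectral. \<bar>Im (cpair Y \<alpha>)\<bar> < 1}" for \<alpha>
      by (intro open_Collect_less continuous_intros cont_cpair)
    ultimately show ?thesis using finP by auto
  qed
  have U0: "(X, 0) \<in> U" for X by (simp add: U_def cpair_real)
  define f where "f \<zeta> Y = of_real \<kappa> * F (csc \<i> \<zeta>, Y) * (\<Prod>\<alpha>\<in>P. inverse (s (cpair Y \<alpha>)))" for \<zeta> Y
  have fcont: "continuous_on U (f \<zeta>)" for \<zeta>
  proof -
    have "continuous_on U (\<lambda>Y. F (csc \<i> \<zeta>, Y))"
      by (rule continuous_on_compose2[OF F(1)]) (auto intro!: continuous_intros)
    moreover have "continuous_on U (\<lambda>Y. inverse (s (cpair Y \<alpha>)))" if "\<alpha> \<in> P" for \<alpha>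
    proof (rule continuous_on_inverse)
      show "continuous_on U (\<lambda>Y. s (cpair Y \<alpha>))"
        by (rule continuous_on_compose2[OF holomorphic_on_imp_continuous_on[OF s(1)] cont_cpair]) auto
      show "\<forall>Y\<in>U. s (cpair Y \<alpha>) \<noteq> 0" using s(3) that by (auto simp: U_def less_imp_le)
    qed
    ultimately show ?thesis unfolding f_def
      by (intro continuous_on_mult continuous_on_const continuous_on_prod)
  qed
  have fhol: "csp.line_holomorphic (f \<zeta>) U" for \<zeta>
    unfolding csp.line_holomorphic_def
  proof (intro allI)
    fix Y \<eta> :: "'r spectral"
    let ?S = "{t. Y + csc t \<eta> \<in> U}"
    note F2 = csp2.line_holomorphicD[where x="(csc \<i> \<zeta>, Y)" and \<xi>="(0, \<eta>)" and S="?S", OF F(2)]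
    have 1: "(\<lambda>t. F (csc \<i> \<zeta>, Y + csc t \<eta>)) holomorphic_on ?S" using F2 by simp
    have 2: "(\<lambda>t. inverse (s (cpair (Y + csc t \<eta>) \<alpha>))) holomorphic_on ?S" if "\<alpha> \<in> P" for \<alpha>
    proof (rule holomorphic_on_inverse)
      have "(\<lambda>t. cpair Y \<alpha> + t * cpair \<eta> \<alpha>) holomorphic_on ?S" by (intro holomorphic_intros)
      then have "(s \<circ> (\<lambda>t. cpair Y \<alpha> + t * cpair \<eta> \<alpha>)) holomorphic_on ?S"
        using s(1) by (rule holomorphic_on_compose_gen) auto
      then show "(\<lambda>t. s (cpair (Y + csc t \<eta>) \<alpha>)) holomorphic_on ?S" by (simp add: o_def cpair_add cpair_csc)
      show "s (cpair (Y + csc t \<eta>) \<alpha>) \<noteq> 0" if "t \<in> ?S" for t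
        using s(3) that \<open>\<alpha> \<in> P\<close> by (auto simp: U_def less_imp_le)
    qed
    show "(\<lambda>t. f \<zeta> (Y + csc t \<eta>)) holomorphic_on ?S"
      unfolding f_def by (intro holomorphic_intros 1 2)
  qed
  have fbound: "Y \<in> U \<and> cmod (f \<zeta> Y) \<le>
      D * (\<Prod>\<alpha>\<in>P. sinhc_weight (\<alpha> \<bullet> X)) * exp (h_fun W (snd \<zeta>) X) * R_fun W P \<zeta> X"
    if d: "2 * a * (1 + norm \<zeta>) * dist (X, 0) Y \<le> 1" for \<zeta> X Y
  proof
    define \<delta> where "\<delta> = Y - (X, 0)"
    have Y: "Y = (X, 0) + \<delta>" by (simp add: \<delta>_def)
    have nd: "dist (X, 0) Y = norm \<delta>" by (simp add: \<delta>_def dist_norm norm_minus_commute)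
    have d0: "norm \<delta> \<ge> 0" by simp
    have m: "a * norm \<delta> \<ge> 0" "a * norm \<delta> * norm \<zeta> \<ge> 0" "norm \<delta> * norm \<zeta> \<ge> 0" using a(1) by auto
    have "a * norm \<delta> + a * norm \<delta> * norm \<zeta> \<le> 1 / 2" using d unfolding nd by (simp add: algebra_simps)
    then have d1: "a * norm \<delta> \<le> 1 / 2" and d2: "a * norm \<zeta> * norm \<delta> \<le> 1"
      using m by (auto simp: mult.assoc mult.left_commute mult.commute)
    have "norm \<zeta> * norm \<delta> \<le> a * (norm \<zeta> * norm \<delta>)" using a(1) m by (intro mult_right_mono[of 1 a, simplified]) (auto simp: mult.commute)
    then have d3: "norm \<zeta> * norm \<delta> \<le> 1" using d2 by (simp add: mult.assoc)
    have cd: "cmod (cpair \<delta> \<alpha>) \<le> 1 / 2" if "\<alpha> \<in> P" for \<alpha>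
    proof -
      have "cmod (cpair \<delta> \<alpha>) \<le> norm \<delta> * norm \<alpha>" by (rule cmod_cpair_le)
      also have "\<dots> \<le> norm \<delta> * a" by (intro mult_left_mono a(2) that) auto
      finally show ?thesis using d1 by (simp add: mult.commute)
    qed
    have im: "\<bar>Im (cpair Y \<alpha>)\<bar> \<le> 1 / 2" if "\<alpha> \<in> P" for \<alpha>
    proof -
      have "Im (cpair Y \<alpha>) = Im (cpair \<delta> \<alpha>)" by (simp add: Y cpair_add cpair_real)
      then show ?thesis using cd[OF that] abs_Im_le_cmod[of "cpair \<delta> \<alpha>"] by linarith
    qed
    show "Y \<in> U" using im by (fastforce simp: U_def)
    have S: "(\<Prod>\<alpha>\<in>P. inverse (cmod (s (cpair Y \<alpha>)))) \<le> (16 * exp 1) ^ N * (\<Prod>\<alpha>\<in>P. sinhc_weight (\<alpha> \<bullet> X))"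
    proof -
      have "(\<Prod>\<alpha>\<in>P. inverse (cmod (s (cpair Y \<alpha>)))) \<le> (\<Prod>\<alpha>\<in>P. 16 * exp 1 * sinhc_weight (\<alpha> \<bullet> X))"
      proof (intro prod_mono conjI)
        fix \<alpha> assume \<alpha>: "\<alpha> \<in> P"
        have "inverse (cmod (s (cpair Y \<alpha>))) \<le> 8 * sinhc_weight (Re (cpair Y \<alpha>))"
          using s(3)[of "cpair Y \<alpha>"] im[OF \<alpha>] by simp
        also have "Re (cpair Y \<alpha>) = \<alpha> \<bullet> X + Re (cpair \<delta> \<alpha>)" by (simp add: Y cpair_add cpair_real inner_commute)
        also have "8 * sinhc_weight (\<alpha> \<bullet> X + Re (cpair \<delta> \<alpha>)) \<le> 8 * (2 * exp 1 * sinhc_weight (\<alpha> \<bullet> X))"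
          using cd[OF \<alpha>] abs_Re_le_cmod[of "cpair \<delta> \<alpha>"] by (intro mult_left_mono sinhc_weight_shift) auto
        finally show "inverse (cmod (s (cpair Y \<alpha>))) \<le> 16 * exp 1 * sinhc_weight (\<alpha> \<bullet> X)" by simp
      qed auto
      then show ?thesis by (simp add: prod.distrib N_def power_mult_distrib)
    qed
    have nz: "norm (csc \<i> \<zeta>) = norm \<zeta>" by (simp add: norm_csc)
    have E: "exp_sum \<Phi> (csc \<i> \<zeta>) Y \<le> exp 2 * (real (card W) * exp (h_fun W (snd \<zeta>) X))"
    proof -
      have "exp_sum \<Phi> (csc \<i> \<zeta>) Y \<le> exp 2 * exp_sum \<Phi> (csc \<i> \<zeta>) (X, 0)"
        unfolding Y by (rule exp_sum_shift[OF \<Phi>]) (simp add: nz d3)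
      also have "\<dots> \<le> exp 2 * (real (card W) * exp (h_fun W (snd \<zeta>) X))"
        unfolding W_def by (intro mult_left_mono exp_sum_le_h_fun[OF \<Phi>]) simp
      finally show ?thesis .
    qed
    have R: "decay_sum v \<Phi> (csc \<i> \<zeta>) Y \<le> (1 + a) ^ N * (b ^ N * R_fun W P \<zeta> X)"
    proof -
      have "decay_sum v \<Phi> (csc \<i> \<zeta>) Y \<le> (1 + a) ^ N * decay_sum v \<Phi> (csc \<i> \<zeta>) (X, 0)"
        unfolding Y N_def P_def by (rule decay_sum_shift[OF \<Phi>]) (use a d2 in \<open>auto simp: nz P_def\<close>)
      also have "\<dots> \<le> (1 + a) ^ N * (b ^ N * R_fun W P \<zeta> X)"
        unfolding W_def N_def P_def using a(1) b
        by (intro mult_left_mono decay_sum_le_R_fun[OF \<Phi>]) (auto simp: P_def)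
      finally show ?thesis .
    qed
    have "cmod (f \<zeta> Y) = \<kappa> * cmod (F (csc \<i> \<zeta>, Y)) * (\<Prod>\<alpha>\<in>P. inverse (cmod (s (cpair Y \<alpha>))))"
      using \<kappa>(1) by (simp add: f_def norm_mult prod_norm[symmetric] norm_inverse)
    also have "\<dots> \<le> \<kappa> * (C * (exp 2 * (real (card W) * exp (h_fun W (snd \<zeta>) X))) * ((1 + a) ^ N * (b ^ N * R_fun W P \<zeta> X))) *
        ((16 * exp 1) ^ N * (\<Prod>\<alpha>\<in>P. sinhc_weight (\<alpha> \<bullet> X)))"
    proof (intro mult_mono S mult_left_mono)
      show "cmod (F (csc \<i> \<zeta>, Y)) \<le> C * (exp 2 * (real (card W) * exp (h_fun W (snd \<zeta>) X))) * ((1 + a) ^ N * (b ^ N * R_fun W P \<zeta> X))"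
        using F(4) by (intro order_trans[OF F(5)] mult_mono E R mult_left_mono exp_sum_nonneg decay_sum_nonneg mult_nonneg_nonneg) auto
      then have nn: "0 \<le> C * (exp 2 * (real (card W) * exp (h_fun W (snd \<zeta>) X))) * ((1 + a) ^ N * (b ^ N * R_fun W P \<zeta> X))"
        using norm_ge_zero order_trans by blast
      show "0 \<le> \<kappa> * (C * (exp 2 * (real (card W) * exp (h_fun W (snd \<zeta>) X))) * ((1 + a) ^ N * (b ^ N * R_fun W P \<zeta> X)))"
        by (rule mult_nonneg_nonneg[OF less_imp_le[OF \<kappa>(1)] nn])
    qed (use \<kappa>(1) in \<open>auto intro!: prod_nonneg\<close>)
    also have "\<dots> = D * (\<Prod>\<alpha>\<in>P. sinhc_weight (\<alpha> \<bullet> X)) * exp (h_fun W (snd \<zeta>) X) * R_fun W P \<zeta> X"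
      by (simp only: D_def mult_ac)
    finally show "cmod (f \<zeta> Y) \<le> D * (\<Prod>\<alpha>\<in>P. sinhc_weight (\<alpha> \<bullet> X)) * exp (h_fun W (snd \<zeta>) X) * R_fun W P \<zeta> X" .
  qed
  have Rnn: "R_fun W P \<zeta> X \<ge> 0" for \<zeta> X
    unfolding R_fun_def by (intro sum_nonneg prod_nonneg) auto
  define C1 where "C1 = D * (2 ^ N / (\<kappa> * c)) * (2 * a * (real k + 1)) ^ k + 1"
  have C1: "C1 > 0" unfolding C1_def using D \<kappa>(1) c(1) a(1) by (intro add_nonneg_pos mult_nonneg_nonneg) auto
  show ?thesis
  proof (intro exI[of _ C1] conjI C1 allI impI)
    fix \<zeta> :: "'r spectral" and X :: "real^'r" and \<xi>s :: "(real^'r) list"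
    assume \<xi>: "length \<xi>s = k \<and> (\<forall>\<xi>\<in>set \<xi>s. norm \<xi> = 1)"
    define q where "q = 2 * a * (real k + 1) * (1 + norm \<zeta>)"
    define r where "r = 1 / q"
    have pos: "q > 0" unfolding q_def using a(1) by (intro mult_pos_pos) (auto intro: add_pos_nonneg)
    then have r: "r > 0" by (simp add: r_def)
    let ?p = "\<Prod>\<alpha>\<in>P. sinhc_weight (\<alpha> \<bullet> X)"
    let ?E = "exp (h_fun W (snd \<zeta>) X)" and ?R = "R_fun W P \<zeta> X"
    let ?l = "map (\<lambda>\<xi>. (\<xi>, 0 :: real^'r)) \<xi>s"
    have "cmod (foldr csp.cderiv ?l (f \<zeta>) (X, 0)) \<le> (D * ?p * ?E * ?R) / r ^ length ?l"
    proof (rule csp.foldr_cderiv_bound[OF fhol fcont Uopen r])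
      show "\<forall>\<xi>\<in>set ?l. norm \<xi> = 1" using \<xi> by (auto simp: norm_Pair)
      fix Y :: "'r spectral" assume "dist (X, 0) Y \<le> real (length ?l) * r"
      then have d: "dist (X, 0) Y \<le> real k * r" using \<xi> by simp
      have "2 * a * (1 + norm \<zeta>) * dist (X, 0) Y \<le> 2 * a * (1 + norm \<zeta>) * ((real k + 1) * r)"
      proof (rule mult_left_mono)
        show "dist (X, 0) Y \<le> (real k + 1) * r" using d r by (simp add: distrib_right)
      qed (use a(1) in auto)
      also have "\<dots> = q * r" by (simp only: q_def mult_ac)
      also have "\<dots> = 1" using pos by (simp add: r_def)
      finally show "Y \<in> U \<and> cmod (f \<zeta> Y) \<le> D * ?p * ?E * ?R" by (rule fbound)
    qed
    also have "foldr csp.cderiv ?l (f \<zeta>) (X, 0) = foldr dir_deriv \<xi>s (spherical W P \<zeta>) X"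
      by (rule foldr_dir_deriv_cderiv[OF fhol fcont Uopen U0, symmetric]) (simp add: \<kappa>(2) f_def)
    also have "(D * ?p * ?E * ?R) / r ^ length ?l = D * (2 * a * (real k + 1)) ^ k * (1 + norm \<zeta>) ^ k * ?p * ?E * ?R"
      using \<xi> by (simp add: r_def q_def power_divide power_mult_distrib mult_ac)
    also have "\<dots> \<le> D * (2 * a * (real k + 1)) ^ k * (1 + norm \<zeta>) ^ k * ((2 ^ N / (\<kappa> * c)) * spherical0 W P X) * ?E * ?R"
    proof (intro mult_right_mono mult_left_mono)
      have "(\<kappa> * c) * ?p \<le> 2 ^ N * spherical0 W P X"
        using sph0[of X] by (simp add: power_one_over field_simps)
      then show "?p \<le> (2 ^ N / (\<kappa> * c)) * spherical0 W P X"
        using \<kappa>(1) c(1) by (simp add: field_simps)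
    qed (use D a(1) Rnn in auto)
    also have "\<dots> = (C1 - 1) * ((1 + norm \<zeta>) ^ k * spherical0 W P X * ?E * ?R)"
      by (simp add: C1_def mult_ac)
    also have "\<dots> \<le> C1 * ((1 + norm \<zeta>) ^ k * spherical0 W P X * ?E * ?R)"
    proof (rule mult_right_mono)
      have "0 \<le> \<kappa> * c * (1 / 2) ^ N * ?p" using \<kappa>(1) c(1) g by (intro mult_nonneg_nonneg prod_nonneg) auto
      then have "spherical0 W P X \<ge> 0" using sph0[of X] by linarith
      then show "0 \<le> (1 + norm \<zeta>) ^ k * spherical0 W P X * ?E * ?R" using Rnn by (intro mult_nonneg_nonneg) auto
    qed simp
    finally show "cmod (foldr dir_deriv \<xi>s (spherical W P \<zeta>) X) \<le>
             C1 * (1 + norm \<zeta>) ^ k * spherical0 W P X * ?E * ?R" by (simp only: mult.assoc)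
  qed
qed

theorem theorem1p3:
  fixes br :: "complex^'n \<Rightarrow> complex^'n \<Rightarrow> complex^'n"
    and \<kk> \<pp> :: "(complex^'n) set"
    and j :: "real^'r \<Rightarrow> complex^'n"
    and \<Phi> P :: "(real^'r) set"
    and W :: "(real^'r \<Rightarrow> real^'r) set"
  assumes "complex_lie_algebra br"
    and "semisimple_lie_algebra br"
    and "cartan_decomposition br \<kk> \<pp>"
    and "maximal_abelian_param br \<pp> j"
    and "\<Phi> = roots br j"
    and "W = weyl_group br j"
    and "weyl_invariant_inner W"
    and "positive_system \<Phi> P"
  shows "\<forall>k::nat. \<exists>C>0. \<forall>(\<zeta> :: 'r spectral) (X :: real^'r) (\<xi>s :: (real^'r) list).
           length \<xi>s = k \<and> (\<forall>\<xi>\<in>set \<xi>s. norm \<xi> = 1) \<longrightarrow>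
           cmod (foldr dir_deriv \<xi>s (spherical W P \<zeta>) X) \<le>
             C * (1 + norm \<zeta>) ^ k * spherical0 W P X * exp (h_fun W (snd \<zeta>) X) * R_fun W P \<zeta> X"
proof -
  interpret restricted_roots br \<kk> \<pp> j
    using assms(1,3,4) by unfold_locales
  have inv: "weyl_invariant_inner (weyl_group br j)" using assms(6,7) by simp
  have refl: "root_reflection br j \<alpha> = reflection \<alpha>" if "\<alpha> \<in> \<Phi>" for \<alpha>
    using root_reflection_orthogonal[OF _ inv] that assms(5) by (auto simp: reflection_def)
  have \<Phi>: "root_set \<Phi>"
    unfolding root_set_def assms(5)
    using finite_roots roots_reflection_closed[OF _ _ inv] roots_reduced by (auto simp: reflection_def roots_def[of br j])
  have W: "W = reflection_group \<Phi>"
  proof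
    show "W \<subseteq> reflection_group \<Phi>"
    proof
      fix w assume "w \<in> W"
      then have "w \<in> weyl_group br j" by (simp add: assms(6))
      then show "w \<in> reflection_group \<Phi>"
      proof induction
        case (2 \<alpha> w)
        then have "\<alpha> \<in> \<Phi>" by (simp add: assms(5))
        then show ?case using 2 refl reflection_group_step by metis
      qed (rule reflection_group_id)
    qed
    show "reflection_group \<Phi> \<subseteq> W"
    proof
      fix w assume "w \<in> reflection_group \<Phi>"
      then show "w \<in> W"
      proof induction
        case (reflection_group_step \<alpha> w)
        then have "root_reflection br j \<alpha> \<circ> w \<in> weyl_group br j"
          using assms(5,6) by (intro weyl_group.intros) auto
        then show ?case by (simp only: refl[OF reflection_group_step(1)] assms(6))
      qed (simp only: assms(6) weyl_group.intros(1))
    qed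
  qed
  obtain v where v: "\<And>\<alpha>. \<alpha> \<in> \<Phi> \<Longrightarrow> \<alpha> \<bullet> v \<noteq> 0" "P = pos_roots v \<Phi>"
    using assms(8) by (auto simp: positive_system_def pos_roots_def)
  show ?thesis
    unfolding W v(2) using reflection_group_estimate[OF \<Phi> v(1)] by blast
qed

end
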